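(* Let $\|\cdot\|$ be any norm on $\mathbb R^d$. Then: (i) there exists an online algorithm for chasing convex functions in $(\mathbb R^d,\|\cdot\|)$ that is $(d+1)$-competitive, and whose service cost $\sum_{n=1}^N f_n(x_n)$ is at most the total cost $\mathrm{OPT}$ of the offline optimum, for every request sequence; (ii) there exists an online algorithm for chasing convex bodies in $(\mathbb R^d,\|\cdot\|)$ that is $d$-competitive. Moreover, when $\|\cdot\|$ is the Euclidean norm, these algorithms are $O(\sqrt{d\log N})$-competitive on request sequences of length $N$ (with an absolute implied constant).
   Context: Chasing convex functions: the player starts at $x_0=0\in\mathbb R^d$. For $n=1,\dots,N$, a convex function $f_n:\mathbb R^d\to[0,\infty)$ is revealed and the player then chooses $x_n\in\mathbb R^d$, depending only on $f_1,\dots,f_n$. The player's cost is $\sum_{n=1}^N\big(f_n(x_n)+\|x_n-x_{n-1}\|\big)$; the first part is the service cost and the second the movement cost. $\mathrm{OPT}$ denotes the infimum of this cost over all sequences $x_1,\dots,x_N$ chosen with full knowledge of the requests. Chasing convex bodies: same, except the requests are nonempty closed convex sets $K_n\subseteq\mathbb R^d$, the player must choose $x_n\in K_n$, and the cost is $\sum_{n=1}^N\|x_n-x_{n-1}\|$, with $\mathrm{OPT}$ the offline infimum of this cost. An online algorithm is $C$-competitive if, for every $N$ and every request sequence, its cost is at most $C\cdot\mathrm{OPT}$. *)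

theory Defs
  imports "HOL-Analysis.Analysis" "HOL-Library.Function_Algebras"
begin

text \<open>
  The implied constant of the Euclidean bound must not depend on the dimension, so the dimension is
  a natural number that can be quantified: R^d is the carrier of the library's
  \<^const>\<open>Euclidean_space\<close>, the sequences that vanish from index d on, with the
  pointwise linear structure.  Norms and requests are functions and sets on the ambient sequence
  type of which only the part over R^d is constrained or used in costs.
\<close>

instantiation "fun" :: (type, real_vector) real_vector
begin

definition scaleR_fun :: "real \<Rightarrow> ('a \<Rightarrow> 'b) \<Rightarrow> 'a \<Rightarrow> 'b"
  where "scaleR_fun c x = (\<lambda>i. c *\<^sub>R x i)"

instance
  by standard (simp_all add: scaleR_fun_def fun_eq_iff scaleR_add_right scaleR_add_left)

end

lemma scaleR_fun_apply [simp]: "(c *\<^sub>R x) i = c *\<^sub>R x i"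
  by (simp add: scaleR_fun_def)

type_synonym point = "nat \<Rightarrow> real"

abbreviation Rd :: "nat \<Rightarrow> point set"
  where "Rd d \<equiv> topspace (Euclidean_space d)"

definition norm_on_Rd :: "nat \<Rightarrow> (point \<Rightarrow> real) \<Rightarrow> bool"
  where "norm_on_Rd d nrm \<longleftrightarrow>
    (\<forall>x\<in>Rd d. 0 \<le> nrm x \<and> (nrm x = 0 \<longleftrightarrow> x = 0)) \<and>
    (\<forall>x\<in>Rd d. \<forall>c. nrm (c *\<^sub>R x) = \<bar>c\<bar> * nrm x) \<and>
    (\<forall>x\<in>Rd d. \<forall>y\<in>Rd d. nrm (x + y) \<le> nrm x + nrm y)"

definition euclidean_norm_on_Rd :: "nat \<Rightarrow> (point \<Rightarrow> real) \<Rightarrow> bool"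
  where "euclidean_norm_on_Rd d nrm \<longleftrightarrow> (\<forall>x\<in>Rd d. nrm x = L2_set x {..<d})"

definition function_request :: "nat \<Rightarrow> (point \<Rightarrow> real) \<Rightarrow> bool"
  where "function_request d f \<longleftrightarrow> convex_on (Rd d) f \<and> (\<forall>x\<in>Rd d. 0 \<le> f x)"

definition body_request :: "nat \<Rightarrow> point set \<Rightarrow> bool"
  where "body_request d K \<longleftrightarrow> K \<noteq> {} \<and> closedin (Euclidean_space d) K \<and> convex K"

text \<open>
  Request sequences and trajectories are indexed as in the problem: the requests are
  r 1, ..., r N, and a trajectory is x 0, x 1, ..., x N with x 0 = 0.  An online algorithm maps
  the nonempty list of requests revealed so far to the next position; it sees neither N nor
  later requests.
\<close>

definition play :: "('r list \<Rightarrow> point) \<Rightarrow> (nat \<Rightarrow> 'r) \<Rightarrow> nat \<Rightarrow> point"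
  where "play A r n = (if n = 0 then 0 else A (map r [1..<Suc n]))"

definition movement_cost :: "(point \<Rightarrow> real) \<Rightarrow> nat \<Rightarrow> (nat \<Rightarrow> point) \<Rightarrow> real"
  where "movement_cost nrm N x = (\<Sum>n=1..N. nrm (x n - x (n - 1)))"

definition service_cost :: "(nat \<Rightarrow> point \<Rightarrow> real) \<Rightarrow> nat \<Rightarrow> (nat \<Rightarrow> point) \<Rightarrow> real"
  where "service_cost f N x = (\<Sum>n=1..N. f n (x n))"

definition function_cost ::
    "(point \<Rightarrow> real) \<Rightarrow> (nat \<Rightarrow> point \<Rightarrow> real) \<Rightarrow> nat \<Rightarrow> (nat \<Rightarrow> point) \<Rightarrow> real"
  where "function_cost nrm f N x = service_cost f N x + movement_cost nrm N x"

definition function_OPT :: "nat \<Rightarrow> (point \<Rightarrow> real) \<Rightarrow> (nat \<Rightarrow> point \<Rightarrow> real) \<Rightarrow> nat \<Rightarrow> real"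
  where "function_OPT d nrm f N =
    Inf {function_cost nrm f N x | x. x 0 = 0 \<and> (\<forall>n\<in>{1..N}. x n \<in> Rd d)}"

definition function_algorithm :: "nat \<Rightarrow> ((point \<Rightarrow> real) list \<Rightarrow> point) \<Rightarrow> bool"
  where "function_algorithm d A \<longleftrightarrow>
    (\<forall>fs. fs \<noteq> [] \<and> (\<forall>f\<in>set fs. function_request d f) \<longrightarrow> A fs \<in> Rd d)"

definition function_competitive_at ::
    "nat \<Rightarrow> (point \<Rightarrow> real) \<Rightarrow> ((point \<Rightarrow> real) list \<Rightarrow> point) \<Rightarrow> nat \<Rightarrow> real \<Rightarrow> bool"
  where "function_competitive_at d nrm A N c \<longleftrightarrow>
    (\<forall>f. (\<forall>n\<in>{1..N}. function_request d (f n)) \<longrightarrow>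
      function_cost nrm f N (play A f) \<le> c * function_OPT d nrm f N)"

definition body_OPT :: "(point \<Rightarrow> real) \<Rightarrow> (nat \<Rightarrow> point set) \<Rightarrow> nat \<Rightarrow> real"
  where "body_OPT nrm K N =
    Inf {movement_cost nrm N x | x. x 0 = 0 \<and> (\<forall>n\<in>{1..N}. x n \<in> K n)}"

definition body_algorithm :: "nat \<Rightarrow> (point set list \<Rightarrow> point) \<Rightarrow> bool"
  where "body_algorithm d A \<longleftrightarrow>
    (\<forall>Ks. Ks \<noteq> [] \<and> (\<forall>K\<in>set Ks. body_request d K) \<longrightarrow> A Ks \<in> last Ks)"

definition body_competitive_at ::
    "nat \<Rightarrow> (point \<Rightarrow> real) \<Rightarrow> (point set list \<Rightarrow> point) \<Rightarrow> nat \<Rightarrow> real \<Rightarrow> bool"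
  where "body_competitive_at d nrm A N c \<longleftrightarrow>
    (\<forall>K. (\<forall>n\<in>{1..N}. body_request d (K n)) \<longrightarrow>
      movement_cost nrm N (play A K) \<le> c * body_OPT nrm K N)"

end

theory Submission
  imports Defs
begin

text \<open>
  Write the work function as an infimum of costs of trajectories ending at a point, and let H_n be
  its concave conjugate on the dual unit ball.  H_n increases with n, it starts at 0, and
  H_N(v) + H_N(-v) is at most twice any offline cost.  The online player moves to the functional
  Steiner point, the average over the dual ball of the minimizers of the work function minus v.
  A minimizer y of the n-th problem satisfies f_n(y) \<le> H_n(v) - H_(n-1)(v), so by convexity the
  service costs telescope.  Since minimizers are negated gradients of H_n, the movement in a dual direction w
  is the flux of H_n - H_(n-1) through the boundary of the dual ball, and it telescopes too, with the
  factor d being the ratio of boundary to volume.  In the Euclidean case a flux in direction w only sees the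
  boundary points weighted by their height, and concentration of measure gives the logarithmic bound.

  Derivatives and boundary integrals are avoided: the average is taken over the ball of radius
  1 - 2 delta, minimizers are replaced by near-minimizers (so that finite convex combinations
  suffice), gradients by difference quotients of step delta^2, and the boundary by a shell.  The player
  uses the limit of these points along an ultrafilter as delta tends to 0, because all
  the bounds are closed conditions on finitely many of the points.
\<close>

section \<open>Lebesgue measure on the carrier\<close>

text \<open>The three scales \<delta>, \<delta>^2, \<delta>^3 have a reason. At depth \<delta>
  inside the dual ball a near-minimizer has norm at most about M / \<delta>, M a bound for H_n, so
  H_n is Lipschitz there with that constant. With step t the new position is controlled by a forward
  and the old one by a backward difference quotient; on average they disagree by order d * t * M /
  \<delta>, which vanishes for t = \<delta>^2. The slack \<delta>^3 of near-minimality is still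
  small after division by t.

  One ultrafilter is fixed because the position may depend on nothing but the history, and there are
  too many histories for a diagonal subsequence.

  The origin of ln N: the flux region depends on the direction w, which changes from step to step,
  so only a symmetric set containing part of it lets the sum telescope. Points of height at most a
  lie in a symmetric shell thinner by a factor of order a, which contributes order d * a. On the
  rest H_n - H_(n-1) is merely bounded by twice the offline cost, once per step, so the Gaussian
  tail beyond height a must be of order 1 / N; this makes d * a^2 of order ln N.\<close>

text \<open>Zorn's lemma for proper filters finer than \<open>sequentially\<close>. The infimum of a
  chain stays proper, since an event of the infimum is already an event of one member.\<close>

lemma exists_ultrafilter:
  "\<exists>F::nat filter. F \<noteq> bot \<and> F \<le> sequentially \<and>
     (\<forall>P. eventually P F \<or> eventually (\<lambda>x. \<not> P x) F)"
proof -
  define A where "A = {F::nat filter. F \<noteq> bot \<and> F \<le> sequentially}"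
  have "\<exists>m\<in>A. \<forall>a\<in>A. a \<le> m \<longrightarrow> a = m"
  proof (rule predicate_Zorn)
    show "partial_order_on A (relation_of (\<lambda>F G. G \<le> F) A)"
      by (rule partial_order_on_relation_ofI) auto
    fix C assume C: "C \<in> Chains (relation_of (\<lambda>F G. G \<le> F) A)"
    then have CA: "C \<subseteq> A" and tot: "\<And>F G. F \<in> C \<Longrightarrow> G \<in> C \<Longrightarrow> F \<le> G \<or> G \<le> F"
      by (auto simp: Chains_def relation_of_def)
    show "\<exists>u\<in>A. \<forall>a\<in>C. u \<le> a"
    proof (cases "C = {}")
      case True
      have "sequentially \<in> A" by (auto simp: A_def)
      with True show ?thesis by blast
    next
      case False
      have base: "\<exists>x\<in>C. x \<le> inf F G" if "F \<in> C" "G \<in> C" for F G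
        using tot[OF that] that by (metis le_inf_iff order_refl)
      have "\<not> eventually (\<lambda>_. False) (Inf C)"
      proof
        assume "eventually (\<lambda>_. False) (Inf C)"
        then obtain b where "b \<in> C" "eventually (\<lambda>_. False) b"
          using eventually_Inf_base[OF False, of "\<lambda>_. False"] base by blast
        then show False using CA by (auto simp: A_def trivial_limit_def)
      qed
      moreover have "Inf C \<le> sequentially"
      proof -
        obtain F where "F \<in> C" using False by blast
        then show ?thesis using CA by (intro Inf_lower2[of F]) (auto simp: A_def)
      qed
      ultimately have "Inf C \<in> A" by (auto simp: A_def trivial_limit_def)
      then show ?thesis by (meson Inf_lower)
    qed
  qed
  then obtain m where m: "m \<in> A" and max: "\<And>a. a \<in> A \<Longrightarrow> a \<le> m \<Longrightarrow> a = m" by blast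
  \<comment> \<open>Restricting \<open>m\<close> to P gives a finer filter, proper by the assumption
    on P, so minimality of \<open>m\<close> makes the two equal.\<close>
  have "eventually P m" if "\<not> eventually (\<lambda>x. \<not> P x) m" for P
  proof -
    have "inf m (principal {x. P x}) \<noteq> bot"
      using that by (auto simp: trivial_limit_def eventually_inf_principal)
    then have "inf m (principal {x. P x}) = m"
      using m by (intro max) (auto simp: A_def intro: le_infI1)
    moreover have "eventually P (inf m (principal {x. P x}))"
      by (simp add: eventually_inf_principal)
    ultimately show ?thesis by simp
  qed
  then show ?thesis using m by (auto simp: A_def)
qed

text \<open>Compactness supplies a cluster point, and a cluster point of an ultrafilter is a limit
  because each neighbourhood or its complement is an event.\<close>

lemma ultrafilter_bounded_real_convergent:
  fixes X :: "nat \<Rightarrow> real"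
  assumes nb: "F \<noteq> bot" and ultra: "\<And>P. eventually P F \<or> eventually (\<lambda>x. \<not> P x) F"
    and bd: "eventually (\<lambda>j. \<bar>X j\<bar> \<le> M) F"
  shows "\<exists>l. (X \<longlongrightarrow> l) F"
proof -
  have "compact {-M..M}" by simp
  moreover have "filtermap X F \<noteq> bot" using nb by (simp add: filtermap_bot_iff)
  moreover have "eventually (\<lambda>x. x \<in> {-M..M}) (filtermap X F)"
    using bd by (auto simp: eventually_filtermap abs_le_iff elim!: eventually_mono)
  ultimately obtain l where l: "inf (nhds l) (filtermap X F) \<noteq> bot"
    unfolding compact_filter by blast
  have "eventually (\<lambda>j. X j \<in> S) F" if S: "open S" "l \<in> S" for S
  proof (rule ccontr)
    assume "\<not> ?thesis"
    then have "eventually (\<lambda>j. X j \<notin> S) F" using ultra[of "\<lambda>j. X j \<in> S"] by blast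
    then have "eventually (\<lambda>x. x \<notin> S) (filtermap X F)" by (simp add: eventually_filtermap)
    moreover have "eventually (\<lambda>x. x \<in> S) (nhds l)" using S by (simp add: eventually_nhds_in_open)
    ultimately have "eventually (\<lambda>x. False) (inf (nhds l) (filtermap X F))"
      unfolding eventually_inf by blast
    then show False using l by (simp add: trivial_limit_def)
  qed
  then show ?thesis by (auto intro!: exI[of _ l] topological_tendstoI)
qed

section \<open>Lebesgue measure transported to the carrier\<close>

text \<open>Elements of the finite product space take the value \<open>undefined\<close> from index
  d on; resetting it to 0 lands in \<open>Rd d\<close>.\<close>

definition embed_Rd :: "nat \<Rightarrow> point \<Rightarrow> point"
  where "embed_Rd d y = (\<lambda>i. if i < d then y i else 0)"

text \<open>The sigma-algebra is that of the whole sequence type, so closed and open sets of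
  sequences are measurable at once.\<close>

definition lebesgue_Rd :: "nat \<Rightarrow> point measure"
  where "lebesgue_Rd d = distr (Pi\<^sub>M {..<d} (\<lambda>_. lborel)) borel (embed_Rd d)"

lemma space_lam [simp]: "space (lebesgue_Rd d) = UNIV" and sets_lam [simp, measurable_cong]: "sets (lebesgue_Rd d) = sets borel"
  by (auto simp: lebesgue_Rd_def)

lemma point_borel_measurableI:
  fixes f :: "'a \<Rightarrow> point"
  assumes "\<And>i. (\<lambda>x. f x i) \<in> borel_measurable M"
  shows "f \<in> borel_measurable M"
  using measurable_coordinatewise_then_product[of f M] assms by blast

lemma emb_measurable [measurable]: "embed_Rd d \<in> Pi\<^sub>M {..<d} (\<lambda>_. lborel) \<rightarrow>\<^sub>M borel"
proof (rule point_borel_measurableI)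
  fix i show "(\<lambda>x. embed_Rd d x i) \<in> borel_measurable (Pi\<^sub>M {..<d} (\<lambda>_. lborel))"
    by (cases "i < d") (auto simp: embed_Rd_def)
qed

lemma Rd_iff: "x \<in> Rd d \<longleftrightarrow> (\<forall>i\<ge>d. x i = 0)"
  by (simp add: topspace_Euclidean_space)

lemma continuous_on_coord [continuous_intros]: "continuous_on S (\<lambda>x::point. x i)"
  by (rule continuous_on_product_then_coordinatewise[OF continuous_on_id])

lemma continuous_on_affine: "continuous_on S (\<lambda>v::point. a + c *\<^sub>R v)"
  by (intro continuous_on_coordinatewise_then_product) (auto intro!: continuous_intros)

lemma affine_measurable [measurable]: "(\<lambda>v::point. a + c *\<^sub>R v) \<in> borel_measurable borel"
  by (rule borel_measurable_continuous_onI[OF continuous_on_affine])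

text \<open>The map acts on each of the d coordinates separately, and each contributes a factor
  \<open>\<bar>c\<bar>\<close>; uniqueness of the product measure reduces the claim to
  boxes.\<close>

lemma emeasure_lam_affine:
  assumes c: "c \<noteq> 0" and a: "a \<in> Rd d" and S[measurable]: "S \<in> sets borel"
  shows "emeasure (lebesgue_Rd d) S = ennreal (\<bar>c\<bar> ^ d) * emeasure (lebesgue_Rd d) {v. a + c *\<^sub>R v \<in> S}"
proof -
  define PM where "PM = Pi\<^sub>M {..<d} (\<lambda>_::nat. lborel::real measure)"
  \<comment> \<open>The affine map in the first d coordinates only, so that it sends the product
    space to itself; \<open>embed_Rd\<close> intertwines it with the map on sequences because
    \<open>a\<close> vanishes from index d on.\<close>
  define T where "T = (\<lambda>y::point. \<lambda>i\<in>{..<d}. a i + c * y i)"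
  have T[measurable]: "T \<in> PM \<rightarrow>\<^sub>M PM"
    unfolding PM_def T_def by measurable
  interpret product_sigma_finite "\<lambda>_::nat. lborel::real measure" ..
  have 1: "emeasure lborel A = ennreal \<bar>c\<bar> * emeasure lborel {x. t + c * x \<in> A}"
    if [measurable]: "A \<in> sets borel" for A t
  proof -
    have "emeasure lborel A = (\<integral>\<^sup>+x. indicator A x \<partial>lborel)" by simp
    also have "\<dots> = ennreal \<bar>c\<bar> * (\<integral>\<^sup>+x. indicator A (t + c * x) \<partial>lborel)"
      by (rule nn_integral_real_affine[OF _ c]) simp
    also have "(\<integral>\<^sup>+x. indicator A (t + c * x) \<partial>lborel) = (\<integral>\<^sup>+x. indicator {x. t + c * x \<in> A} x \<partial>lborel)"
      by (intro nn_integral_cong) (auto split: split_indicator)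
    also have "\<dots> = emeasure lborel {x. t + c * x \<in> A}" by (rule nn_integral_indicator) simp
    finally show ?thesis .
  qed
  have P: "scale_measure (ennreal (\<bar>c\<bar> ^ d)) (distr PM PM T) = PM"
    unfolding PM_def
  proof (rule PiM_eqI)
    fix A :: "nat \<Rightarrow> real set" assume A: "\<And>i. i \<in> {..<d} \<Longrightarrow> A i \<in> sets lborel"
    have [measurable]: "Pi\<^sub>E {..<d} A \<in> sets PM" unfolding PM_def using A by (intro sets_PiM_I_finite) auto
    have eq: "T -` Pi\<^sub>E {..<d} A \<inter> space PM = Pi\<^sub>E {..<d} (\<lambda>i. {x. a i + c * x \<in> A i})"
    proof (intro set_eqI iffI)
      fix y assume "y \<in> Pi\<^sub>E {..<d} (\<lambda>i. {x. a i + c * x \<in> A i})"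
      then show "y \<in> T -` Pi\<^sub>E {..<d} A \<inter> space PM"
        unfolding T_def PM_def space_PiM by (simp add: PiE_iff)
    next
      fix y assume "y \<in> T -` Pi\<^sub>E {..<d} A \<inter> space PM"
      then show "y \<in> Pi\<^sub>E {..<d} (\<lambda>i. {x. a i + c * x \<in> A i})"
        unfolding T_def PM_def space_PiM by (simp add: PiE_iff)
    qed
    have m: "{x. a i + c * x \<in> A i} \<in> sets lborel" if "i < d" for i
    proof -
      have [measurable]: "A i \<in> sets borel" using A that by simp
      show ?thesis by simp
    qed
    have "emeasure (scale_measure (ennreal (\<bar>c\<bar> ^ d)) (distr PM PM T)) (Pi\<^sub>E {..<d} A)
      = ennreal (\<bar>c\<bar> ^ d) * emeasure PM (Pi\<^sub>E {..<d} (\<lambda>i. {x. a i + c * x \<in> A i}))"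
      by (simp add: emeasure_distr eq)
    also have "\<dots> = ennreal (\<bar>c\<bar> ^ d) * (\<Prod>i<d. emeasure lborel {x. a i + c * x \<in> A i})"
      unfolding PM_def using m by (subst emeasure_PiM) auto
    also have "\<dots> = (\<Prod>i<d. ennreal \<bar>c\<bar> * emeasure lborel {x. a i + c * x \<in> A i})"
      by (simp add: prod.distrib ennreal_power)
    also have "\<dots> = (\<Prod>i<d. emeasure lborel (A i))"
      using A 1 by (intro prod.cong) auto
    finally show "emeasure (scale_measure (ennreal (\<bar>c\<bar> ^ d)) (distr (Pi\<^sub>M {..<d} (\<lambda>_. lborel)) (Pi\<^sub>M {..<d} (\<lambda>_. lborel)) T)) (Pi\<^sub>E {..<d} A)
      = (\<Prod>i<d. emeasure lborel (A i))" by (simp add: PM_def)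
  qed (auto)
  have e[measurable]: "embed_Rd d \<in> PM \<rightarrow>\<^sub>M borel" unfolding PM_def by simp
  have comm: "embed_Rd d (T y) = a + c *\<^sub>R embed_Rd d y" for y
    using a by (auto simp: embed_Rd_def T_def fun_eq_iff Rd_iff)
  have "emeasure (lebesgue_Rd d) S = emeasure PM (embed_Rd d -` S \<inter> space PM)"
    by (simp add: lebesgue_Rd_def PM_def[symmetric] emeasure_distr)
  also have "\<dots> = ennreal (\<bar>c\<bar> ^ d) * emeasure PM (T -` (embed_Rd d -` S \<inter> space PM) \<inter> space PM)"
  proof -
    have "embed_Rd d -` S \<inter> space PM \<in> sets PM" by measurable
    then have "emeasure (scale_measure (ennreal (\<bar>c\<bar> ^ d)) (distr PM PM T)) (embed_Rd d -` S \<inter> space PM)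
      = ennreal (\<bar>c\<bar> ^ d) * emeasure PM (T -` (embed_Rd d -` S \<inter> space PM) \<inter> space PM)"
      by (simp add: emeasure_distr)
    then show ?thesis unfolding P .
  qed
  also have "T -` (embed_Rd d -` S \<inter> space PM) \<inter> space PM = embed_Rd d -` {v. a + c *\<^sub>R v \<in> S} \<inter> space PM"
    using measurable_space[OF T] by (auto simp: comm)
  also have "emeasure PM \<dots> = emeasure (lebesgue_Rd d) {v. a + c *\<^sub>R v \<in> S}"
  proof -
    have "{v. a + c *\<^sub>R v \<in> S} \<in> sets borel" by measurable
    then show ?thesis by (simp add: lebesgue_Rd_def PM_def[symmetric] emeasure_distr)
  qed
  finally show ?thesis .
qed

lemma distr_lam_affine:
  assumes "\<bar>c\<bar> = 1" and "a \<in> Rd d"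
  shows "distr (lebesgue_Rd d) borel (\<lambda>v. a + c *\<^sub>R v) = lebesgue_Rd d"
proof (rule measure_eqI)
  fix S assume "S \<in> sets (distr (lebesgue_Rd d) borel (\<lambda>v. a + c *\<^sub>R v))"
  then have S: "S \<in> sets borel" by simp
  have "c \<noteq> 0" using assms by auto
  show "emeasure (distr (lebesgue_Rd d) borel (\<lambda>v. a + c *\<^sub>R v)) S = emeasure (lebesgue_Rd d) S"
    using S emeasure_lam_affine[OF \<open>c \<noteq> 0\<close> assms(2) S] assms(1) by (simp add: emeasure_distr vimage_def)
qed simp

lemma emeasure_lam_box:
  assumes "\<And>i. i < d \<Longrightarrow> l i \<le> u i"
  shows "emeasure (lebesgue_Rd d) {v \<in> Rd d. \<forall>i<d. l i \<le> v i \<and> v i \<le> u i} = ennreal (\<Prod>i<d. u i - l i)"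
proof -
  define PM where "PM = Pi\<^sub>M {..<d} (\<lambda>_::nat. lborel::real measure)"
  interpret product_sigma_finite "\<lambda>_::nat. lborel::real measure" ..
  have cl: "closed {v \<in> Rd d. \<forall>i<d. l i \<le> v i \<and> v i \<le> u i}"
  proof -
    have "{v \<in> Rd d. \<forall>i<d. l i \<le> v i \<and> v i \<le> u i}
      = (\<Inter>i. {v. v i \<in> (if i < d then {l i..u i} else {0})})"
    proof (intro set_eqI)
      fix v :: point
      have "v \<in> (\<Inter>i. {v. v i \<in> (if i < d then {l i..u i} else {0})})
        \<longleftrightarrow> (\<forall>i. if i < d then l i \<le> v i \<and> v i \<le> u i else v i = 0)" by auto
      also have "\<dots> \<longleftrightarrow> v \<in> {v \<in> Rd d. \<forall>i<d. l i \<le> v i \<and> v i \<le> u i}"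
      proof -
        have "(\<forall>i. if i < d then P i else Q i) \<longleftrightarrow> (\<forall>i\<ge>d. Q i) \<and> (\<forall>i<d. P i)" for P Q
          by (meson linorder_not_le)
        from this[of "\<lambda>i. l i \<le> v i \<and> v i \<le> u i"] show ?thesis by (simp only: Rd_iff mem_Collect_eq)
      qed
      finally show "v \<in> {v \<in> Rd d. \<forall>i<d. l i \<le> v i \<and> v i \<le> u i} \<longleftrightarrow>
        v \<in> (\<Inter>i. {v. v i \<in> (if i < d then {l i..u i} else {0})})" by simp
    qed
    moreover have "closed {v::point. v i \<in> A}" if "closed A" for i A
      using closed_vimage[OF that continuous_on_coord[of UNIV i]] by (simp add: vimage_def)
    moreover have "closed (if i < d then {l i..u i} else {0::real})" for i by simp
    ultimately show ?thesis by (simp only:) (intro closed_INT ballI, blast)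
  qed
  have "emeasure (lebesgue_Rd d) {v \<in> Rd d. \<forall>i<d. l i \<le> v i \<and> v i \<le> u i} = emeasure PM (embed_Rd d -` {v \<in> Rd d. \<forall>i<d. l i \<le> v i \<and> v i \<le> u i} \<inter> space PM)"
    unfolding lebesgue_Rd_def PM_def by (rule emeasure_distr[OF emb_measurable borel_closed[OF cl]])
  also have "embed_Rd d -` {v \<in> Rd d. \<forall>i<d. l i \<le> v i \<and> v i \<le> u i} \<inter> space PM = Pi\<^sub>E {..<d} (\<lambda>i. {l i..u i})"
  proof (intro set_eqI)
    fix y
    have "y \<in> Pi\<^sub>E {..<d} (\<lambda>i. {l i..u i}) \<longleftrightarrow> (\<forall>i<d. l i \<le> y i \<and> y i \<le> u i) \<and> y \<in> space PM"
      unfolding PM_def space_PiM PiE_iff by auto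
    moreover have "embed_Rd d y \<in> Rd d" and "(\<forall>i<d. l i \<le> embed_Rd d y i \<and> embed_Rd d y i \<le> u i) \<longleftrightarrow> (\<forall>i<d. l i \<le> y i \<and> y i \<le> u i)"
      by (simp_all add: embed_Rd_def Rd_iff)
    ultimately show "y \<in> embed_Rd d -` {v \<in> Rd d. \<forall>i<d. l i \<le> v i \<and> v i \<le> u i} \<inter> space PM \<longleftrightarrow> y \<in> Pi\<^sub>E {..<d} (\<lambda>i. {l i..u i})"
      by blast
  qed
  also have "emeasure PM \<dots> = (\<Prod>i<d. ennreal (u i - l i))"
    unfolding PM_def by (subst emeasure_PiM) (auto simp: assms intro!: prod.cong)
  also have "\<dots> = ennreal (\<Prod>i<d. u i - l i)"
    using assms by (intro prod_ennreal) auto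
  finally show ?thesis .
qed

section \<open>The dual ball\<close>

definition ip :: "nat \<Rightarrow> point \<Rightarrow> point \<Rightarrow> real"
  where "ip d v x = (\<Sum>i<d. v i * x i)"

text \<open>A reference norm that is visibly continuous in the product topology; continuity of an
  arbitrary \<open>nrm\<close> is derived by comparison with it.\<close>

definition l1 :: "nat \<Rightarrow> point \<Rightarrow> real"
  where "l1 d x = (\<Sum>i<d. \<bar>x i\<bar>)"

lemma ip_add: "ip d v (x + y) = ip d v x + ip d v y" "ip d (v + w) x = ip d v x + ip d w x"
  by (simp_all add: ip_def algebra_simps sum.distrib)

lemma ip_diff: "ip d v (x - y) = ip d v x - ip d v y" "ip d (v - w) x = ip d v x - ip d w x"
  by (simp_all add: ip_def algebra_simps sum_subtractf)

lemma ip_scale: "ip d v (c *\<^sub>R x) = c * ip d v x" "ip d (c *\<^sub>R v) x = c * ip d v x"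
  by (simp_all add: ip_def algebra_simps sum_distrib_left)

lemma ip_minus: "ip d v (- x) = - ip d v x" "ip d (- v) x = - ip d v x"
  by (simp_all add: ip_def sum_negf)

lemma ip_zero [simp]: "ip d v 0 = 0" "ip d 0 v = 0"
  by (simp_all add: ip_def)

lemma ip_sum: "ip d v (\<Sum>i\<in>I. f i) = (\<Sum>i\<in>I. ip d v (f i))"
proof (induction I rule: infinite_finite_induct)
  case (insert x F)
  then show ?case by (simp only: sum.insert[OF insert.hyps] ip_add)
qed (simp_all only: sum.infinite sum.empty ip_zero not_False_eq_True)

lemma ip_commute: "ip d v w = ip d w v"
  by (simp add: ip_def mult.commute)

lemma ip_sq: "ip d (p - s *\<^sub>R z) (p - s *\<^sub>R z) = ip d p p - 2 * s * ip d p z + s * s * ip d z z"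
  by (simp add: ip_diff ip_scale ip_commute[of d z p] algebra_simps)

lemma ip_self_nonneg: "0 \<le> ip d v v"
  by (simp add: ip_def sum_nonneg)

lemma l1_nonneg: "0 \<le> l1 d x"
  by (simp add: l1_def sum_nonneg)

lemma continuous_on_ip [continuous_intros]: "continuous_on S (ip d v)" "continuous_on S (\<lambda>v. ip d v x)"
  unfolding ip_def by (intro continuous_intros)+

lemma continuous_on_l1: "continuous_on S (\<lambda>x. l1 d (a - x))"
  unfolding l1_def by (simp, intro continuous_intros)

lemma Rd_closed_ops [simp, intro]:
  "0 \<in> Rd d" "x \<in> Rd d \<Longrightarrow> y \<in> Rd d \<Longrightarrow> x + y \<in> Rd d" "x \<in> Rd d \<Longrightarrow> y \<in> Rd d \<Longrightarrow> x - y \<in> Rd d"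
  "x \<in> Rd d \<Longrightarrow> c *\<^sub>R x \<in> Rd d" "x \<in> Rd d \<Longrightarrow> - x \<in> Rd d"
  by (simp_all add: Rd_iff)

lemma closed_Rd: "closed (Rd d)"
  using closedin_Euclidean_imp_closed[of d "Rd d"] by blast

lemma compact_box: "compact {v \<in> Rd d. \<forall>i<d. \<bar>v i\<bar> \<le> R}"
proof -
  define X where "X = (\<lambda>i. if i < d then {-R..R} else {0::real})"
  have "compactin (product_topology (\<lambda>i. euclidean) UNIV) (PiE UNIV X)"
    unfolding compactin_PiE by (auto simp: X_def)
  then have "compact (PiE UNIV X)" by (simp add: euclidean_product_topology)
  also have "PiE UNIV X = {v \<in> Rd d. \<forall>i<d. \<bar>v i\<bar> \<le> R}"
  proof (intro set_eqI)
    fix v :: point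
    have "v \<in> PiE UNIV X \<longleftrightarrow> (\<forall>i. if i < d then \<bar>v i\<bar> \<le> R else v i = 0)"
      by (auto simp: X_def PiE_iff abs_le_iff)
    also have "\<dots> \<longleftrightarrow> (\<forall>i\<ge>d. v i = 0) \<and> (\<forall>i<d. \<bar>v i\<bar> \<le> R)" by (meson linorder_not_le)
    finally show "v \<in> PiE UNIV X \<longleftrightarrow> v \<in> {v \<in> Rd d. \<forall>i<d. \<bar>v i\<bar> \<le> R}"
      by (simp only: Rd_iff mem_Collect_eq)
  qed
  finally show ?thesis .
qed

lemma Rd_eq_sum_axes: "x \<in> Rd d \<Longrightarrow> x = (\<Sum>i<d. x i *\<^sub>R (\<lambda>j. if j = i then 1 else 0))"
proof
  fix j assume x: "x \<in> Rd d"
  have app: "(\<Sum>i\<in>I. f i) j = (\<Sum>i\<in>I. f i j)" for I and f :: "nat \<Rightarrow> point"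
    by (induction I rule: infinite_finite_induct) simp_all
  have "(\<Sum>i<d. x i *\<^sub>R (\<lambda>j. if j = i then 1 else 0::real)) j = (\<Sum>i<d. if j = i then x i else 0)"
    unfolding app by (intro sum.cong) auto
  also have "\<dots> = x j" using x by (auto simp: Rd_iff)
  finally show "x j = (\<Sum>i<d. x i *\<^sub>R (\<lambda>j. if j = i then 1 else 0)) j" by simp
qed

lemma ip_abs_le_l1: "(\<And>i. i < d \<Longrightarrow> \<bar>v i\<bar> \<le> R) \<Longrightarrow> \<bar>ip d v x\<bar> \<le> R * l1 d x"
  unfolding ip_def l1_def sum_distrib_left
  by (rule order.trans[OF sum_abs]) (auto simp: abs_mult intro!: sum_mono mult_right_mono)

text \<open>The separating functional points from the Euclidean nearest point y of U to x. A point u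
  of U beyond the supporting hyperplane would let y move towards u and get closer to x.\<close>

lemma nearest_point_separation:
  assumes U: "compact U" "convex U" "U \<noteq> {}" "U \<subseteq> Rd d" and x: "x \<in> Rd d" "x \<notin> U"
  shows "\<exists>p\<in>Rd d. \<exists>m. m < ip d p x \<and> (\<forall>u\<in>U. ip d p u \<le> m)"
proof -
  define D where "D = (\<lambda>u. ip d (x - u) (x - u))"
  have "continuous_on U D" unfolding D_def ip_def by (simp, intro continuous_intros)
  then obtain y where y: "y \<in> U" and miny: "\<And>u. u \<in> U \<Longrightarrow> D y \<le> D u"
    using continuous_attains_inf[OF U(1,3)] by blast
  define p where "p = x - y"
  have yR: "y \<in> Rd d" using y U by auto
  have pR: "p \<in> Rd d" using yR x by (simp add: p_def)
  have "ip d p u \<le> ip d p y" if u: "u \<in> U" for u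
  proof (rule ccontr)
    assume "\<not> ?thesis"
    then have pos: "0 < ip d p (u - y)" by (simp add: ip_diff)
    define q where "q = ip d (u - y) (u - y)"
    have q0: "0 \<le> q" by (simp add: q_def ip_self_nonneg)
    \<comment> \<open>Small enough that the linear gain \<open>2 * s * ip d p (u - y)\<close> beats
      the quadratic loss \<open>s * s * q\<close>, and at most 1 to stay in U; the summand 1 avoids
      division by zero.\<close>
    define s where "s = min 1 (ip d p (u - y) / (q + 1))"
    have s: "0 < s" "s \<le> 1" using pos q0 by (auto simp: s_def)
    have sq: "s * q < 2 * ip d p (u - y)"
    proof -
      have "s \<le> ip d p (u - y) / (q + 1)" by (simp add: s_def)
      then have "s * (q + 1) \<le> ip d p (u - y)" using q0 by (simp add: pos_le_divide_eq)
      then show ?thesis using pos s by (simp add: algebra_simps)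
    qed
    have "y + s *\<^sub>R (u - y) = (1 - s) *\<^sub>R y + s *\<^sub>R u" by (simp add: fun_eq_iff algebra_simps)
    then have "y + s *\<^sub>R (u - y) \<in> U" using convexD[OF U(2) y u, of "1 - s" s] s by simp
    then have "D y \<le> D (y + s *\<^sub>R (u - y))" by (rule miny)
    also have "x - (y + s *\<^sub>R (u - y)) = p - s *\<^sub>R (u - y)" by (simp add: p_def)
    then have "D (y + s *\<^sub>R (u - y)) = D y - 2 * s * ip d p (u - y) + s * s * q"
      by (simp only: D_def ip_sq p_def[symmetric] q_def)
    finally have "s * (2 * ip d p (u - y)) \<le> s * (s * q)" by (simp add: algebra_simps)
    then show False using sq s by simp
  qed
  moreover have "ip d p y < ip d p x"
  proof -
    have "x \<noteq> y" using x y by auto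
    then obtain i where "x i \<noteq> y i" by auto
    then have i: "i < d" using x yR by (metis Rd_iff linorder_not_le)
    have "0 < (\<Sum>i<d. p i * p i)"
      by (rule sum_pos2[of _ i]) (use i \<open>x i \<noteq> y i\<close> in \<open>auto simp: p_def zero_less_mult_iff\<close>)
    then have "0 < ip d p p" by (simp add: ip_def)
    then have "0 < ip d p (x - y)" by (simp add: p_def)
    then show ?thesis by (simp add: ip_diff)
  qed
  ultimately show ?thesis using pR by blast
qed

section \<open>An arbitrary norm on the carrier: comparison with l1 and continuity\<close>

locale normed_Rd =
  fixes d :: nat and nrm :: "point \<Rightarrow> real"
  assumes norm_nrm: "norm_on_Rd d nrm"
begin

lemma nrm_nonneg: "x \<in> Rd d \<Longrightarrow> 0 \<le> nrm x"
  and nrm_eq_0: "x \<in> Rd d \<Longrightarrow> nrm x = 0 \<longleftrightarrow> x = 0"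
  and nrm_scale: "x \<in> Rd d \<Longrightarrow> nrm (c *\<^sub>R x) = \<bar>c\<bar> * nrm x"
  and nrm_triangle: "x \<in> Rd d \<Longrightarrow> y \<in> Rd d \<Longrightarrow> nrm (x + y) \<le> nrm x + nrm y"
  using norm_nrm unfolding norm_on_Rd_def by blast+

lemma nrm_zero [simp]: "nrm 0 = 0"
  using nrm_eq_0[of 0] by simp

lemma nrm_minus: "x \<in> Rd d \<Longrightarrow> nrm (- x) = nrm x"
  using nrm_scale[of x "-1"] by simp

lemma nrm_diff_commute: "x \<in> Rd d \<Longrightarrow> y \<in> Rd d \<Longrightarrow> nrm (x - y) = nrm (y - x)"
  using nrm_minus[of "x - y"] by simp

lemma nrm_sum: "(\<And>i. i \<in> I \<Longrightarrow> f i \<in> Rd d) \<Longrightarrow> (\<Sum>i\<in>I. f i) \<in> Rd d \<and> nrm (\<Sum>i\<in>I. f i) \<le> (\<Sum>i\<in>I. nrm (f i))"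
proof (induction I rule: infinite_finite_induct)
  case (insert i I)
  then have *: "(\<Sum>i\<in>I. f i) \<in> Rd d" "nrm (\<Sum>i\<in>I. f i) \<le> (\<Sum>i\<in>I. nrm (f i))" "f i \<in> Rd d" by auto
  then show ?case using nrm_triangle[OF *(3,1)] Rd_closed_ops(2)[OF *(3,1)]
    by (simp only: sum.insert[OF insert.hyps] simp_thms)
qed (simp_all only: sum.infinite sum.empty Rd_closed_ops nrm_zero not_False_eq_True order_refl simp_thms)

text \<open>One constant for two comparisons: of \<open>nrm\<close> with \<open>l1\<close>, and of
  the coordinates of a functional with its dual norm.\<close>

definition K1 :: real
  where "K1 = (\<Sum>i<d. nrm (\<lambda>j. if j = i then 1 else 0))"

lemma nrm_axis_nonneg: "i < d \<Longrightarrow> 0 \<le> nrm (\<lambda>j. if j = i then 1 else 0)"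
  by (rule nrm_nonneg) (simp add: Rd_iff)

lemma K1_nonneg: "0 \<le> K1"
  by (auto simp: K1_def nrm_axis_nonneg intro!: sum_nonneg)

lemma nrm_le_l1: assumes x: "x \<in> Rd d" shows "nrm x \<le> K1 * l1 d x"
proof -
  have R: "(\<lambda>j. if j = i then 1 else 0) \<in> Rd d" if "i < d" for i using that by (simp add: Rd_iff)
  have "nrm x \<le> (\<Sum>i<d. nrm (x i *\<^sub>R (\<lambda>j. if j = i then 1 else 0)))"
    using Rd_eq_sum_axes[OF x] nrm_sum[of "{..<d}" "\<lambda>i. x i *\<^sub>R (\<lambda>j. if j = i then 1 else 0)"] R by auto
  also have "\<dots> = (\<Sum>i<d. \<bar>x i\<bar> * nrm (\<lambda>j. if j = i then 1 else 0))"
    using R by (intro sum.cong refl nrm_scale) auto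
  also have "\<dots> \<le> (\<Sum>i<d. \<bar>x i\<bar> * K1)"
    unfolding K1_def by (intro sum_mono mult_left_mono member_le_sum) (auto simp: nrm_axis_nonneg)
  finally show ?thesis by (simp add: l1_def sum_distrib_left mult.commute)
qed

lemma abs_nrm_diff_le: "x \<in> Rd d \<Longrightarrow> y \<in> Rd d \<Longrightarrow> \<bar>nrm x - nrm y\<bar> \<le> nrm (x - y)"
  using nrm_triangle[of "x - y" y] nrm_triangle[of "y - x" x] nrm_diff_commute[of x y] by simp

lemma continuous_on_nrm: "continuous_on (Rd d) nrm"
  unfolding continuous_on_def
proof
  fix x assume x: "x \<in> Rd d"
  have "continuous_on UNIV (\<lambda>y. K1 * l1 d (x - y))" by (intro continuous_intros continuous_on_l1)
  then have "((\<lambda>y. K1 * l1 d (x - y)) \<longlongrightarrow> K1 * l1 d (x - x)) (at x within Rd d)"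
    by (meson continuous_on_def continuous_on_subset subset_UNIV tendsto_within_subset UNIV_I)
  then have 0: "((\<lambda>y. K1 * l1 d (x - y)) \<longlongrightarrow> 0) (at x within Rd d)" by (simp add: l1_def)
  have "((\<lambda>y. nrm y - nrm x) \<longlongrightarrow> 0) (at x within Rd d)"
  proof (rule Lim_null_comparison[OF _ 0])
    have "norm (nrm y - nrm x) \<le> K1 * l1 d (x - y)" if "y \<in> Rd d" for y
      using abs_nrm_diff_le[OF that x] nrm_diff_commute[OF that x] nrm_le_l1[of "x - y"] that x by simp
    then show "\<forall>\<^sub>F y in at x within Rd d. norm (nrm y - nrm x) \<le> K1 * l1 d (x - y)"
      by (auto simp: eventually_at_filter)
  qed
  then show "(nrm \<longlongrightarrow> nrm x) (at x within Rd d)" by (rule LIM_zero_cancel)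
qed

text \<open>Equivalence of norms: \<open>nrm\<close> is continuous and positive on the compact l1
  sphere, hence bounded below there.\<close>

lemma l1_le_nrm: "\<exists>c>0. \<forall>x\<in>Rd d. c * l1 d x \<le> nrm x"
proof (cases "d = 0")
  \<comment> \<open>In dimension 0 the l1 sphere is empty and has no minimizer.\<close>
  case True then show ?thesis by (auto simp: l1_def nrm_nonneg intro!: exI[of _ 1])
next
  case False
  define S where "S = {v \<in> Rd d. \<forall>i<d. \<bar>v i\<bar> \<le> 1} \<inter> {x. l1 d (0 - x) = 1}"
  have "compact S" unfolding S_def
    by (intro compact_Int_closed compact_box closed_Collect_eq continuous_on_l1 continuous_intros)
  moreover have "(\<lambda>j. if j = 0 then 1 else 0) \<in> S"
    using False by (auto simp: S_def Rd_iff l1_def if_distrib[of abs] cong: if_cong)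
  moreover have "continuous_on S nrm" by (rule continuous_on_subset[OF continuous_on_nrm]) (auto simp: S_def)
  ultimately obtain z where z: "z \<in> S" "\<And>u. u \<in> S \<Longrightarrow> nrm z \<le> nrm u"
    using continuous_attains_inf[of S nrm] by blast
  have zR: "z \<in> Rd d" and z1: "l1 d z = 1" using z(1) by (auto simp: S_def l1_def)
  have "z \<noteq> 0" using z1 by (auto simp: l1_def)
  then have pos: "0 < nrm z" using nrm_eq_0[OF zR] nrm_nonneg[OF zR] by linarith
  have "nrm z * l1 d x \<le> nrm x" if x: "x \<in> Rd d" for x
  proof (cases "l1 d x = 0")
    case True then show ?thesis using nrm_nonneg[OF x] by simp
  next
    case False
    then have l: "0 < l1 d x" using l1_nonneg[of d x] by linarith
    define y where "y = (1 / l1 d x) *\<^sub>R x"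
    have yl: "l1 d y = 1" using l by (simp add: y_def l1_def abs_mult sum_divide_distrib[symmetric])
    have yb: "\<bar>y i\<bar> \<le> 1" if "i < d" for i
      using member_le_sum[of i "{..<d}" "\<lambda>i. \<bar>y i\<bar>"] that yl by (simp add: l1_def)
    have "y \<in> S" using yl yb x by (auto simp: S_def y_def[symmetric] l1_def) (auto simp: y_def)
    then have "nrm z \<le> nrm y" by (rule z(2))
    also have "\<dots> = nrm x / l1 d x" using l x by (simp add: y_def nrm_scale)
    finally show ?thesis using l by (simp add: field_simps)
  qed
  then show ?thesis using pos by blast
qed

section \<open>Balls of the dual norm and duality\<close>

text \<open>The ball of radius r of the dual norm, a norm that itself is never introduced;
  functionals are identified with points through \<open>ip\<close>.\<close>

definition B :: "real \<Rightarrow> point set"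
  where "B r = {v \<in> Rd d. \<forall>x\<in>Rd d. ip d v x \<le> r * nrm x}"

lemma BD: "v \<in> B r \<Longrightarrow> v \<in> Rd d" "v \<in> B r \<Longrightarrow> x \<in> Rd d \<Longrightarrow> ip d v x \<le> r * nrm x"
  by (auto simp: B_def)

lemma B_abs: "v \<in> B r \<Longrightarrow> x \<in> Rd d \<Longrightarrow> \<bar>ip d v x\<bar> \<le> r * nrm x"
  using BD(2)[of v r x] BD(2)[of v r "- x"] by (simp add: nrm_minus ip_minus abs_le_iff)

lemma B_mono: "r \<le> s \<Longrightarrow> B r \<subseteq> B s"
proof
  fix v assume le: "r \<le> s" and v: "v \<in> B r"
  have "ip d v x \<le> s * nrm x" if "x \<in> Rd d" for x
    using BD(2)[OF v that] mult_right_mono[OF le nrm_nonneg[OF that]] by linarith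
  then show "v \<in> B s" using BD(1)[OF v] by (simp add: B_def)
qed

lemma B_minus: "v \<in> B r \<Longrightarrow> - v \<in> B r"
  using B_abs by (fastforce simp: B_def ip_minus)

lemma B_minus_iff: "- v \<in> B r \<longleftrightarrow> v \<in> B r"
  using B_minus[of v r] B_minus[of "- v" r] by auto

lemma B_add: "v \<in> B r \<Longrightarrow> w \<in> B s \<Longrightarrow> v + w \<in> B (r + s)"
  by (auto simp: B_def ip_add distrib_right intro!: add_mono)

lemma B_scale: "v \<in> B r \<Longrightarrow> 0 \<le> c \<Longrightarrow> c *\<^sub>R v \<in> B (c * r)"
  by (auto simp: B_def ip_scale mult.assoc intro!: mult_left_mono)

lemma B_scale_iff: "0 < c \<Longrightarrow> c *\<^sub>R v \<in> B (c * r) \<longleftrightarrow> v \<in> B r"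
  using B_scale[of "c *\<^sub>R v" "c * r" "1 / c"] B_scale[of v r c] by auto

lemma B_shift: "v \<in> B r \<Longrightarrow> w \<in> B 1 \<Longrightarrow> 0 \<le> t \<Longrightarrow> v + t *\<^sub>R w \<in> B (r + t)"
  using B_add[of v r "t *\<^sub>R w" t] B_scale[of w 1 t] by simp

lemma zero_in_B: "0 \<le> r \<Longrightarrow> 0 \<in> B r"
  by (auto simp: B_def nrm_nonneg)

lemma closed_B: "closed (B r)"
proof -
  have "B r = Rd d \<inter> (\<Inter>x\<in>Rd d. {v. ip d v x \<le> r * nrm x})" by (auto simp: B_def)
  then show ?thesis
    by (simp only:) (intro closed_Int closed_Rd closed_INT ballI closed_Collect_le continuous_intros)
qed

lemma B_borel [measurable]: "B r \<in> sets borel"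
  by (rule borel_closed[OF closed_B])

lemma B_coord: assumes "v \<in> B r" "0 \<le> r" "i < d" shows "\<bar>v i\<bar> \<le> r * K1"
proof -
  let ?e = "\<lambda>j. if j = i then 1 else 0 :: real"
  have eR: "?e \<in> Rd d" using assms by (simp add: Rd_iff)
  have "ip d v ?e = v i" using assms by (simp add: ip_def if_distrib cong: if_cong)
  then have "\<bar>v i\<bar> \<le> r * nrm ?e" using B_abs[OF assms(1) eR] by simp
  also have "\<dots> \<le> r * K1" unfolding K1_def
    by (intro mult_left_mono member_le_sum) (use assms in \<open>auto simp: nrm_axis_nonneg\<close>)
  finally show ?thesis .
qed

lemma B_subset_box: "0 \<le> r \<Longrightarrow> B r \<subseteq> {v \<in> Rd d. \<forall>i<d. \<bar>v i\<bar> \<le> r * K1}"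
  using B_coord BD(1) by blast

lemma compact_B: "0 \<le> r \<Longrightarrow> compact (B r)"
  using compact_Int_closed[OF compact_box closed_B, of d "r * K1" r] B_subset_box[of r]
  by (simp only: Int_absorb1)

lemma box_subset_B: "\<exists>c>0. \<forall>r\<ge>0. {v \<in> Rd d. \<forall>i<d. \<bar>v i\<bar> \<le> r * c} \<subseteq> B r"
proof -
  obtain c where c: "0 < c" "\<And>x. x \<in> Rd d \<Longrightarrow> c * l1 d x \<le> nrm x" using l1_le_nrm by blast
  have "v \<in> B r" if r: "0 \<le> r" and v: "v \<in> Rd d" "\<forall>i<d. \<bar>v i\<bar> \<le> r * c" for r v
  proof -
    have "ip d v x \<le> r * nrm x" if x: "x \<in> Rd d" for x
    proof -
      have "ip d v x \<le> r * c * l1 d x" using ip_abs_le_l1[of d v "r * c" x] v by simp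
      also have "\<dots> \<le> r * nrm x" using mult_left_mono[OF c(2)[OF x] r] by (simp add: mult.assoc)
      finally show ?thesis .
    qed
    then show ?thesis using v by (simp add: B_def)
  qed
  then show ?thesis using c by blast
qed

text \<open>A Hahn-Banach argument: x is separated from a primal ball U that is slightly too small
  to contain it, and the separating functional is normalized.\<close>

lemma dual_norm_attained_approx:
  assumes x: "x \<in> Rd d" and a: "a < nrm x"
  shows "\<exists>w\<in>B 1. a < ip d w x"
proof (cases "a < 0")
  case True then show ?thesis using zero_in_B[of 1] by (intro bexI[of _ 0]) auto
next
  case False
  obtain c where c: "0 < c" "\<And>x. x \<in> Rd d \<Longrightarrow> c * l1 d x \<le> nrm x" using l1_le_nrm by blast
  \<comment> \<open>A radius strictly between: below \<open>nrm x\<close>, so that x lies outside U,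
    and above \<open>a\<close>, so that the value reached at x exceeds \<open>a\<close>.\<close>
  define a' where "a' = (a + nrm x) / 2"
  have a': "a < a'" "a' < nrm x" "0 < a'" using a False by (auto simp: a'_def)
  define U where "U = {u \<in> Rd d. nrm u \<le> a'}"
  have "closed U"
  proof -
    have "U = Rd d \<inter> nrm -` {..a'}" by (auto simp: U_def)
    then show ?thesis using continuous_closed_preimage[OF continuous_on_nrm closed_Rd closed_atMost] by simp
  qed
  moreover have "U \<subseteq> {v \<in> Rd d. \<forall>i<d. \<bar>v i\<bar> \<le> a' / c}"
  proof
    fix u assume u: "u \<in> U"
    then have uR: "u \<in> Rd d" and "nrm u \<le> a'" by (auto simp: U_def)
    then have "l1 d u \<le> a' / c" using c(2)[OF uR] c(1) by (simp add: field_simps)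
    moreover have "\<bar>u i\<bar> \<le> l1 d u" if "i < d" for i
      unfolding l1_def using member_le_sum[of i "{..<d}" "\<lambda>i. \<bar>u i\<bar>"] that by simp
    ultimately show "u \<in> {v \<in> Rd d. \<forall>i<d. \<bar>v i\<bar> \<le> a' / c}" using uR by fastforce
  qed
  ultimately have "compact U" using compact_Int_closed[OF compact_box, of U d "a' / c"] by (simp add: Int_absorb1)
  moreover have "convex U"
    unfolding U_def convex_def
  proof (intro ballI allI impI)
    fix y z u v assume yz: "y \<in> {u \<in> Rd d. nrm u \<le> a'}" "z \<in> {u \<in> Rd d. nrm u \<le> a'}" and uv: "0 \<le> (u::real)" "0 \<le> v" "u + v = 1"
    have "nrm (u *\<^sub>R y + v *\<^sub>R z) \<le> u * nrm y + v * nrm z"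
      using nrm_triangle[of "u *\<^sub>R y" "v *\<^sub>R z"] yz uv by (simp add: nrm_scale)
    also have "\<dots> \<le> a'" using convex_bound_le[of "nrm y" a' "nrm z" u v] yz uv by simp
    finally show "u *\<^sub>R y + v *\<^sub>R z \<in> {u \<in> Rd d. nrm u \<le> a'}" using yz by simp
  qed
  moreover have "0 \<in> U" using a' by (simp add: U_def)
  moreover have "x \<notin> U" using a' by (simp add: U_def)
  ultimately obtain p m where p: "p \<in> Rd d" "m < ip d p x" "\<And>u. u \<in> U \<Longrightarrow> ip d p u \<le> m"
  proof -
    have "U \<subseteq> Rd d" by (auto simp: U_def)
    with \<open>compact U\<close> \<open>convex U\<close> \<open>0 \<in> U\<close> \<open>x \<notin> U\<close> that show ?thesis
      using nearest_point_separation[of U d x] x by blast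
  qed
  define M where "M = ip d p x"
  have "0 \<le> m" using p(3)[OF \<open>0 \<in> U\<close>] by simp
  then have M: "0 < M" using p by (simp add: M_def)
  \<comment> \<open>Scaled to take the value \<open>a'\<close> at x. As p is less than M on U, w is
    at most \<open>a'\<close> on the ball of radius \<open>a'\<close>, which means dual norm at most
    1.\<close>
  define w where "w = (a' / M) *\<^sub>R p"
  have "ip d w y \<le> 1 * nrm y" if y: "y \<in> Rd d" for y
  proof (cases "nrm y = 0")
    case True then show ?thesis using nrm_eq_0[OF y] by simp
  next
    case False
    then have ny: "0 < nrm y" using nrm_nonneg[OF y] by linarith
    have "(a' / nrm y) *\<^sub>R y \<in> U" using y ny a' by (simp add: U_def nrm_scale)
    from p(3)[OF this] have "(a' / nrm y) * ip d p y \<le> M" using p(2) by (simp add: ip_scale M_def)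
    then show ?thesis using ny a' M by (simp add: w_def ip_scale field_simps)
  qed
  then have "w \<in> B 1" using p(1) by (simp add: B_def w_def)
  moreover have "ip d w x = a'" using M by (simp add: w_def ip_scale M_def)
  ultimately show ?thesis using a' by (intro bexI[of _ w]) auto
qed

lemma nrm_le_dualI:
  assumes "x \<in> Rd d" and "\<And>w. w \<in> B 1 \<Longrightarrow> ip d w x \<le> a"
  shows "nrm x \<le> a"
  using dual_norm_attained_approx[OF assms(1), of a] assms(2) by (meson linorder_not_le)

end

section \<open>Conjugates of work_state functions\<close>

lemma abs_le_iff_between: "\<bar>a\<bar> \<le> R \<longleftrightarrow> - R \<le> a \<and> a \<le> R" for a R :: real
  by linarith

context normed_Rd
begin

section \<open>Volume of dual balls and of their shells\<close>

lemma emeasure_finite: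
  assumes S: "S \<subseteq> B r" and r: "0 \<le> r"
  shows "emeasure (lebesgue_Rd d) S < \<infinity>"
proof -
  have K: "0 \<le> r * K1" using r K1_nonneg by simp
  have box: "{v \<in> Rd d. \<forall>i<d. \<bar>v i\<bar> \<le> r * K1} = {v \<in> Rd d. \<forall>i<d. - (r * K1) \<le> v i \<and> v i \<le> r * K1}"
    by (simp only: abs_le_iff_between)
  have "emeasure (lebesgue_Rd d) S \<le> emeasure (lebesgue_Rd d) {v \<in> Rd d. \<forall>i<d. \<bar>v i\<bar> \<le> r * K1}"
    by (rule emeasure_mono[OF order.trans[OF S B_subset_box[OF r]]])
      (simp only: sets_lam borel_closed[OF compact_imp_closed[OF compact_box]])
  also have "\<dots> < \<infinity>"
    unfolding box using emeasure_lam_box[of d "\<lambda>_. - (r * K1)" "\<lambda>_. r * K1"] K by simp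
  finally show ?thesis .
qed

lemma measure_B_pos: assumes r: "0 < r" shows "0 < measure (lebesgue_Rd d) (B r)"
proof -
  obtain c where c: "0 < c" "{v \<in> Rd d. \<forall>i<d. \<bar>v i\<bar> \<le> r * c} \<subseteq> B r"
    using box_subset_B less_imp_le[OF r] by blast
  have box: "{v \<in> Rd d. \<forall>i<d. \<bar>v i\<bar> \<le> r * c} = {v \<in> Rd d. \<forall>i<d. - (r * c) \<le> v i \<and> v i \<le> r * c}"
    by (simp only: abs_le_iff_between)
  have "0 < (\<Prod>i<d. r * c - - (r * c))" using r c by (intro prod_pos) auto
  moreover have "0 \<le> r * c" using r c by simp
  ultimately have "0 < emeasure (lebesgue_Rd d) {v \<in> Rd d. \<forall>i<d. \<bar>v i\<bar> \<le> r * c}"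
    unfolding box using emeasure_lam_box[of d "\<lambda>_. - (r * c)" "\<lambda>_. r * c"] by simp
  also have "\<dots> \<le> emeasure (lebesgue_Rd d) (B r)" by (rule emeasure_mono[OF c(2)]) simp
  finally show ?thesis
    using emeasure_finite[of "B r" r] r by (simp add: measure_def enn2real_positive_iff)
qed

lemma measure_scale:
  assumes c: "0 < c" and S: "S \<in> sets borel"
  shows "measure (lebesgue_Rd d) S = c ^ d * measure (lebesgue_Rd d) {v. c *\<^sub>R v \<in> S}"
  using emeasure_lam_affine[of c 0 d S] assms by (simp add: measure_def enn2real_mult)

lemma measure_translate:
  assumes a: "a \<in> Rd d" and S: "S \<in> sets borel"
  shows "measure (lebesgue_Rd d) {v. v - a \<in> S} = measure (lebesgue_Rd d) S"
  using emeasure_lam_affine[of 1 "- a" d S] assms by (simp add: measure_def)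

text \<open>Shrinking C by the factor (r - t) / r keeps it inside C and inside the smaller ball, so
  the shell has at most the fraction 1 - ((r - t) / r)^d of C, at most d * t / r by Bernoulli. This
  is the ratio of boundary to volume that yields the factor d; C is a general star-shaped set so
  that cones are covered as well.\<close>

lemma star_shell_measure:
  assumes C[measurable]: "C \<in> sets borel" and Cr: "C \<subseteq> B r" and star: "\<And>v c. v \<in> C \<Longrightarrow> 0 < c \<Longrightarrow> c \<le> 1 \<Longrightarrow> c *\<^sub>R v \<in> C"
    and r: "0 < r" "0 \<le> t" "t < r"
  shows "measure (lebesgue_Rd d) (C - B (r - t)) \<le> real d * t / r * measure (lebesgue_Rd d) C"
proof -
  define c where "c = (r - t) / r"
  have c: "0 < c" "c \<le> 1" using r by (auto simp: c_def)
  have cr: "c * r = r - t" using r by (simp add: c_def)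
  define S where "S = {v. (1 / c) *\<^sub>R v \<in> C}"
  have [measurable]: "S \<in> sets borel"
    unfolding S_def using measurable_sets[OF affine_measurable[of 0 "1 / c"] C] by (simp add: vimage_def)
  have SC: "S \<subseteq> C \<inter> B (r - t)"
  proof
    fix v assume "v \<in> S"
    then have v: "(1 / c) *\<^sub>R v \<in> C" by (simp add: S_def)
    have e: "c *\<^sub>R ((1 / c) *\<^sub>R v) = v" using c by simp
    have "(1 / c) *\<^sub>R v \<in> B r" using v Cr by blast
    from B_scale[OF this, of c] c have "v \<in> B (r - t)" by (simp add: cr)
    moreover have "v \<in> C" using star[OF v c] e by simp
    ultimately show "v \<in> C \<inter> B (r - t)" by blast
  qed
  have fin: "emeasure (lebesgue_Rd d) C \<noteq> \<infinity>" using emeasure_finite[OF Cr] r by auto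
  have "measure (lebesgue_Rd d) S = c ^ d * measure (lebesgue_Rd d) {v. c *\<^sub>R v \<in> S}"
    by (rule measure_scale) (use c in auto)
  also have "{v. c *\<^sub>R v \<in> S} = C" using c by (simp add: S_def)
  finally have mS: "measure (lebesgue_Rd d) S = c ^ d * measure (lebesgue_Rd d) C" .
  have "measure (lebesgue_Rd d) (C - B (r - t)) \<le> measure (lebesgue_Rd d) (C - S)"
  proof (rule measure_mono_fmeasurable)
    show "C - S \<in> fmeasurable (lebesgue_Rd d)"
      using emeasure_finite[of "C - S" r] Cr r by (intro fmeasurableI) auto
  qed (use SC in auto)
  also have "\<dots> = measure (lebesgue_Rd d) C - measure (lebesgue_Rd d) S"
    using SC fin by (intro measure_Diff) auto
  also have "\<dots> = (1 - c ^ d) * measure (lebesgue_Rd d) C" by (simp add: mS algebra_simps)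
  also have "\<dots> \<le> (real d * t / r) * measure (lebesgue_Rd d) C"
  proof (rule mult_right_mono)
    have "1 + real d * (- (t / r)) \<le> (1 + - (t / r)) ^ d"
      using r by (intro Bernoulli_inequality) (simp add: field_simps)
    also have "1 + - (t / r) = c" using r by (simp add: c_def field_simps)
    finally show "1 - c ^ d \<le> real d * t / r" by simp
  qed simp
  finally show ?thesis .
qed

section \<open>Integrals over bounded sets: translation, reflection, differences\<close>

lemma set_integrable_bounded:
  fixes h :: "point \<Rightarrow> real"
  assumes "h \<in> borel_measurable borel" "S \<in> sets borel" "S \<subseteq> B r" "0 \<le> r" "\<And>v. v \<in> S \<Longrightarrow> \<bar>h v\<bar> \<le> M"
  shows "set_integrable (lebesgue_Rd d) S h"
  unfolding set_integrable_def
  by (rule integrableI_bounded_set_indicator[where B=M]) (use assms emeasure_finite[OF assms(3,4)] in auto)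

lemma affine_measurable_lam: "(\<lambda>v. a + c *\<^sub>R v) \<in> lebesgue_Rd d \<rightarrow>\<^sub>M borel"
  by (subst measurable_cong_sets[OF sets_lam refl]) (rule affine_measurable)

lemma set_integral_translate:
  fixes h :: "point \<Rightarrow> real"
  assumes h: "h \<in> borel_measurable borel" and S: "S \<in> sets borel" and a: "a \<in> Rd d"
  shows "(LINT v:S|lebesgue_Rd d. h (v + a)) = (LINT v:{v. v - a \<in> S}|lebesgue_Rd d. h v)"
proof -
  have [measurable]: "{v. v - a \<in> S} \<in> sets borel"
    using measurable_sets[OF affine_measurable[of "- a" 1] S] by (simp add: vimage_def)
  note h[measurable]
  have "(LINT v:{v. v - a \<in> S}|lebesgue_Rd d. h v) = (\<integral>v. indicator {v. v - a \<in> S} v *\<^sub>R h v \<partial>distr (lebesgue_Rd d) borel (\<lambda>v. a + 1 *\<^sub>R v))"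
    using distr_lam_affine[OF _ a, of 1] by (simp add: set_lebesgue_integral_def)
  also have "\<dots> = (\<integral>v. indicator {v. v - a \<in> S} (a + 1 *\<^sub>R v) *\<^sub>R h (a + 1 *\<^sub>R v) \<partial>lebesgue_Rd d)"
    by (rule integral_distr[OF affine_measurable_lam]) measurable
  also have "\<dots> = (LINT v:S|lebesgue_Rd d. h (v + a))"
    unfolding set_lebesgue_integral_def by (intro Bochner_Integration.integral_cong) (auto simp: indicator_def add.commute)
  finally show ?thesis by simp
qed

lemma set_integral_reflect:
  fixes h :: "point \<Rightarrow> real"
  assumes h: "h \<in> borel_measurable borel" and S: "S \<in> sets borel" and sym: "\<And>v. - v \<in> S \<longleftrightarrow> v \<in> S"
  shows "(LINT v:S|lebesgue_Rd d. h (- v)) = (LINT v:S|lebesgue_Rd d. h v)"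
proof -
  note h[measurable] S[measurable]
  have "(LINT v:S|lebesgue_Rd d. h v) = (\<integral>v. indicator S v *\<^sub>R h v \<partial>distr (lebesgue_Rd d) borel (\<lambda>v. 0 + (-1) *\<^sub>R v))"
    using distr_lam_affine[of "-1" 0 d] by (simp add: set_lebesgue_integral_def)
  also have "\<dots> = (\<integral>v. indicator S (0 + (-1) *\<^sub>R v) *\<^sub>R h (0 + (-1) *\<^sub>R v) \<partial>lebesgue_Rd d)"
    by (rule integral_distr[OF affine_measurable_lam]) measurable
  also have "\<dots> = (LINT v:S|lebesgue_Rd d. h (- v))"
    unfolding set_lebesgue_integral_def using sym by (intro Bochner_Integration.integral_cong) (auto simp: indicator_def)
  finally show ?thesis by simp
qed

text \<open>What is lost on \<open>S' - S\<close> only helps. With \<open>S'\<close> a translate of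
  S the right-hand side lives near the boundary of S; this replaces the divergence theorem.\<close>

lemma set_integral_diff_le:
  fixes k :: "point \<Rightarrow> real"
  assumes k: "k \<in> borel_measurable borel" "\<And>v. v \<in> S \<union> S' \<Longrightarrow> 0 \<le> k v" "\<And>v. v \<in> S \<union> S' \<Longrightarrow> k v \<le> M"
    and S: "S \<in> sets borel" "S \<subseteq> B r" "S' \<in> sets borel" "S' \<subseteq> B r" "0 \<le> r"
  shows "(LINT v:S|lebesgue_Rd d. k v) - (LINT v:S'|lebesgue_Rd d. k v) \<le> (LINT v:S - S'|lebesgue_Rd d. k v)"
proof -
  have i: "set_integrable (lebesgue_Rd d) T k" if "T \<in> sets borel" "T \<subseteq> S \<union> S'" for T
    by (rule set_integrable_bounded[where r=r and M=M]) (use k S that in \<open>auto simp: abs_le_iff\<close>, fastforce+)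
  have "(LINT v:S|lebesgue_Rd d. k v) - (LINT v:S'|lebesgue_Rd d. k v) = (\<integral>v. indicator S v *\<^sub>R k v - indicator S' v *\<^sub>R k v \<partial>lebesgue_Rd d)"
    unfolding set_lebesgue_integral_def using i[of S] i[of S'] S by (subst Bochner_Integration.integral_diff) (auto simp: set_integrable_def)
  also have "\<dots> \<le> (\<integral>v. indicator (S - S') v *\<^sub>R k v \<partial>lebesgue_Rd d)"
    using i[of S] i[of S'] i[of "S - S'"] S k(2)
    by (intro integral_mono Bochner_Integration.integrable_diff) (auto simp: set_integrable_def indicator_def)
  finally show ?thesis by (simp add: set_lebesgue_integral_def)
qed

lemma set_integral_const: "S \<in> sets borel \<Longrightarrow> S \<subseteq> B r \<Longrightarrow> 0 \<le> r \<Longrightarrow> (LINT v:S|lebesgue_Rd d. (c::real)) = c * measure (lebesgue_Rd d) S"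
  using emeasure_finite[of S r] by (subst set_integral_const) auto

section \<open>Concave conjugates: measurability, coercivity, Lipschitz bounds\<close>

text \<open>The value 0 outside the dual ball, where the infimum may be unbounded below, keeps the
  function nonnegative, bounded and Borel on the whole type.\<close>

definition conjugate :: "point set \<Rightarrow> (point \<Rightarrow> real) \<Rightarrow> point \<Rightarrow> real"
  where "conjugate A F v = (if v \<in> B 1 then INF y\<in>A. F y - ip d v y else 0)"

text \<open>The last condition says that a work function is at least the distance from the starting
  point 0; it makes the infima in \<open>conjugate\<close> nonnegative.\<close>

definition state :: "point set \<Rightarrow> (point \<Rightarrow> real) \<Rightarrow> bool"
  where "state A F \<longleftrightarrow> A \<noteq> {} \<and> A \<subseteq> Rd d \<and> (\<forall>y\<in>A. nrm y \<le> F y)"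

lemma stateD: "state A F \<Longrightarrow> y \<in> A \<Longrightarrow> y \<in> Rd d" "state A F \<Longrightarrow> y \<in> A \<Longrightarrow> nrm y \<le> F y"
  by (auto simp: state_def)

lemma state_diff_nonneg: "state A F \<Longrightarrow> v \<in> B 1 \<Longrightarrow> y \<in> A \<Longrightarrow> 0 \<le> F y - ip d v y"
  using stateD[of A F y] BD(2)[of v 1 y] by simp

lemma conj_le: "state A F \<Longrightarrow> v \<in> B 1 \<Longrightarrow> y \<in> A \<Longrightarrow> conjugate A F v \<le> F y - ip d v y"
  using state_diff_nonneg by (auto simp: conjugate_def intro!: cINF_lower bdd_belowI[of _ 0])

lemma conj_geI: "state A F \<Longrightarrow> v \<in> B 1 \<Longrightarrow> (\<And>y. y \<in> A \<Longrightarrow> c \<le> F y - ip d v y) \<Longrightarrow> c \<le> conjugate A F v"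
  by (auto simp: conjugate_def state_def intro!: cINF_greatest)

lemma conj_nonneg: "state A F \<Longrightarrow> 0 \<le> conjugate A F v"
  using conj_geI[of A F v 0] state_diff_nonneg by (cases "v \<in> B 1") (auto simp: conjugate_def)

lemma conj_approx: "state A F \<Longrightarrow> v \<in> B 1 \<Longrightarrow> 0 < \<eta> \<Longrightarrow> \<exists>y\<in>A. F y - ip d v y < conjugate A F v + \<eta>"
  using conj_geI[of A F v "conjugate A F v + \<eta>"] by (smt (verit))

lemma conj_bounded: "state A F \<Longrightarrow> \<exists>M\<ge>0. \<forall>v. conjugate A F v \<le> M"
proof -
  assume st: "state A F"
  then obtain y where y: "y \<in> A" by (auto simp: state_def)
  have "conjugate A F v \<le> 2 * F y" for v
  proof (cases "v \<in> B 1")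
    case True
    have "\<bar>ip d v y\<bar> \<le> nrm y" using B_abs[OF True stateD(1)[OF st y]] by simp
    then show ?thesis using conj_le[OF st True y] stateD(2)[OF st y] by linarith
  next
    case False
    then show ?thesis using nrm_nonneg[OF stateD(1)[OF st y]] stateD(2)[OF st y] by (simp add: conjugate_def)
  qed
  moreover have "0 \<le> 2 * F y" using nrm_nonneg[OF stateD(1)[OF st y]] stateD(2)[OF st y] by simp
  ultimately show ?thesis by blast
qed

text \<open>An infimum of affine functions is upper semicontinuous: inside the dual ball its strict
  sublevel sets are unions of open half-spaces, however large A is.\<close>

lemma conj_measurable: assumes st: "state A F" shows "conjugate A F \<in> borel_measurable borel"
proof (rule borel_measurableI_less)
  fix c :: real
  have "{v. conjugate A F v < c} = (B 1 \<inter> (\<Union>y\<in>A. {v. F y - ip d v y < c})) \<union> (if 0 < c then - B 1 else {})"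
  proof (intro set_eqI)
    fix v
    have "conjugate A F v < c \<longleftrightarrow> (\<exists>y\<in>A. F y - ip d v y < c)" if "v \<in> B 1"
      using conj_le[OF st that] conj_geI[OF st that, of c] by (meson le_less_trans linorder_not_le)
    then show "v \<in> {v. conjugate A F v < c} \<longleftrightarrow> v \<in> (B 1 \<inter> (\<Union>y\<in>A. {v. F y - ip d v y < c})) \<union> (if 0 < c then - B 1 else {})"
      by (cases "v \<in> B 1") (auto simp: conjugate_def)
  qed
  moreover have "open (\<Union>y\<in>A. {v. F y - ip d v y < c})"
    by (intro open_UN ballI open_Collect_less continuous_intros)
  then have "(B 1 \<inter> (\<Union>y\<in>A. {v. F y - ip d v y < c})) \<union> (if 0 < c then - B 1 else {}) \<in> sets borel"
    by (intro sets.Un sets.Int B_borel borel_open) (auto simp: closed_B open_Compl)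
  ultimately show "{w \<in> space borel. conjugate A F w < c} \<in> sets borel" by simp
qed

text \<open>At depth \<delta> the dual vector v uses only the fraction 1 - \<delta> of
  \<open>nrm y\<close>, so the objective \<open>F y - ip d v y\<close> is at least
  \<open>\<delta> * nrm y\<close>.\<close>

lemma near_argmin_bound:
  assumes st: "state A F" and M: "\<And>v. conjugate A F v \<le> M" and v: "v \<in> B (1 - \<delta>)" and \<delta>: "0 < \<delta>"
    and y: "y \<in> A" "F y - ip d v y \<le> conjugate A F v + \<eta>"
  shows "nrm y \<le> (M + \<eta>) / \<delta>"
proof -
  have "nrm y - (1 - \<delta>) * nrm y \<le> F y - ip d v y"
    using stateD(2)[OF st y(1)] BD(2)[OF v stateD(1)[OF st y(1)]] by linarith
  also have "\<dots> \<le> M + \<eta>" using y(2) M[of v] by linarith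
  finally have "\<delta> * nrm y \<le> M + \<eta>" by (simp add: algebra_simps)
  then show ?thesis using \<delta> by (simp add: field_simps)
qed

text \<open>A near-minimizer at v competes in the infimum at u; the price is the change of the
  linear term at a point of norm about M / \<delta>.\<close>

lemma conj_le_of_near:
  assumes st: "state A F" and M: "\<And>v. conjugate A F v \<le> M" and v: "v \<in> B (1 - \<delta>)" and \<delta>: "0 < \<delta>"
    and u: "u \<in> B 1" and P: "\<And>y. y \<in> Rd d \<Longrightarrow> ip d v y - ip d u y \<le> L * nrm y" and L: "0 \<le> L"
  shows "conjugate A F u \<le> conjugate A F v + L * (M / \<delta>)"
proof (rule field_le_epsilon)
  fix e :: real assume e: "0 < e"
  \<comment> \<open>The slack enters twice, directly and through the norm bound (M + \<eta>) /
    \<delta>; this choice makes the two contributions add up to e.\<close>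
  define \<eta> where "\<eta> = e / (1 + L / \<delta>)"
  have L1: "0 < 1 + L / \<delta>" using L \<delta> by (simp add: add_pos_nonneg)
  have \<eta>: "0 < \<eta>" "\<eta> * (1 + L / \<delta>) = e" using e L1 by (simp_all add: \<eta>_def)
  have v1: "v \<in> B 1" using v B_mono[of "1 - \<delta>" 1] \<delta> by auto
  obtain y where y: "y \<in> A" "F y - ip d v y < conjugate A F v + \<eta>" using conj_approx[OF st v1 \<eta>(1)] by blast
  have ny: "nrm y \<le> (M + \<eta>) / \<delta>" using near_argmin_bound[OF st M v \<delta> y(1)] y(2) by simp
  have "conjugate A F u \<le> F y - ip d u y" by (rule conj_le[OF st u y(1)])
  also have "\<dots> \<le> conjugate A F v + \<eta> + L * nrm y" using y(2) P[OF stateD(1)[OF st y(1)]] by linarith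
  also have "\<dots> \<le> conjugate A F v + \<eta> + L * ((M + \<eta>) / \<delta>)" using mult_left_mono[OF ny L] by simp
  also have "\<dots> = conjugate A F v + L * (M / \<delta>) + e"
    using \<eta>(2) \<delta> by (simp add: algebra_simps add_divide_distrib)
  finally show "conjugate A F u \<le> conjugate A F v + L * (M / \<delta>) + e" .
qed

lemma conj_shift_le:
  assumes st: "state A F" and M: "\<And>v. conjugate A F v \<le> M" and v: "v \<in> B (1 - \<delta>)" and \<delta>: "0 < \<delta>"
    and w: "w \<in> B 1" and t: "0 \<le> t" "t \<le> \<delta>"
  shows "conjugate A F (v + t *\<^sub>R w) \<le> conjugate A F v + t * (M / \<delta>)"
proof (rule conj_le_of_near[OF st M v \<delta>])
  show "v + t *\<^sub>R w \<in> B 1" using B_shift[OF v w t(1)] B_mono[of "1 - \<delta> + t" 1] t by auto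
  fix y assume "y \<in> Rd d"
  then show "ip d v y - ip d (v + t *\<^sub>R w) y \<le> t * nrm y"
    using B_abs[OF w, of y] t mult_left_mono[of "- ip d w y" "nrm y" t] by (simp add: ip_add ip_scale)
qed (use t in auto)

section \<open>Averages of near-minimizers\<close>

text \<open>Compares a step function on a finite partition of S with \<psi>. Signs are free, since
  the differences of conjugates to which it is applied can be negative.\<close>

lemma sum_measure_le_integral:
  fixes P :: "nat \<Rightarrow> point set"
  assumes n: "\<And>i. i < n \<Longrightarrow> P i \<in> sets borel" and disj: "disjoint_family_on P {..<n}" and un: "(\<Union>i<n. P i) = S"
    and S: "S \<subseteq> B r" "0 \<le> r"
    and \<psi>: "\<psi> \<in> borel_measurable borel" "\<And>v. v \<in> S \<Longrightarrow> \<bar>\<psi> v\<bar> \<le> M"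
    and le: "\<And>i v. i < n \<Longrightarrow> v \<in> P i \<Longrightarrow> \<phi> i \<le> \<psi> v"
  shows "(\<Sum>i<n. \<phi> i * measure (lebesgue_Rd d) (P i)) \<le> (LINT v:S|lebesgue_Rd d. \<psi> v)"
proof -
  have sub: "P i \<subseteq> S" if "i < n" for i using un that by blast
  have int: "set_integrable (lebesgue_Rd d) (P i) \<psi>" if "i < n" for i
    by (rule set_integrable_bounded[where r=r and M=M]) (use n \<psi> S sub[OF that] that in auto)
  have "(\<Sum>i<n. \<phi> i * measure (lebesgue_Rd d) (P i)) \<le> (\<Sum>i<n. LINT v:P i|lebesgue_Rd d. \<psi> v)"
  proof (rule sum_mono)
    fix i assume "i \<in> {..<n}"
    then have i: "i < n" by simp
    have "P i \<subseteq> B r" using sub[OF i] S by blast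
    have "\<phi> i * measure (lebesgue_Rd d) (P i) = (LINT v:P i|lebesgue_Rd d. \<phi> i)"
      using set_integral_const[OF n[OF i] \<open>P i \<subseteq> B r\<close> S(2)] by simp
    also have "\<dots> \<le> (LINT v:P i|lebesgue_Rd d. \<psi> v)"
    proof (rule set_integral_mono)
      show "set_integrable (lebesgue_Rd d) (P i) (\<lambda>v. \<phi> i)"
        by (rule set_integrable_bounded[OF _ n[OF i] \<open>P i \<subseteq> B r\<close> S(2), of _ "\<bar>\<phi> i\<bar>"]) auto
    qed (use int[OF i] le[OF i] in auto)
    finally show "\<phi> i * measure (lebesgue_Rd d) (P i) \<le> (LINT v:P i|lebesgue_Rd d. \<psi> v)" .
  qed
  also have "\<dots> = (LINT v:S|lebesgue_Rd d. \<psi> v)"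
    unfolding un[symmetric] using n int disj
    by (subst set_integral_finite_Union) auto
  finally show ?thesis .
qed

text \<open>A finite convex combination of near-minimizers replaces the average of the minimizers, so that
  no measurable selection is needed.\<close>

lemma exists_averaged_point:
  fixes h G :: "point \<Rightarrow> real"
  assumes st: "state A F" and h: "convex_on A h"
    and G: "G \<in> borel_measurable borel" "\<And>v. 0 \<le> G v" "\<And>v. G v \<le> MG"
    and hG: "\<And>v y. v \<in> B 1 \<Longrightarrow> y \<in> A \<Longrightarrow> h y + G v \<le> F y - ip d v y"
    and \<delta>: "0 < \<delta>" "2 * \<delta> < 1" and \<eta>: "0 < \<eta>" and t: "0 \<le> t" "t \<le> \<delta>"
  defines "S \<equiv> B (1 - 2 * \<delta>)"
  shows "\<exists>s\<in>A. h s * measure (lebesgue_Rd d) S \<le> (LINT v:S|lebesgue_Rd d. conjugate A F v - G v + \<eta>) \<and>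
    (\<forall>w\<in>B 1. t * ip d w s * measure (lebesgue_Rd d) S \<le> (LINT v:S|lebesgue_Rd d. conjugate A F v - conjugate A F (v + t *\<^sub>R w) + \<eta>))"
proof -
  define H where "H = conjugate A F"
  note stH[measurable] = conj_measurable[OF st, folded H_def] and G(1)[measurable]
  obtain M where M: "0 \<le> M" "\<And>v. H v \<le> M" using conj_bounded[OF st] unfolding H_def by blast
  have H0: "0 \<le> H v" for v using conj_nonneg[OF st] by (simp add: H_def)
  obtain c where c: "0 < c" "\<And>x. x \<in> Rd d \<Longrightarrow> c * l1 d x \<le> nrm x" using l1_le_nrm by blast
  \<comment> \<open>A third of the slack each for near-minimality at the centre u, for moving the
    linear term from u to v, and for the change of H from u to v. The cap 1 keeps the norm bound,
    and so \<kappa>, independent of \<eta>.\<close>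
  define \<eta>' where "\<eta>' = min (\<eta> / 3) 1"
  have \<eta>': "0 < \<eta>'" "\<eta>' \<le> 1" "3 * \<eta>' \<le> \<eta>" using \<eta> by (auto simp: \<eta>'_def)
  \<comment> \<open>Per unit of l1 distance this bounds both the variation of H on S and the change
    of the linear term at any of the near-minimizers.\<close>
  define \<kappa> where "\<kappa> = (M + 1) / (c * \<delta>)"
  have \<kappa>: "0 < \<kappa>" using M c \<delta> by (simp add: \<kappa>_def add_nonneg_pos)
  have SB: "S \<subseteq> B (1 - \<delta>)" "S \<subseteq> B 1" unfolding S_def using \<delta> by (intro B_mono; simp)+
  have S_borel[measurable]: "S \<in> sets borel" by (simp add: S_def)
  have ip_l1: "\<bar>ip d a y\<bar> \<le> l1 d a / c * nrm y" if "y \<in> Rd d" for a y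
  proof -
    have "\<bar>a i\<bar> \<le> l1 d a" if "i < d" for i
      unfolding l1_def using member_le_sum[of i "{..<d}" "\<lambda>i. \<bar>a i\<bar>"] that by simp
    then have "\<bar>ip d a y\<bar> \<le> l1 d a * l1 d y" by (rule ip_abs_le_l1)
    also have "\<dots> \<le> l1 d a * (nrm y / c)"
      using c(2)[OF that] c(1) by (intro mult_left_mono) (simp_all add: field_simps l1_nonneg)
    finally show ?thesis by simp
  qed
  have lip: "H u \<le> H v + \<kappa> * l1 d (u - v)" if "u \<in> S" "v \<in> S" for u v
  proof -
    have "H u \<le> H v + l1 d (u - v) / c * (M / \<delta>)"
      unfolding H_def
    proof (rule conj_le_of_near[OF st M(2)[unfolded H_def] _ \<delta>(1)])
      fix y assume "y \<in> Rd d"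
      from ip_l1[OF this, of "u - v"] show "ip d v y - ip d u y \<le> l1 d (u - v) / c * nrm y" by (simp add: ip_diff)
    qed (use that SB c in \<open>auto simp: l1_nonneg\<close>)
    also have "l1 d (u - v) / c * (M / \<delta>) \<le> \<kappa> * l1 d (u - v)"
      using c \<delta> M l1_nonneg[of d "u - v"] by (simp add: \<kappa>_def divide_simps mult_mono) (simp add: algebra_simps)
    finally show ?thesis by simp
  qed
  have "\<forall>u\<in>S. \<exists>y. y \<in> A \<and> F y - ip d u y < H u + \<eta>'"
    using conj_approx[OF st _ \<eta>'(1)] SB unfolding H_def by blast
  then obtain Y where Y: "\<And>u. u \<in> S \<Longrightarrow> Y u \<in> A" "\<And>u. u \<in> S \<Longrightarrow> F (Y u) - ip d u (Y u) < H u + \<eta>'"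
    by (metis (full_types))
  \<comment> \<open>The neighbourhood of u on which the single point \<open>Y u\<close> remains an
    \<eta>-minimizer. Finitely many of them cover the compact S and are then made disjoint.\<close>
  define N where "N = (\<lambda>u. {v. \<kappa> * l1 d (u - v) < \<eta>'})"
  have N_open: "open (N u)" for u
    unfolding N_def by (intro open_Collect_less continuous_intros continuous_on_l1)
  have near: "F (Y u) - ip d v (Y u) \<le> H v + \<eta>" if u: "u \<in> S" and v: "v \<in> S" "v \<in> N u" for u v
  proof -
    have YR: "Y u \<in> Rd d" using stateD(1)[OF st Y(1)[OF u]] .
    have "nrm (Y u) \<le> (M + \<eta>') / \<delta>"
      by (rule near_argmin_bound[OF st M(2)[unfolded H_def] _ \<delta>(1) Y(1)[OF u]])
        (use u SB Y(2)[OF u] in \<open>auto simp: H_def\<close>)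
    also have "\<dots> \<le> (M + 1) / \<delta>" using \<eta>' \<delta> by (simp add: divide_right_mono)
    finally have "l1 d (u - v) / c * nrm (Y u) \<le> l1 d (u - v) / c * ((M + 1) / \<delta>)"
      using c l1_nonneg by (intro mult_left_mono) auto
    then have "ip d (u - v) (Y u) \<le> \<kappa> * l1 d (u - v)"
      using ip_l1[OF YR, of "u - v"] by (simp add: \<kappa>_def mult.commute)
    then have "F (Y u) - ip d v (Y u) \<le> F (Y u) - ip d u (Y u) + \<kappa> * l1 d (u - v)" by (simp add: ip_diff)
    also have "\<dots> \<le> H v + 3 * \<eta>'"
      using Y(2)[OF u] lip[OF u v(1)] v(2) by (simp add: N_def)
    finally show ?thesis using \<eta>' by linarith
  qed
  have "compact S" unfolding S_def using \<delta> by (intro compact_B) simp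
  moreover have "S \<subseteq> (\<Union>u\<in>S. N u)" using \<eta>' by (auto simp: N_def l1_def)
  ultimately obtain U where U: "U \<subseteq> S" "finite U" "S \<subseteq> (\<Union>u\<in>U. N u)"
    using compactE_image[of S S N] N_open by blast
  obtain n and e :: "nat \<Rightarrow> point" where e: "U = e ` {i. i < n}" using finite_imp_nat_seg_image_inj_on[OF U(2)] by blast
  have eS: "e i \<in> S" if "i < n" for i using e U(1) that by blast
  define P where "P = (\<lambda>i. S \<inter> N (e i) - (\<Union>j<i. N (e j)))"
  have Pb: "P i \<in> sets borel" for i
    unfolding P_def using N_open by (intro sets.Diff sets.Int S_borel borel_open open_UN) auto
  have disj: "disjoint_family_on P {..<n}"
    unfolding disjoint_family_on_def
  proof (intro ballI impI)
    fix i j :: nat assume "i \<noteq> j"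
    then consider "i < j" | "j < i" by linarith
    then show "P i \<inter> P j = {}" by cases (auto simp: P_def)
  qed
  have un: "(\<Union>i<n. P i) = S"
  proof
    show "S \<subseteq> (\<Union>i<n. P i)"
    proof
      fix v assume v: "v \<in> S"
      then obtain i where i: "i < n" "v \<in> N (e i)" using U(3) e by auto
      define k where "k = (LEAST i. v \<in> N (e i))"
      have "v \<in> N (e k)" "k \<le> i" "\<And>j. j < k \<Longrightarrow> v \<notin> N (e j)"
        unfolding k_def using i(2) by (auto intro: LeastI Least_le dest: not_less_Least)
      then show "v \<in> (\<Union>i<n. P i)" using v i(1) by (auto simp: P_def intro!: bexI[of _ k])
    qed
  qed (auto simp: P_def)
  have r0: "0 \<le> 1 - 2 * \<delta>" "0 < 1 - 2 * \<delta>" using \<delta> by auto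
  note SI = sum_measure_le_integral[OF Pb disj un _ r0(1)]
  define m where "m = measure (lebesgue_Rd d) S"
  have m: "0 < m" unfolding m_def S_def by (rule measure_B_pos[OF r0(2)])
  define a where "a = (\<lambda>i. measure (lebesgue_Rd d) (P i) / m)"
  have a0: "0 \<le> a i" for i using m by (simp add: a_def)
  have "(\<Sum>i<n. measure (lebesgue_Rd d) (P i)) = m"
  proof -
    \<comment> \<open>The constants 1 and -1 give the two inequalities of additivity, so that the
      weights sum to 1.\<close>
    have 1: "(\<Sum>i<n. 1 * measure (lebesgue_Rd d) (P i)) \<le> (LINT v:S|lebesgue_Rd d. 1)" by (rule SI[where M=1]) (auto simp: S_def)
    have 2: "(\<Sum>i<n. - 1 * measure (lebesgue_Rd d) (P i)) \<le> (LINT v:S|lebesgue_Rd d. - 1)" by (rule SI[where M=1]) (auto simp: S_def)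
    have 3: "(LINT v:S|lebesgue_Rd d. c) = c * m" for c
      unfolding m_def by (rule set_integral_const[OF _ _ r0(1)]) (auto simp: S_def)
    show ?thesis using 1 2 unfolding 3 by (simp add: sum_negf)
  qed
  then have a1: "(\<Sum>i<n. a i) = 1" using m by (simp add: a_def sum_divide_distrib[symmetric])
  then have n0: "{..<n} \<noteq> {}" by auto
  define s where "s = (\<Sum>i<n. a i *\<^sub>R Y (e i))"
  have YA: "Y (e i) \<in> A" if "i < n" for i using Y(1)[OF eS[OF that]] .
  have "convex A" using h by (simp add: convex_on_def)
  then have sA: "s \<in> A" unfolding s_def using a1 a0 YA by (intro convex_sum) auto
  have PS: "v \<in> S" "v \<in> N (e i)" if "v \<in> P i" for v i using that by (auto simp: P_def)
  have am: "a i * m = measure (lebesgue_Rd d) (P i)" for i using m by (simp add: a_def)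
  have "h s * m \<le> (\<Sum>i<n. a i * h (Y (e i))) * m"
    unfolding s_def using convex_on_sum[OF _ n0 h a1 a0, of "\<lambda>i. Y (e i)"] YA m by (intro mult_right_mono) auto
  also have "\<dots> = (\<Sum>i<n. h (Y (e i)) * measure (lebesgue_Rd d) (P i))"
    unfolding sum_distrib_right am[symmetric] by (simp add: mult_ac)
  also have "\<dots> \<le> (LINT v:S|lebesgue_Rd d. H v - G v + \<eta>)"
  proof (rule SI)
    show "h (Y (e i)) \<le> H v - G v + \<eta>" if "i < n" "v \<in> P i" for i v
      using hG[of v "Y (e i)"] YA[OF that(1)] near[OF eS[OF that(1)] PS[OF that(2)]] SB PS[OF that(2)] by fastforce
    show "\<bar>H v - G v + \<eta>\<bar> \<le> M + MG + \<eta>" for v using H0[of v] M(2)[of v] G(2,3)[of v] \<eta> by linarith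
  qed (auto simp: S_def)
  finally have 1: "h s * m \<le> (LINT v:S|lebesgue_Rd d. H v - G v + \<eta>)" .
  have 2: "t * ip d w s * m \<le> (LINT v:S|lebesgue_Rd d. H v - H (v + t *\<^sub>R w) + \<eta>)" if w: "w \<in> B 1" for w
  proof -
    have [measurable]: "(\<lambda>v. H (v + t *\<^sub>R w)) \<in> borel_measurable borel"
      using measurable_compose[OF affine_measurable[of "t *\<^sub>R w" 1] stH] by (simp add: add.commute)
    have "t * ip d w s * m = (\<Sum>i<n. t * ip d w (Y (e i)) * measure (lebesgue_Rd d) (P i))"
      unfolding s_def ip_sum ip_scale sum_distrib_left sum_distrib_right am[symmetric] by (simp add: mult_ac)
    also have "\<dots> \<le> (LINT v:S|lebesgue_Rd d. H v - H (v + t *\<^sub>R w) + \<eta>)"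
    proof (rule SI)
      \<comment> \<open>The near-minimizer for v competes in the infimum at
        \<open>v + t *\<^sub>R w\<close>, where its objective is lower by
        \<open>t * ip d w (Y (e i))\<close>.\<close>
      show "t * ip d w (Y (e i)) \<le> H v - H (v + t *\<^sub>R w) + \<eta>" if i: "i < n" "v \<in> P i" for i v
      proof -
        have "v + t *\<^sub>R w \<in> B (1 - \<delta> + t)" using PS[OF i(2)] SB by (intro B_shift w t) auto
        then have "v + t *\<^sub>R w \<in> B 1" using B_mono[of "1 - \<delta> + t" 1] t by auto
        from conj_le[OF st this YA[OF i(1)]]
        show ?thesis using near[OF eS[OF i(1)] PS[OF i(2)]] by (simp add: H_def ip_add ip_scale)
      qed
      show "\<bar>H v - H (v + t *\<^sub>R w) + \<eta>\<bar> \<le> M + M + \<eta>" for v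
        using H0[of v] M(2)[of v] H0[of "v + t *\<^sub>R w"] M(2)[of "v + t *\<^sub>R w"] \<eta> by linarith
    qed (auto simp: S_def)
    finally show ?thesis .
  qed
  show ?thesis using sA 1 2 unfolding m_def H_def by blast
qed

text \<open>For exact Steiner points both sides agree to first order in the step: the component of s in
  direction w is the average of minus the derivative of the conjugate in direction w.\<close>

definition near_steiner :: "real \<Rightarrow> point set \<Rightarrow> (point \<Rightarrow> real) \<Rightarrow> point \<Rightarrow> bool"
  where "near_steiner \<delta> A F s \<longleftrightarrow> s \<in> Rd d \<and>
    (\<forall>w\<in>B 1. \<delta>\<^sup>2 * ip d w s * measure (lebesgue_Rd d) (B (1 - 2 * \<delta>)) \<le>
      (LINT v:B (1 - 2 * \<delta>)|lebesgue_Rd d. conjugate A F v - conjugate A F (v + \<delta>\<^sup>2 *\<^sub>R w) + \<delta> ^ 3))"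

section \<open>Movement in a dual direction as flux through the boundary\<close>

text \<open>Only upper bounds on pairings are available, so s' is tested with w and s with -w. After
  translation the forward differences leave the increment of the conjugate on S minus its translate,
  which is the flux. The mismatch of forward and backward differences of the old conjugate is a
  second difference: a first difference of size t * M / \<delta>, integrated over a shell of
  thickness t = \<delta>^2.\<close>

lemma near_steiner_step:
  assumes s: "near_steiner \<delta> A F s" "near_steiner \<delta> A' F' s'" and st: "state A F" "state A' F'"
    and le: "\<And>v. conjugate A F v \<le> conjugate A' F' v" and M: "\<And>v. conjugate A F v \<le> M"
    and \<delta>: "0 < \<delta>" "8 * \<delta> \<le> 1" and w: "w \<in> B 1"
  defines "S \<equiv> B (1 - 2 * \<delta>)"
  shows "\<delta>\<^sup>2 * ip d w (s' - s) * measure (lebesgue_Rd d) S \<le>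
    (LINT v:S - {v. v - \<delta>\<^sup>2 *\<^sub>R w \<in> S}|lebesgue_Rd d. conjugate A' F' v - conjugate A F v) +
    (2 * \<delta>\<^sup>2 * (M / \<delta>) * (real d * \<delta>\<^sup>2 / (1 - 2 * \<delta>)) + 2 * \<delta> ^ 3) * measure (lebesgue_Rd d) S"
proof -
  define a b where "a = conjugate A' F'" and "b = conjugate A F"
  define t r m R where "t = \<delta>\<^sup>2" and "r = 1 - 2 * \<delta>" and "m = measure (lebesgue_Rd d) S" and "R = M / \<delta>"
  have t: "0 < t" "2 * t \<le> \<delta>" "t < r" and r: "0 < r" "0 \<le> r"
  proof -
    have "\<delta> * \<delta> \<le> \<delta> * (1 / 8)" using \<delta> by (intro mult_left_mono) auto
    then have "2 * t \<le> \<delta>" using \<delta> unfolding t_def power2_eq_square by linarith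
    moreover have "0 < t" using \<delta> by (simp add: t_def)
    ultimately show "0 < t" "2 * t \<le> \<delta>" "t < r" "0 < r" "0 \<le> r" using \<delta> unfolding r_def by linarith+
  qed
  have Sr: "S = B r" by (simp add: S_def r_def)
  have S_borel[measurable]: "S \<in> sets borel" by (simp add: S_def)
  have ab: "a \<in> borel_measurable borel" "b \<in> borel_measurable borel"
    unfolding a_def b_def by (intro conj_measurable st)+
  note ab[measurable]
  obtain Ma where Ma: "\<And>v. a v \<le> Ma" using conj_bounded[OF st(2)] unfolding a_def by blast
  have a0: "0 \<le> a v" "0 \<le> b v" "b v \<le> M" "b v \<le> a v" for v
    using conj_nonneg[OF st(1)] conj_nonneg[OF st(2)] M le by (auto simp: a_def b_def)
  have Ma0: "0 \<le> Ma" "0 \<le> M" using a0[of 0] Ma[of 0] by linarith+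
  have wR: "w \<in> Rd d" using w by (rule BD)
  have twR: "t *\<^sub>R w \<in> Rd d" "t *\<^sub>R (- w) \<in> Rd d" using wR by auto
  have mw: "- w \<in> B 1" using w by (simp add: B_minus_iff)
  define Sp Sm where "Sp = {v. v - t *\<^sub>R w \<in> S}" and "Sm = {v. v - t *\<^sub>R (- w) \<in> S}"
  have [measurable]: "Sp \<in> sets borel" "Sm \<in> sets borel"
    unfolding Sp_def Sm_def using measurable_sets[OF affine_measurable[of "- t *\<^sub>R w" 1] S_borel]
      measurable_sets[OF affine_measurable[of "t *\<^sub>R w" 1] S_borel] by (simp_all add: vimage_def add.commute)
  have SpB: "Sp \<subseteq> B (r + t)"
  proof
    fix v assume "v \<in> Sp"
    from B_shift[OF this[unfolded Sp_def Sr mem_Collect_eq] w, of t] t show "v \<in> B (r + t)" by simp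
  qed
  have SmB: "Sm \<subseteq> B (r + t)"
  proof
    fix v assume "v \<in> Sm"
    from B_shift[OF this[unfolded Sm_def Sr mem_Collect_eq] mw, of t] t show "v \<in> B (r + t)" by simp
  qed
  have SB: "S \<subseteq> B (r + t)" unfolding Sr using t by (intro B_mono) auto
  have rt: "0 \<le> r + t" using r t by simp
  have I: "set_integrable (lebesgue_Rd d) T f"
    if "f \<in> borel_measurable borel" "T \<in> sets borel" "T \<subseteq> B (r + t)" "\<And>v. \<bar>f v\<bar> \<le> C" for f :: "point \<Rightarrow> real" and T C
    using that rt by (intro set_integrable_bounded[where r="r + t" and M=C])
  have shm: "(\<lambda>v. f (v + t *\<^sub>R w)) \<in> borel_measurable borel" "(\<lambda>v. f (v + t *\<^sub>R (- w))) \<in> borel_measurable borel"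
    if "f \<in> borel_measurable borel" for f :: "point \<Rightarrow> real"
    using measurable_compose[OF affine_measurable[of "t *\<^sub>R w" 1] that] measurable_compose[OF affine_measurable[of "t *\<^sub>R (-w)" 1] that]
    by (simp_all add: add.commute)
  note shm[OF ab(1), measurable] shm[OF ab(2), measurable]
  have Ia: "set_integrable (lebesgue_Rd d) T a" "set_integrable (lebesgue_Rd d) T b" "set_integrable (lebesgue_Rd d) T (\<lambda>v. a (v + t *\<^sub>R w))"
    "set_integrable (lebesgue_Rd d) T (\<lambda>v. b (v + t *\<^sub>R w))" "set_integrable (lebesgue_Rd d) T (\<lambda>v. b (v + t *\<^sub>R (- w)))" "set_integrable (lebesgue_Rd d) T (\<lambda>v. c)"
    if "T \<in> sets borel" "T \<subseteq> B (r + t)" for T and c :: real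
  proof -
    have A: "\<bar>a v\<bar> \<le> Ma" "\<bar>b v\<bar> \<le> M" for v using a0[of v] Ma[of v] by simp_all
    show "set_integrable (lebesgue_Rd d) T a" by (rule I[OF ab(1) that A(1)])
    show "set_integrable (lebesgue_Rd d) T b" by (rule I[OF ab(2) that A(2)])
    show "set_integrable (lebesgue_Rd d) T (\<lambda>v. a (v + t *\<^sub>R w))" by (rule I[OF shm(1)[OF ab(1)] that A(1)])
    show "set_integrable (lebesgue_Rd d) T (\<lambda>v. b (v + t *\<^sub>R w))" by (rule I[OF shm(1)[OF ab(2)] that A(2)])
    show "set_integrable (lebesgue_Rd d) T (\<lambda>v. b (v + t *\<^sub>R (- w)))" by (rule I[OF shm(2)[OF ab(2)] that A(2)])
    show "set_integrable (lebesgue_Rd d) T (\<lambda>v. c)" by (rule I[OF _ that, of _ "\<bar>c\<bar>"]) auto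
  qed
  have const: "(LINT v:T|lebesgue_Rd d. c) = c * measure (lebesgue_Rd d) T" if "T \<in> sets borel" "T \<subseteq> B (r + t)" for T and c :: real
    by (rule set_integral_const[OF that rt])
  have 1: "t * ip d w s' * m \<le> (LINT v:S|lebesgue_Rd d. a v) - (LINT v:Sp|lebesgue_Rd d. a v) + \<delta> ^ 3 * m"
  proof -
    have "t * ip d w s' * m \<le> (LINT v:S|lebesgue_Rd d. a v - a (v + t *\<^sub>R w) + \<delta> ^ 3)"
      using s(2) w unfolding near_steiner_def a_def t_def m_def S_def by blast
    also have "\<dots> = (LINT v:S|lebesgue_Rd d. a v) - (LINT v:S|lebesgue_Rd d. a (v + t *\<^sub>R w)) + \<delta> ^ 3 * m"
      using Ia[OF S_borel SB] const[OF S_borel SB] by (simp add: m_def)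
    also have "(LINT v:S|lebesgue_Rd d. a (v + t *\<^sub>R w)) = (LINT v:Sp|lebesgue_Rd d. a v)"
      unfolding Sp_def by (rule set_integral_translate[OF ab(1) S_borel twR(1)])
    finally show ?thesis .
  qed
  have 2: "- t * ip d w s * m \<le> (LINT v:S|lebesgue_Rd d. b v) - (LINT v:Sm|lebesgue_Rd d. b v) + \<delta> ^ 3 * m"
  proof -
    have "t * ip d (- w) s * m \<le> (LINT v:S|lebesgue_Rd d. b v - b (v + t *\<^sub>R (- w)) + \<delta> ^ 3)"
      using s(1) mw unfolding near_steiner_def b_def t_def m_def S_def by blast
    also have "\<dots> = (LINT v:S|lebesgue_Rd d. b v) - (LINT v:S|lebesgue_Rd d. b (v + t *\<^sub>R (- w))) + \<delta> ^ 3 * m"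
      using Ia[OF S_borel SB] const[OF S_borel SB] by (simp add: m_def)
    also have "(LINT v:S|lebesgue_Rd d. b (v + t *\<^sub>R (- w))) = (LINT v:Sm|lebesgue_Rd d. b v)"
      unfolding Sm_def by (rule set_integral_translate[OF ab(2) S_borel twR(2)])
    finally show ?thesis by (simp only: ip_minus mult_minus_left mult_minus_right)
  qed
  \<comment> \<open>The old conjugate was differenced backwards in 2, but the flux needs it
    forwards. The correction is the integral of \<beta> over S minus that over Sm.\<close>
  define \<beta> where "\<beta> = (\<lambda>v. b v - b (v + t *\<^sub>R w))"
  have \<beta>m[measurable]: "\<beta> \<in> borel_measurable borel" unfolding \<beta>_def by measurable
  have I\<beta>: "set_integrable (lebesgue_Rd d) T \<beta>" if "T \<in> sets borel" "T \<subseteq> B (r + t)" for T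
    unfolding \<beta>_def using Ia[OF that] by auto
  have R0: "0 \<le> t * R" using Ma0 \<delta> t by (simp add: R_def)
  have \<beta>b: "- (t * R) \<le> \<beta> v" "\<beta> v \<le> t * R" if v: "v \<in> B (r + t)" for v
  proof -
    have v1: "v \<in> B (1 - \<delta>)" using v B_mono[of "r + t" "1 - \<delta>"] t \<delta> by (auto simp: r_def)
    have v2: "v + t *\<^sub>R w \<in> B (1 - \<delta>)"
      using B_shift[OF v w, of t] B_mono[of "r + t + t" "1 - \<delta>"] t \<delta> by (auto simp: r_def)
    have "t \<le> \<delta>" "0 \<le> t" using t by auto
    from conj_shift_le[OF st(1) M v1 \<delta>(1) w this(2,1)] show "- (t * R) \<le> \<beta> v" by (simp add: \<beta>_def b_def R_def)
    from conj_shift_le[OF st(1) M v2 \<delta>(1) mw \<open>0 \<le> t\<close> \<open>t \<le> \<delta>\<close>] show "\<beta> v \<le> t * R" by (simp add: \<beta>_def b_def R_def)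
  qed
  have 3: "(LINT v:S|lebesgue_Rd d. \<beta> v) - (LINT v:Sm|lebesgue_Rd d. \<beta> v) \<le> 2 * t * R * (real d * t / r * m)"
  proof -
    \<comment> \<open>Adding the bound makes the integrand nonnegative, as
      \<open>set_integral_diff_le\<close> requires; S and its translate Sm have equal measure, so
      the added constants cancel.\<close>
    define k where "k = (\<lambda>v. \<beta> v + t * R)"
    have kT: "(LINT v:T|lebesgue_Rd d. k v) = (LINT v:T|lebesgue_Rd d. \<beta> v) + t * R * measure (lebesgue_Rd d) T"
      if "T \<in> sets borel" "T \<subseteq> B (r + t)" for T
      unfolding k_def using I\<beta>[OF that] Ia(6)[OF that] const[OF that] by simp
    have mSm: "measure (lebesgue_Rd d) Sm = m" unfolding Sm_def m_def by (rule measure_translate[OF twR(2) S_borel])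
    have "(LINT v:S|lebesgue_Rd d. \<beta> v) - (LINT v:Sm|lebesgue_Rd d. \<beta> v) = (LINT v:S|lebesgue_Rd d. k v) - (LINT v:Sm|lebesgue_Rd d. k v)"
      using kT[OF S_borel SB] kT[of Sm] SmB mSm by (simp add: m_def)
    also have "\<dots> \<le> (LINT v:S - Sm|lebesgue_Rd d. k v)"
    proof (rule set_integral_diff_le[where r="r + t" and M="2 * (t * R)"])
      show "0 \<le> k v" "k v \<le> 2 * (t * R)" if "v \<in> S \<union> Sm" for v
      proof -
        have "v \<in> B (r + t)" using SB SmB that by blast
        from \<beta>b[OF this] show "0 \<le> k v" "k v \<le> 2 * (t * R)" unfolding k_def by linarith+
      qed
    qed (use SB SmB rt in \<open>auto simp: k_def\<close>)
    also have "\<dots> \<le> (LINT v:S - Sm|lebesgue_Rd d. 2 * (t * R))"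
    proof (rule set_integral_mono)
      have "set_integrable (lebesgue_Rd d) (S - Sm) \<beta>" by (rule I\<beta>) (use SB in auto)
      moreover have "set_integrable (lebesgue_Rd d) (S - Sm) (\<lambda>v. c)" for c :: real by (rule Ia(6)) (use SB in auto)
      ultimately show "set_integrable (lebesgue_Rd d) (S - Sm) k" "set_integrable (lebesgue_Rd d) (S - Sm) (\<lambda>v. 2 * (t * R))"
        unfolding k_def by auto
      show "k v \<le> 2 * (t * R)" if "v \<in> S - Sm" for v
      proof -
        have "v \<in> B (r + t)" using SB that by blast
        from \<beta>b[OF this] show "k v \<le> 2 * (t * R)" unfolding k_def by linarith
      qed
    qed
    also have "\<dots> = 2 * (t * R) * measure (lebesgue_Rd d) (S - Sm)" by (rule const) (use SB in auto)
    also have "\<dots> \<le> 2 * (t * R) * (real d * t / r * m)"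
    proof (rule mult_left_mono)
      have "measure (lebesgue_Rd d) (S - Sm) \<le> measure (lebesgue_Rd d) (S - B (r - t))"
      proof (rule measure_mono_fmeasurable)
        show "S - Sm \<subseteq> S - B (r - t)"
          using B_shift[OF _ w, of _ "r - t" t] t by (auto simp: Sm_def Sr)
        show "S - B (r - t) \<in> fmeasurable (lebesgue_Rd d)"
          using emeasure_finite[of "S - B (r - t)" "r + t"] SB rt by (intro fmeasurableI) auto
      qed auto
      also have "\<dots> \<le> real d * t / r * m"
        unfolding m_def
      proof (rule star_shell_measure)
        show "c *\<^sub>R v \<in> S" if v: "v \<in> S" "0 < c" "c \<le> 1" for v c
        proof -
          have "c *\<^sub>R v \<in> B (c * r)" using v by (intro B_scale) (auto simp: Sr)
          then show ?thesis using B_mono[of "c * r" r] v r by (auto simp: Sr mult_le_cancel_right1)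
        qed
      qed (use r t in \<open>auto simp: Sr\<close>)
      finally show "measure (lebesgue_Rd d) (S - Sm) \<le> real d * t / r * m" .
    qed (use R0 in simp)
    finally show ?thesis by simp
  qed
  have 4: "(LINT v:S|lebesgue_Rd d. \<beta> v) = (LINT v:S|lebesgue_Rd d. b v) - (LINT v:Sp|lebesgue_Rd d. b v)"
  proof -
    have "(LINT v:S|lebesgue_Rd d. \<beta> v) = (LINT v:S|lebesgue_Rd d. b v) - (LINT v:S|lebesgue_Rd d. b (v + t *\<^sub>R w))"
      unfolding \<beta>_def using Ia[OF S_borel SB] by simp
    also have "(LINT v:S|lebesgue_Rd d. b (v + t *\<^sub>R w)) = (LINT v:Sp|lebesgue_Rd d. b v)"
      unfolding Sp_def by (rule set_integral_translate[OF ab(2) S_borel twR(1)])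
    finally show ?thesis .
  qed
  have 5: "(LINT v:Sm|lebesgue_Rd d. \<beta> v) = (LINT v:Sm|lebesgue_Rd d. b v) - (LINT v:S|lebesgue_Rd d. b v)"
  proof -
    have "(LINT v:Sm|lebesgue_Rd d. \<beta> v) = (LINT v:Sm|lebesgue_Rd d. b v) - (LINT v:Sm|lebesgue_Rd d. b (v + t *\<^sub>R w))"
      unfolding \<beta>_def using Ia[of Sm] SmB by simp
    also have "(LINT v:Sm|lebesgue_Rd d. b (v + t *\<^sub>R w)) = (LINT v:{v. v - t *\<^sub>R w \<in> Sm}|lebesgue_Rd d. b v)"
      by (rule set_integral_translate[OF ab(2) _ twR(1)]) simp
    also have "{v. v - t *\<^sub>R w \<in> Sm} = S" by (auto simp: Sm_def)
    finally show ?thesis .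
  qed
  define g where "g = (\<lambda>v. a v - b v)"
  have gT: "(LINT v:T|lebesgue_Rd d. g v) = (LINT v:T|lebesgue_Rd d. a v) - (LINT v:T|lebesgue_Rd d. b v)" if "T \<in> sets borel" "T \<subseteq> B (r + t)" for T
    unfolding g_def using Ia[OF that] by simp
  have 6: "(LINT v:S|lebesgue_Rd d. g v) - (LINT v:Sp|lebesgue_Rd d. g v) \<le> (LINT v:S - Sp|lebesgue_Rd d. g v)"
  proof (rule set_integral_diff_le[where r="r + t" and M=Ma])
    show "0 \<le> g v" "g v \<le> Ma" for v using a0[of v] Ma[of v] unfolding g_def by linarith+
  qed (use SB SpB rt in \<open>auto simp: g_def\<close>)
  have "t * ip d w (s' - s) * m = t * ip d w s' * m + - t * ip d w s * m" by (simp add: ip_diff algebra_simps)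
  also have "\<dots> \<le> (LINT v:S|lebesgue_Rd d. g v) - (LINT v:Sp|lebesgue_Rd d. g v) + ((LINT v:S|lebesgue_Rd d. \<beta> v) - (LINT v:Sm|lebesgue_Rd d. \<beta> v)) + 2 * \<delta> ^ 3 * m"
    unfolding 4 5 gT[OF S_borel SB] using 1 2 gT[of Sp] SpB by simp
  also have "\<dots> \<le> (LINT v:S - Sp|lebesgue_Rd d. g v) + 2 * t * R * (real d * t / r * m) + 2 * \<delta> ^ 3 * m"
    using 6 3 by simp
  finally show ?thesis
    unfolding t_def[symmetric] r_def[symmetric] R_def[symmetric] m_def[symmetric] a_def[symmetric] b_def[symmetric] Sp_def[symmetric] g_def[symmetric]
    by (simp add: algebra_simps g_def[symmetric])
qed

end

section \<open>Approximate and limiting Steiner points\<close>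

text \<open>Chosen once and for all: with it the limit position is a function of the history
  only.\<close>

definition ultra :: "nat filter"
  where "ultra = (SOME F. F \<noteq> bot \<and> F \<le> sequentially \<and> (\<forall>P. eventually P F \<or> eventually (\<lambda>x. \<not> P x) F))"

lemma ultra: "ultra \<noteq> bot" "ultra \<le> sequentially" "eventually P ultra \<or> eventually (\<lambda>x. \<not> P x) ultra"
  using someI_ex[OF exists_ultrafilter, folded ultra_def] by blast+

lemma ultra_tendsto: "(X \<longlongrightarrow> l) sequentially \<Longrightarrow> (X \<longlongrightarrow> l) ultra"
  using tendsto_mono[OF ultra(2)] .

lemma bounded_tendsto_ultra:
  fixes X :: "nat \<Rightarrow> real"
  assumes "\<And>j. \<bar>X j\<bar> \<le> M"
  shows "\<exists>l. (X \<longlongrightarrow> l) ultra"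
  using ultrafilter_bounded_real_convergent[OF ultra(1) ultra(3), of X M] assms by simp

lemma tendsto_pointI:
  fixes X :: "'a \<Rightarrow> point"
  assumes "\<And>i. ((\<lambda>j. X j i) \<longlongrightarrow> x i) F"
  shows "(X \<longlongrightarrow> x) F"
proof -
  have "limitin (product_topology (\<lambda>i. euclidean) UNIV) X x F"
    unfolding limitin_componentwise using assms by simp
  then show ?thesis by (simp add: euclidean_product_topology)
qed

section \<open>Requests, work functions and the growth of their conjugates\<close>

type_synonym req = "point set \<times> (point \<Rightarrow> real)"

context normed_Rd
begin

text \<open>Functions f are the requests (Rd, f) and bodies K the requests (K, 0), so that both problems have the
  same work_state functions; the closed epigraph lets service costs pass to the limit.\<close>

definition request :: "req \<Rightarrow> bool"
  where "request q \<longleftrightarrow> fst q \<subseteq> Rd d \<and> fst q \<noteq> {} \<and> convex_on (fst q) (snd q) \<and> (\<forall>y\<in>fst q. 0 \<le> snd q y) \<and>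
    closed {(x, c). x \<in> fst q \<and> snd q x \<le> c}"

definition valid :: "req list \<Rightarrow> bool"
  where "valid \<rho> \<longleftrightarrow> (\<forall>q\<in>set \<rho>. request q)"

lemma valid_simps [simp]: "valid []" "valid (\<rho> @ [q]) \<longleftrightarrow> valid \<rho> \<and> request q"
  by (auto simp: valid_def)

text \<open>Dynamic programming: the infimal convolution of the old work function with the norm,
  plus the new cost. Its values count only on the first component.\<close>

definition step :: "req \<Rightarrow> req \<Rightarrow> req"
  where "step st q = (fst q, \<lambda>y. snd q y + (INF z\<in>fst st. snd st z + nrm (y - z)))"

definition work_state :: "req list \<Rightarrow> req"
  where "work_state \<rho> = foldl step ({0}, \<lambda>_. 0) \<rho>"

definition H :: "req list \<Rightarrow> point \<Rightarrow> real"
  where "H \<rho> = conjugate (fst (work_state \<rho>)) (snd (work_state \<rho>))"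

lemma work_Nil: "work_state [] = ({0}, \<lambda>_. 0)"
  by (simp add: work_state_def)

lemma work_snoc: "work_state (\<rho> @ [q]) = step (work_state \<rho>) q"
  by (simp add: work_state_def)

lemma fst_work_snoc: "fst (work_state (\<rho> @ [q])) = fst q"
  by (simp add: work_snoc step_def)

lemma step_INF:
  assumes "state A F" "y \<in> Rd d"
  shows "\<And>z. z \<in> A \<Longrightarrow> (INF z\<in>A. F z + nrm (y - z)) \<le> F z + nrm (y - z)"
    and "\<And>c. (\<And>z. z \<in> A \<Longrightarrow> c \<le> F z + nrm (y - z)) \<Longrightarrow> c \<le> (INF z\<in>A. F z + nrm (y - z))"
proof -
  have "0 \<le> F z + nrm (y - z)" if "z \<in> A" for z
    using stateD[OF assms(1) that] nrm_nonneg[of z] nrm_nonneg[of "y - z"] assms(2) by simp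
  then show "\<And>z. z \<in> A \<Longrightarrow> (INF z\<in>A. F z + nrm (y - z)) \<le> F z + nrm (y - z)"
    by (intro cINF_lower bdd_belowI[of _ 0]) auto
  show "\<And>c. (\<And>z. z \<in> A \<Longrightarrow> c \<le> F z + nrm (y - z)) \<Longrightarrow> c \<le> (INF z\<in>A. F z + nrm (y - z))"
    using assms(1) by (intro cINF_greatest) (auto simp: state_def)
qed

lemma requestD: "request q \<Longrightarrow> y \<in> fst q \<Longrightarrow> y \<in> Rd d" "request q \<Longrightarrow> y \<in> fst q \<Longrightarrow> 0 \<le> snd q y"
  by (auto simp: request_def)

lemma state_work: "valid \<rho> \<Longrightarrow> state (fst (work_state \<rho>)) (snd (work_state \<rho>))"
proof (induction \<rho> rule: rev_induct)
  case Nil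
  then show ?case by (simp add: work_Nil state_def)
next
  case (snoc q \<rho>)
  then have st: "state (fst (work_state \<rho>)) (snd (work_state \<rho>))" and q: "request q" by auto
  have "nrm y \<le> snd (work_state (\<rho> @ [q])) y" if y: "y \<in> fst q" for y
  proof -
    have yR: "y \<in> Rd d" using requestD[OF q y] by simp
    have "nrm y \<le> (INF z\<in>fst (work_state \<rho>). snd (work_state \<rho>) z + nrm (y - z))"
    proof (rule step_INF(2)[OF st yR])
      fix z assume z: "z \<in> fst (work_state \<rho>)"
      then show "nrm y \<le> snd (work_state \<rho>) z + nrm (y - z)"
        using stateD[OF st z] nrm_triangle[of "y - z" z] yR by simp
    qed
    then show ?thesis using requestD(2)[OF q y] by (simp add: work_snoc step_def)
  qed
  then show ?case using q unfolding state_def by (auto simp: fst_work_snoc request_def)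
qed

text \<open>For v in the dual ball the move from z to y costs at least
  \<open>ip d v (y - z)\<close>, which is exactly what the linear terms at z and y differ by. Both
  monotonicity of H and the service cost bound rest on this inequality.\<close>

lemma H_step_ge:
  assumes st: "state (fst (work_state \<rho>)) (snd (work_state \<rho>))" and q: "request q" and v: "v \<in> B 1" and y: "y \<in> fst q"
  shows "snd q y + H \<rho> v \<le> snd (work_state (\<rho> @ [q])) y - ip d v y"
proof -
  have yR: "y \<in> Rd d" using requestD[OF q y] by simp
  have "H \<rho> v + ip d v y \<le> (INF z\<in>fst (work_state \<rho>). snd (work_state \<rho>) z + nrm (y - z))"
  proof (rule step_INF(2)[OF st yR])
    fix z assume z: "z \<in> fst (work_state \<rho>)"
    have "H \<rho> v \<le> snd (work_state \<rho>) z - ip d v z" unfolding H_def by (rule conj_le[OF st v z])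
    moreover have "ip d v (y - z) \<le> 1 * nrm (y - z)" using BD(2)[OF v] stateD(1)[OF st z] yR by blast
    ultimately show "H \<rho> v + ip d v y \<le> snd (work_state \<rho>) z + nrm (y - z)" by (simp add: ip_diff)
  qed
  then show ?thesis by (simp add: work_snoc step_def)
qed

lemma H_mono_step:
  assumes \<rho>: "valid (\<rho> @ [q])"
  shows "H \<rho> v \<le> H (\<rho> @ [q]) v"
proof (cases "v \<in> B 1")
  case True
  have st: "state (fst (work_state \<rho>)) (snd (work_state \<rho>))" and st': "state (fst (work_state (\<rho> @ [q]))) (snd (work_state (\<rho> @ [q])))" and q: "request q"
    using \<rho> state_work[OF \<rho>] state_work[of \<rho>] by simp_all
  show ?thesis
    unfolding H_def[of "\<rho> @ [q]"]
  proof (rule conj_geI[OF st' True])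
    fix y assume "y \<in> fst (work_state (\<rho> @ [q]))"
    then have y: "y \<in> fst q" by (simp add: fst_work_snoc)
    then show "H \<rho> v \<le> snd (work_state (\<rho> @ [q])) y - ip d v y"
      using H_step_ge[OF st q True y] requestD(2)[OF q y] by linarith
  qed
qed (simp add: H_def conjugate_def)

lemma H_Nil: "H [] v = 0"
  by (simp add: H_def conjugate_def work_Nil)

lemma work_step_le:
  assumes st: "state (fst (work_state \<rho>)) (snd (work_state \<rho>))" and z: "z \<in> fst (work_state \<rho>)" and y: "y \<in> Rd d"
  shows "snd (work_state (\<rho> @ [q])) y \<le> snd q y + snd (work_state \<rho>) z + nrm (y - z)"
  using step_INF(1)[OF st y z] by (simp add: work_snoc step_def)

text \<open>Both infima are tested at the same point z, where the linear terms cancel.\<close>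

lemma H_symmetric_le:
  assumes st: "state (fst (work_state \<rho>)) (snd (work_state \<rho>))" and z: "z \<in> fst (work_state \<rho>)"
  shows "H \<rho> v + H \<rho> (- v) \<le> 2 * snd (work_state \<rho>) z"
proof (cases "v \<in> B 1")
  case True
  then have mv: "- v \<in> B 1" by (simp add: B_minus_iff)
  from conj_le[OF st True z] conj_le[OF st mv z] show ?thesis unfolding H_def ip_minus by linarith
next
  case False
  then have "- v \<notin> B 1" by (simp add: B_minus_iff)
  then show ?thesis using False nrm_nonneg[OF stateD(1)[OF st z]] stateD(2)[OF st z] by (simp add: H_def conjugate_def)
qed

section \<open>Approximate Steiner points\<close>

text \<open>The shift 8 ensures that the radius 1 - 2 * \<open>delta j\<close> is at least 3 / 4 and
  that the squared step is far below the margin for every j.\<close>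

definition delta :: "nat \<Rightarrow> real"
  where "delta j = 1 / (real j + 8)"

lemma delta: "0 < delta j" "8 * delta j \<le> 1" "0 < 1 - 2 * delta j"
  by (auto simp: delta_def field_simps)

lemma dl_tendsto: "(delta \<longlongrightarrow> 0) ultra"
proof (rule ultra_tendsto)
  have "(\<lambda>j. 1 / (real (j + 8))) \<longlonglongrightarrow> 0" by (intro LIMSEQ_ignore_initial_segment lim_const_over_n[where a=1])
  then show "delta \<longlonglongrightarrow> 0" by (simp add: delta_def[abs_def])
qed

definition S :: "nat \<Rightarrow> point set"
  where "S j = B (1 - 2 * delta j)"

definition m :: "nat \<Rightarrow> real"
  where "m j = measure (lebesgue_Rd d) (S j)"

lemma m_pos: "0 < m j"
  unfolding m_def S_def by (rule measure_B_pos[OF delta(3)])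

text \<open>The service cost granted for the last request: the average increase of H since the
  previous history, plus the slack of near-minimality.\<close>

definition \<beta> :: "nat \<Rightarrow> req list \<Rightarrow> real"
  where "\<beta> j \<rho> = (LINT v:S j|lebesgue_Rd d. H \<rho> v - H (butlast \<rho>) v + delta j ^ 3) / m j"

definition good :: "nat \<Rightarrow> req list \<Rightarrow> point \<Rightarrow> bool"
  where "good j \<rho> s \<longleftrightarrow> near_steiner (delta j) (fst (work_state \<rho>)) (snd (work_state \<rho>)) s \<and>
    (if \<rho> = [] then s = 0 else s \<in> fst (last \<rho>) \<and> snd (last \<rho>) s \<le> \<beta> j \<rho>)"

lemma S_borel [measurable]: "S j \<in> sets borel"
  by (simp add: S_def)

lemma S_sub: "S j \<subseteq> B 1"
  unfolding S_def using delta(1)[of j] by (intro B_mono) simp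

lemma integrable_S:
  assumes "h \<in> borel_measurable borel" "\<And>v. \<bar>h v\<bar> \<le> (M::real)" "T \<in> sets borel" "T \<subseteq> B 1"
  shows "set_integrable (lebesgue_Rd d) T h"
  using assms by (intro set_integrable_bounded[where r=1 and M=M]) auto

lemma integral_const_S: "T \<in> sets borel \<Longrightarrow> T \<subseteq> B 1 \<Longrightarrow> (LINT v:T|lebesgue_Rd d. (c::real)) = c * measure (lebesgue_Rd d) T"
  by (rule set_integral_const[where r=1]) auto

lemma H_facts:
  assumes "valid \<rho>"
  shows "H \<rho> \<in> borel_measurable borel" "0 \<le> H \<rho> v" "\<exists>M\<ge>0. \<forall>v. H \<rho> v \<le> M"
  using conj_measurable conj_nonneg conj_bounded state_work[OF assms] unfolding H_def by blast+

lemma exists_good: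
  assumes \<rho>: "valid \<rho>"
  shows "\<exists>s. good j \<rho> s"
proof (cases \<rho> rule: rev_cases)
  case Nil
  have "(LINT v:S j|lebesgue_Rd d. 0 - 0 + delta j ^ 3) = delta j ^ 3 * m j"
    using integral_const_S[OF S_borel S_sub, of j "delta j ^ 3"] by (simp add: m_def)
  moreover have "0 \<le> delta j ^ 3 * m j" using delta(1)[of j] m_pos[of j] by simp
  ultimately have "good j [] 0"
    using H_Nil by (simp add: good_def near_steiner_def H_def[symmetric] S_def)
  then show ?thesis using Nil by blast
next
  case (snoc \<sigma> q)
  have st: "state (fst (work_state \<sigma>)) (snd (work_state \<sigma>))" and st': "state (fst q) (snd (work_state \<rho>))" and q: "request q"
    using \<rho> snoc state_work[of \<rho>] state_work[of \<sigma>] fst_work_snoc[of \<sigma> q] by simp_all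
  obtain M where M: "0 \<le> M" "\<And>v. H \<sigma> v \<le> M" using H_facts(3)[of \<sigma>] \<rho> snoc by auto
  have v\<sigma>: "valid \<sigma>" using \<rho> snoc by simp
  have cv: "convex_on (fst q) (snd q)" using q by (simp add: request_def)
  have "(delta j)\<^sup>2 \<le> delta j"
    using delta[of j] by (simp add: power2_eq_square mult_le_cancel_left1)
  \<comment> \<open>The averaging lemma with h the new request, G the previous conjugate, step
    \<delta>^2 and slack \<delta>^3; \<open>H_step_ge\<close> is its coupling hypothesis.\<close>
  then have "\<exists>s\<in>fst q. snd q s * measure (lebesgue_Rd d) (S j) \<le> (LINT v:S j|lebesgue_Rd d. conjugate (fst q) (snd (work_state \<rho>)) v - H \<sigma> v + delta j ^ 3) \<and>
    (\<forall>w\<in>B 1. (delta j)\<^sup>2 * ip d w s * measure (lebesgue_Rd d) (S j) \<le>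
      (LINT v:S j|lebesgue_Rd d. conjugate (fst q) (snd (work_state \<rho>)) v - conjugate (fst q) (snd (work_state \<rho>)) (v + (delta j)\<^sup>2 *\<^sub>R w) + delta j ^ 3))"
    unfolding S_def
    using delta[of j] M H_step_ge[OF st q] snoc
    by (intro exists_averaged_point[OF st' cv H_facts(1)[OF v\<sigma>] H_facts(2)[OF v\<sigma>] M(2)]) auto
  then obtain s where s: "s \<in> fst q" "snd q s * m j \<le> (LINT v:S j|lebesgue_Rd d. H \<rho> v - H \<sigma> v + delta j ^ 3)"
    "\<And>w. w \<in> B 1 \<Longrightarrow> (delta j)\<^sup>2 * ip d w s * measure (lebesgue_Rd d) (S j) \<le> (LINT v:S j|lebesgue_Rd d. H \<rho> v - H \<rho> (v + (delta j)\<^sup>2 *\<^sub>R w) + delta j ^ 3)"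
    using snoc fst_work_snoc[of \<sigma> q] by (auto simp: H_def m_def)
  have "s \<in> Rd d" using requestD(1)[OF q s(1)] .
  then have "near_steiner (delta j) (fst (work_state \<rho>)) (snd (work_state \<rho>)) s"
    unfolding near_steiner_def using s(3) by (simp add: S_def H_def)
  moreover have "snd q s \<le> \<beta> j \<rho>"
    using s(2) m_pos[of j] snoc by (simp add: \<beta>_def pos_le_divide_eq)
  ultimately have "good j \<rho> s" using s(1) snoc by (simp add: good_def)
  then show ?thesis by blast
qed

definition pos :: "nat \<Rightarrow> req list \<Rightarrow> point"
  where "pos j \<rho> = (SOME s. good j \<rho> s)"

lemma good_pos: "valid \<rho> \<Longrightarrow> good j \<rho> (pos j \<rho>)"
  unfolding pos_def by (rule someI_ex[OF exists_good])

lemma pos_Nil: "pos j [] = 0"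
  using good_pos[of "[]" j] by (simp add: good_def)

lemma pos_Rd: "valid \<rho> \<Longrightarrow> pos j \<rho> \<in> Rd d"
  using good_pos[of \<rho> j] by (auto simp: good_def near_steiner_def)

section \<open>Flux regions and movement of the approximate points\<close>

text \<open>The part of the ball that a step against w leaves, hence a strip along the boundary on
  the side where w points inward. It lies opposite to w since minimizers are negated
  gradients.\<close>

definition D :: "nat \<Rightarrow> point \<Rightarrow> point set"
  where "D j w = S j - {v. v - (delta j)\<^sup>2 *\<^sub>R w \<in> S j}"

definition shell :: "nat \<Rightarrow> real \<Rightarrow> point set"
  where "shell j \<theta> = S j - B (1 - 2 * delta j - \<theta>)"

lemma sets_D_shell [measurable]: "D j w \<in> sets borel" "shell j \<theta> \<in> sets borel"
  using measurable_sets[OF affine_measurable[of "- (delta j)\<^sup>2 *\<^sub>R w" 1] S_borel[of j]]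
  by (auto simp: D_def shell_def vimage_def add.commute)

lemma D_shell_sub: "D j w \<subseteq> S j" "shell j \<theta> \<subseteq> S j" "D j w \<subseteq> B 1" "shell j \<theta> \<subseteq> B 1"
  using S_sub[of j] by (auto simp: D_def shell_def)

lemma D_sub_shell: assumes "w \<in> B 1" shows "D j w \<subseteq> shell j ((delta j)\<^sup>2)"
proof
  fix v assume v: "v \<in> D j w"
  have "v \<notin> B (1 - 2 * delta j - (delta j)\<^sup>2)"
  proof
    have mw: "- w \<in> B 1" using assms by (simp add: B_minus_iff)
    assume "v \<in> B (1 - 2 * delta j - (delta j)\<^sup>2)"
    from B_shift[OF this mw, of "(delta j)\<^sup>2"] have "v - (delta j)\<^sup>2 *\<^sub>R w \<in> S j" by (simp add: S_def)
    then show False using v by (simp add: D_def)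
  qed
  then show "v \<in> shell j ((delta j)\<^sup>2)" using v by (simp add: D_def shell_def)
qed

lemma S_scale: "v \<in> S j \<Longrightarrow> 0 < c \<Longrightarrow> c \<le> 1 \<Longrightarrow> c *\<^sub>R v \<in> S j"
proof -
  assume v: "v \<in> S j" "0 < c" "c \<le> 1"
  then have "c *\<^sub>R v \<in> B (c * (1 - 2 * delta j))" by (intro B_scale) (auto simp: S_def)
  moreover have "c * (1 - 2 * delta j) \<le> 1 - 2 * delta j" using v delta(3)[of j] by (simp add: mult_le_cancel_right1)
  ultimately show ?thesis using B_mono unfolding S_def by blast
qed

lemma measure_shell: "0 \<le> \<theta> \<Longrightarrow> \<theta> < 1 - 2 * delta j \<Longrightarrow> measure (lebesgue_Rd d) (shell j \<theta>) \<le> real d * \<theta> / (1 - 2 * delta j) * m j"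
  unfolding shell_def m_def
  by (rule star_shell_measure) (use delta(3)[of j] S_scale in \<open>auto simp: S_def\<close>)

lemma dl_sq: "(delta j)\<^sup>2 < 1 - 2 * delta j" "0 \<le> (delta j)\<^sup>2" "(delta j)\<^sup>2 \<le> delta j / 8"
proof -
  have "delta j * delta j \<le> delta j * (1 / 8)" using delta[of j] by (intro mult_left_mono) auto
  then have "delta j * delta j \<le> delta j / 8" by simp
  then show "(delta j)\<^sup>2 \<le> delta j / 8" by (simp add: power2_eq_square)
  then show "(delta j)\<^sup>2 < 1 - 2 * delta j" using delta[of j] by linarith
  show "0 \<le> (delta j)\<^sup>2" by simp
qed

text \<open>The error of \<open>near_steiner_step\<close> relative to volume and step: with t =
  \<delta>^2 both of its terms are of order \<delta>.\<close>

definition err :: "nat \<Rightarrow> real \<Rightarrow> real"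
  where "err j M = 2 * M * real d * delta j / (1 - 2 * delta j) + 2 * delta j"

lemma err_tendsto: "((\<lambda>j. err j M) \<longlongrightarrow> 0) ultra"
proof -
  have "((\<lambda>j. err j M) \<longlongrightarrow> 2 * M * real d * 0 / (1 - 2 * 0) + 2 * 0) ultra"
    unfolding err_def by (intro tendsto_intros dl_tendsto) simp
  then show ?thesis by simp
qed

lemma pos_step:
  assumes \<rho>: "valid \<rho>" and \<sigma>: "valid \<sigma>"
    and le: "\<And>v. H \<rho> v \<le> H \<sigma> v" and M: "\<And>v. H \<rho> v \<le> M" and w: "w \<in> B 1"
  shows "ip d w (pos j \<sigma> - pos j \<rho>) \<le> (LINT v:D j w|lebesgue_Rd d. H \<sigma> v - H \<rho> v) / ((delta j)\<^sup>2 * m j) + err j M"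
proof -
  let ?\<delta> = "delta j"
  define x where "x = ip d w (pos j \<sigma> - pos j \<rho>)"
  have "?\<delta>\<^sup>2 * x * m j \<le> (LINT v:D j w|lebesgue_Rd d. H \<sigma> v - H \<rho> v)
    + (2 * ?\<delta>\<^sup>2 * (M / ?\<delta>) * (real d * ?\<delta>\<^sup>2 / (1 - 2 * ?\<delta>)) + 2 * ?\<delta> ^ 3) * m j"
    unfolding x_def m_def S_def D_def H_def
    by (rule near_steiner_step) (use good_pos[OF \<rho>, of j] good_pos[OF \<sigma>, of j] state_work[OF \<rho>] state_work[OF \<sigma>] le M w delta[of j] in
        \<open>auto simp: good_def H_def[symmetric]\<close>)
  also have "2 * ?\<delta>\<^sup>2 * (M / ?\<delta>) * (real d * ?\<delta>\<^sup>2 / (1 - 2 * ?\<delta>)) + 2 * ?\<delta> ^ 3 = ?\<delta>\<^sup>2 * err j M"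
    using delta(1)[of j] by (simp add: err_def field_simps power2_eq_square power3_eq_cube)
  finally have "x \<le> (LINT v:D j w|lebesgue_Rd d. H \<sigma> v - H \<rho> v) / ((delta j)\<^sup>2 * m j) + err j M"
    using delta(1)[of j] m_pos[of j] by (simp add: field_simps)
  then show ?thesis by (simp only: x_def)
qed

lemma integral_D_le_shell:
  assumes "g \<in> borel_measurable borel" "\<And>v. 0 \<le> g v" "\<And>v. g v \<le> (M::real)" "w \<in> B 1"
  shows "(LINT v:D j w|lebesgue_Rd d. g v) \<le> (LINT v:shell j ((delta j)\<^sup>2)|lebesgue_Rd d. g v)"
proof -
  have i: "set_integrable (lebesgue_Rd d) (D j w) g" "set_integrable (lebesgue_Rd d) (shell j ((delta j)\<^sup>2)) g"
    using assms D_shell_sub[of j] by (intro integrable_S[where M=M]; auto)+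
  show ?thesis
    unfolding set_lebesgue_integral_def
    using i D_sub_shell[OF assms(4), of j] assms(2) by (intro integral_mono) (auto simp: set_integrable_def indicator_def)
qed

text \<open>The whole history is treated as a single step from the empty one, whose point is 0. The
  flux is at most M times a shell of thickness \<delta>^2, so the bound does not depend on j and a
  limit exists.\<close>

lemma pos_bounded:
  assumes \<rho>: "valid \<rho>"
  shows "\<exists>R. \<forall>j i. \<bar>pos j \<rho> i\<bar> \<le> R"
proof -
  obtain c where c: "0 < c" "\<And>x. x \<in> Rd d \<Longrightarrow> c * l1 d x \<le> nrm x" using l1_le_nrm by blast
  obtain M where M: "0 \<le> M" "\<And>v. H \<rho> v \<le> M" using H_facts(3)[OF \<rho>] by blast
  define R where "R = 2 * M * real d + 2"
  have n: "nrm (pos j \<rho>) \<le> R" for j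
  proof (rule nrm_le_dualI)
    show pR: "pos j \<rho> \<in> Rd d" by (rule pos_Rd[OF \<rho>])
    fix w assume w: "w \<in> B 1"
    have r: "3 / 4 \<le> 1 - 2 * delta j" using delta[of j] by simp
    have "ip d w (pos j \<rho> - pos j []) \<le> (LINT v:D j w|lebesgue_Rd d. H \<rho> v - H [] v) / ((delta j)\<^sup>2 * m j) + err j 0"
      \<comment> \<open>The old conjugate is 0, so the error term is taken with bound 0.\<close>
      by (rule pos_step[OF _ \<rho> _ _ w]) (use H_facts(2)[OF \<rho>] in \<open>auto simp: H_Nil\<close>)
    also have "\<dots> = (LINT v:D j w|lebesgue_Rd d. H \<rho> v) / ((delta j)\<^sup>2 * m j) + 2 * delta j"
      by (simp add: H_Nil err_def)
    also have "\<dots> \<le> 2 * M * real d + 2"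
    proof (rule add_mono)
      have "(LINT v:D j w|lebesgue_Rd d. H \<rho> v) \<le> (LINT v:shell j ((delta j)\<^sup>2)|lebesgue_Rd d. H \<rho> v)"
        using integral_D_le_shell[OF H_facts(1,2)[OF \<rho>] M(2) w] by blast
      also have "\<dots> \<le> (LINT v:shell j ((delta j)\<^sup>2)|lebesgue_Rd d. M)"
        using H_facts(1,2)[OF \<rho>] M D_shell_sub[of j]
        by (intro set_integral_mono integrable_S[where M=M]) auto
      also have "\<dots> = M * measure (lebesgue_Rd d) (shell j ((delta j)\<^sup>2))" using D_shell_sub by (intro integral_const_S) auto
      also have "\<dots> \<le> M * (real d * (delta j)\<^sup>2 / (1 - 2 * delta j) * m j)"
        using M dl_sq[of j] by (intro mult_left_mono measure_shell) auto
      also have "\<dots> \<le> M * (real d * (delta j)\<^sup>2 * 2 * m j)"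
      proof -
        have "real d * (delta j)\<^sup>2 / (1 - 2 * delta j) \<le> real d * (delta j)\<^sup>2 / (1 / 2)"
          using r by (intro divide_left_mono) auto
        then show ?thesis using M m_pos[of j] by (intro mult_left_mono mult_right_mono) auto
      qed
      finally show "(LINT v:D j w|lebesgue_Rd d. H \<rho> v) / ((delta j)\<^sup>2 * m j) \<le> 2 * M * real d"
        using delta(1)[of j] m_pos[of j] by (simp add: field_simps)
      show "2 * delta j \<le> 2" using delta[of j] by simp
    qed
    finally show "ip d w (pos j \<rho>) \<le> R" by (simp add: pos_Nil R_def)
  qed
  have R0: "0 \<le> R" using M by (simp add: R_def)
  have "\<bar>pos j \<rho> i\<bar> \<le> R / c" for j i
  proof (cases "i < d")
    case True
    then have "\<bar>pos j \<rho> i\<bar> \<le> l1 d (pos j \<rho>)"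
      unfolding l1_def using member_le_sum[of i "{..<d}" "\<lambda>i. \<bar>pos j \<rho> i\<bar>"] by simp
    also have "\<dots> \<le> R / c" using c(2)[OF pos_Rd[OF \<rho>], of j] n[of j] c(1) by (simp add: field_simps)
    finally show ?thesis .
  next
    case False
    then show ?thesis using pos_Rd[OF \<rho>, of j] R0 c(1) by (simp add: Rd_iff)
  qed
  then show ?thesis by blast
qed

section \<open>The limiting player\<close>

definition steiner_alg :: "req list \<Rightarrow> point"
  where "steiner_alg \<rho> = (\<lambda>i. Lim ultra (\<lambda>j. pos j \<rho> i))"

lemma pos_tendsto_alg:
  assumes \<rho>: "valid \<rho>"
  shows "((\<lambda>j. pos j \<rho>) \<longlongrightarrow> steiner_alg \<rho>) ultra"
proof (rule tendsto_pointI)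
  fix i
  obtain R where R: "\<And>j i. \<bar>pos j \<rho> i\<bar> \<le> R" using pos_bounded[OF \<rho>] by blast
  obtain l where l: "((\<lambda>j. pos j \<rho> i) \<longlongrightarrow> l) ultra" using bounded_tendsto_ultra[of "\<lambda>j. pos j \<rho> i" R] R by blast
  then have "Lim ultra (\<lambda>j. pos j \<rho> i) = l" using ultra(1) by (intro tendsto_Lim) auto
  then show "((\<lambda>j. pos j \<rho> i) \<longlongrightarrow> steiner_alg \<rho> i) ultra" using l by (simp add: steiner_alg_def)
qed

lemma alg_Rd: "valid \<rho> \<Longrightarrow> steiner_alg \<rho> \<in> Rd d"
  using Lim_in_closed_set[OF closed_Rd _ ultra(1) pos_tendsto_alg] pos_Rd by (metis (mono_tags, lifting) always_eventually)

lemma alg_Nil: "steiner_alg [] = 0"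
  using tendsto_unique[OF ultra(1) pos_tendsto_alg[of "[]"]] tendsto_const[of 0 ultra] by (simp add: pos_Nil)

lemma nrm_tendsto:
  assumes \<rho>: "valid \<rho>" and \<sigma>: "valid \<sigma>"
  shows "((\<lambda>j. nrm (pos j \<sigma> - pos j \<rho>)) \<longlongrightarrow> nrm (steiner_alg \<sigma> - steiner_alg \<rho>)) ultra"
proof -
  have c: "((\<lambda>j. pos j \<tau> i) \<longlongrightarrow> steiner_alg \<tau> i) ultra" if "valid \<tau>" for \<tau> i
    using continuous_on_tendsto_compose[OF continuous_on_coord[of UNIV i] pos_tendsto_alg[OF that]] by simp
  have "((\<lambda>j. pos j \<sigma> - pos j \<rho>) \<longlongrightarrow> steiner_alg \<sigma> - steiner_alg \<rho>) ultra"
    by (rule tendsto_pointI) (use c[OF \<rho>] c[OF \<sigma>] in \<open>auto intro!: tendsto_diff\<close>)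
  then show ?thesis
    using pos_Rd[OF \<rho>] pos_Rd[OF \<sigma>] alg_Rd[OF \<rho>] alg_Rd[OF \<sigma>]
    by (intro continuous_on_tendsto_compose[OF continuous_on_nrm]) auto
qed

end

section \<open>Competitive bounds for an arbitrary norm\<close>

lemma set_integral_mono_cover:
  fixes g :: "'a \<Rightarrow> real"
  assumes "finite I" and D: "set_integrable M D g" "set_integrable M T g" "\<And>k. k \<in> I \<Longrightarrow> set_integrable M (L k) g"
    and sub: "D \<subseteq> T \<union> (\<Union>k\<in>I. L k)" and g: "\<And>v. 0 \<le> g v"
  shows "(LINT v:D|M. g v) \<le> (LINT v:T|M. g v) + (\<Sum>k\<in>I. LINT v:L k|M. g v)"
proof -
  have "(LINT v:D|M. g v) \<le> (\<integral>v. indicator T v *\<^sub>R g v + (\<Sum>k\<in>I. indicator (L k) v *\<^sub>R g v) \<partial>M)"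
    unfolding set_lebesgue_integral_def
  proof (rule integral_mono)
    show "integrable M (\<lambda>v. indicator D v *\<^sub>R g v)" using D(1) by (simp add: set_integrable_def)
    show "integrable M (\<lambda>v. indicator T v *\<^sub>R g v + (\<Sum>k\<in>I. indicator (L k) v *\<^sub>R g v))"
      using D(2,3) by (intro Bochner_Integration.integrable_add Bochner_Integration.integrable_sum) (auto simp: set_integrable_def)
    fix v
    have pos: "0 \<le> indicator T v *\<^sub>R g v" "0 \<le> indicator (L k) v *\<^sub>R g v" for k using g[of v] by simp_all
    show "indicator D v *\<^sub>R g v \<le> indicator T v *\<^sub>R g v + (\<Sum>k\<in>I. indicator (L k) v *\<^sub>R g v)"
    proof (cases "v \<in> D")
      case True
      then consider "v \<in> T" | k where "k \<in> I" "v \<in> L k" using sub by blast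
      then show ?thesis
      proof cases
        case 1
        then show ?thesis using True pos(2) by (simp add: sum_nonneg)
      next
        case (2 k)
        then have "g v \<le> (\<Sum>k\<in>I. indicator (L k) v *\<^sub>R g v)"
          using member_le_sum[OF 2(1), of "\<lambda>k. indicator (L k) v *\<^sub>R g v"] pos(2) \<open>finite I\<close> by simp
        then show ?thesis using True pos(1) by simp
      qed
    next
      case False
      then show ?thesis using pos by (simp add: sum_nonneg add_nonneg_nonneg)
    qed
  qed
  also have "\<dots> = (LINT v:T|M. g v) + (\<Sum>k\<in>I. LINT v:L k|M. g v)"
    unfolding set_lebesgue_integral_def using D(2,3)
    by (subst Bochner_Integration.integral_add) (auto simp: set_integrable_def intro!: Bochner_Integration.integrable_sum)
  finally show ?thesis .
qed

lemma sum_telescope_from_1: "(\<Sum>n=1..N. f n - f (n - 1)) = f N - (f 0 :: real)" for N :: nat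
  by (induction N) (auto simp: sum.atLeast1_atMost_eq)

context normed_Rd
begin

definition pre :: "(nat \<Rightarrow> req) \<Rightarrow> nat \<Rightarrow> req list"
  where "pre r n = map r [1..<Suc n]"

lemma pre_0 [simp]: "pre r 0 = []" and pre_Suc: "pre r (Suc n) = pre r n @ [r (Suc n)]"
  by (simp_all add: pre_def)

definition traj_cost :: "(nat \<Rightarrow> req) \<Rightarrow> (nat \<Rightarrow> point) \<Rightarrow> nat \<Rightarrow> real"
  where "traj_cost r x N = (\<Sum>n=1..N. snd (r n) (x n) + nrm (x n - x (n - 1)))"

end

text \<open>x is an arbitrary offline trajectory. Every bound is proved against its cost, and the
  infimum is taken only at the very end, so no optimal trajectory has to be constructed.\<close>

locale chase = normed_Rd +
  fixes r :: "nat \<Rightarrow> req" and N :: nat and x :: "nat \<Rightarrow> point"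
  assumes req: "n \<in> {1..N} \<Longrightarrow> request (r n)"
    and x0: "x 0 = 0" and feasible: "n \<in> {1..N} \<Longrightarrow> x n \<in> fst (r n)"
begin

definition c :: real
  where "c = traj_cost r x N"

definition Hn :: "nat \<Rightarrow> point \<Rightarrow> real"
  where "Hn n = H (pre r n)"

definition g :: "nat \<Rightarrow> point \<Rightarrow> real"
  where "g n v = Hn n v - Hn (n - 1) v"

lemma valid_pre: "n \<le> N \<Longrightarrow> valid (pre r n)"
  by (induction n) (auto simp: pre_Suc req)

text \<open>Each move of the trajectory is one of the competitors in the recursion for the work
  function.\<close>

lemma work_le_cost: "n \<le> N \<Longrightarrow> x n \<in> fst (work_state (pre r n)) \<and> snd (work_state (pre r n)) (x n) \<le> traj_cost r x n"
proof (induction n)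
  case 0
  have "x 0 \<in> fst (work_state (pre r 0))" unfolding pre_0 work_Nil fst_conv x0 by (rule singletonI)
  moreover have "snd (work_state (pre r 0)) (x 0) \<le> traj_cost r x 0" unfolding pre_0 work_Nil snd_conv traj_cost_def by simp
  ultimately show ?case by blast
next
  case (Suc n)
  then have IH: "x n \<in> fst (work_state (pre r n))" "snd (work_state (pre r n)) (x n) \<le> traj_cost r x n" by auto
  have xS: "x (Suc n) \<in> fst (r (Suc n))" using feasible Suc.prems by simp
  have "x (Suc n) \<in> Rd d" using requestD(1)[OF req xS] Suc.prems by simp
  from work_step_le[OF state_work[OF valid_pre] IH(1) this, of "r (Suc n)"] Suc.prems IH(2)
  have "snd (work_state (pre r (Suc n))) (x (Suc n)) \<le> traj_cost r x (Suc n)" by (simp add: pre_Suc traj_cost_def)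
  then show ?case using xS by (simp add: pre_Suc fst_work_snoc)
qed

lemma x_Rd: "n \<le> N \<Longrightarrow> x n \<in> Rd d"
  using work_le_cost[of n] stateD(1)[OF state_work[OF valid_pre]] by blast

lemma c_nonneg: "0 \<le> c"
  using work_le_cost[of N] stateD[OF state_work[OF valid_pre], of N "x N"] nrm_nonneg[OF x_Rd, of N] by (simp add: c_def)

lemma Hn_0: "Hn 0 v = 0"
  by (simp add: Hn_def H_Nil)

lemma Hn_Suc: "Suc n \<le> N \<Longrightarrow> Hn n v \<le> Hn (Suc n) v"
  using valid_pre[of "Suc n"] H_mono_step[of "pre r n" "r (Suc n)" v] by (simp add: Hn_def pre_Suc)

lemma Hn_mono: "k \<le> n \<Longrightarrow> n \<le> N \<Longrightarrow> Hn k v \<le> Hn n v"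
proof (induction n rule: dec_induct)
  case (step n)
  then show ?case using Hn_Suc[of n v] by simp
qed simp

lemma Hn_sym: "Hn N v + Hn N (- v) \<le> 2 * c"
  using H_symmetric_le[OF state_work[OF valid_pre], of N "x N" v] work_le_cost[of N] by (simp add: Hn_def c_def)

lemma Hn_facts: "n \<le> N \<Longrightarrow> Hn n \<in> borel_measurable borel" "n \<le> N \<Longrightarrow> 0 \<le> Hn n v"
  using H_facts(1,2)[OF valid_pre, of n] by (simp_all add: Hn_def)

lemma Hn_le: "n \<le> N \<Longrightarrow> Hn n v \<le> 2 * c"
  using Hn_mono[of n N v] Hn_sym[of v] Hn_facts(2)[of N "- v"] by simp

lemma integrable_Hn: "n \<le> N \<Longrightarrow> T \<in> sets borel \<Longrightarrow> T \<subseteq> B 1 \<Longrightarrow> set_integrable (lebesgue_Rd d) T (Hn n)"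
  using Hn_facts[of n] Hn_le[of n] by (intro integrable_S[where M="2 * c"]) auto

lemma g_facts:
  assumes "n \<in> {1..N}"
  shows "g n \<in> borel_measurable borel" "0 \<le> g n v" "g n v \<le> 2 * c"
    "T \<in> sets borel \<Longrightarrow> T \<subseteq> B 1 \<Longrightarrow> set_integrable (lebesgue_Rd d) T (g n)"
    "T \<in> sets borel \<Longrightarrow> T \<subseteq> B 1 \<Longrightarrow> (LINT v:T|lebesgue_Rd d. g n v) = (LINT v:T|lebesgue_Rd d. Hn n v) - (LINT v:T|lebesgue_Rd d. Hn (n - 1) v)"
proof -
  have n: "n \<le> N" "n - 1 \<le> N" using assms by auto
  note [measurable] = Hn_facts(1)[OF n(1)] Hn_facts(1)[OF n(2)]
  show gm: "g n \<in> borel_measurable borel" unfolding g_def by measurable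
  show g0: "0 \<le> g n v" for v using Hn_mono[of "n - 1" n v] n by (simp add: g_def)
  show gc: "g n v \<le> 2 * c" for v using Hn_le[OF n(1), of v] Hn_facts(2)[OF n(2), of v] by (simp add: g_def)
  assume T: "T \<in> sets borel" "T \<subseteq> B 1"
  show "set_integrable (lebesgue_Rd d) T (g n)"
    using gm g0 gc T by (intro integrable_S[where M="2 * c"]) auto
  show "(LINT v:T|lebesgue_Rd d. g n v) = (LINT v:T|lebesgue_Rd d. Hn n v) - (LINT v:T|lebesgue_Rd d. Hn (n - 1) v)"
    unfolding g_def using integrable_Hn[OF n(1) T] integrable_Hn[OF n(2) T] by simp
qed

text \<open>Averaging over a symmetric set turns the bound on opposite directions into a bound on the average.\<close>

lemma sum_integral_g_le:
  assumes T: "T \<in> sets borel" "T \<subseteq> B 1" "\<And>v. - v \<in> T \<longleftrightarrow> v \<in> T"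
  shows "(\<Sum>n=1..N. LINT v:T|lebesgue_Rd d. g n v) \<le> c * measure (lebesgue_Rd d) T"
proof -
  have "(\<Sum>n=1..N. LINT v:T|lebesgue_Rd d. g n v) = (\<Sum>n=1..N. (LINT v:T|lebesgue_Rd d. Hn n v) - (LINT v:T|lebesgue_Rd d. Hn (n - 1) v))"
    using g_facts(5)[OF _ T(1,2)] by (intro sum.cong) auto
  also have "\<dots> = (LINT v:T|lebesgue_Rd d. Hn N v)"
    using sum_telescope_from_1[of "\<lambda>n. LINT v:T|lebesgue_Rd d. Hn n v" N] by (simp add: Hn_0)
  finally have sum: "(\<Sum>n=1..N. LINT v:T|lebesgue_Rd d. g n v) = (LINT v:T|lebesgue_Rd d. Hn N v)" .
  have "2 * (LINT v:T|lebesgue_Rd d. Hn N v) = (LINT v:T|lebesgue_Rd d. Hn N v) + (LINT v:T|lebesgue_Rd d. Hn N (- v))"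
    using set_integral_reflect[OF Hn_facts(1) T(1,3), of N] by simp
  also have "\<dots> = (LINT v:T|lebesgue_Rd d. Hn N v + Hn N (- v))"
  proof -
    have "(\<lambda>v. Hn N (0 + (-1) *\<^sub>R v)) \<in> borel_measurable borel"
      using measurable_compose[OF affine_measurable[of 0 "-1"] Hn_facts(1)[of N]] by simp
    then have "set_integrable (lebesgue_Rd d) T (\<lambda>v. Hn N (- v))"
      using Hn_facts(2)[of N] Hn_le[of N] T by (intro integrable_S[where M="2 * c"]) auto
    then show ?thesis using integrable_Hn[of N T] T by simp
  qed
  also have "\<dots> \<le> (LINT v:T|lebesgue_Rd d. 2 * c)"
  proof (rule set_integral_mono)
    have "(\<lambda>v. Hn N (0 + (-1) *\<^sub>R v)) \<in> borel_measurable borel"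
      using measurable_compose[OF affine_measurable[of 0 "-1"] Hn_facts(1)[of N]] by simp
    then have "set_integrable (lebesgue_Rd d) T (\<lambda>v. Hn N (- v))"
      using Hn_facts(2)[of N] Hn_le[of N] T by (intro integrable_S[where M="2 * c"]) auto
    then show "set_integrable (lebesgue_Rd d) T (\<lambda>v. Hn N v + Hn N (- v))" using integrable_Hn[of N T] T by simp
    show "set_integrable (lebesgue_Rd d) T (\<lambda>v. 2 * c)" using T c_nonneg by (intro integrable_S[where M="2 * c"]) auto
  qed (use Hn_sym in auto)
  also have "\<dots> = 2 * (c * measure (lebesgue_Rd d) T)" using integral_const_S[OF T(1,2)] by simp
  finally show ?thesis unfolding sum by simp
qed

lemma symmetric_S_shell: "- v \<in> S j \<longleftrightarrow> v \<in> S j" "- v \<in> shell j \<theta> \<longleftrightarrow> v \<in> shell j \<theta>"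
  by (auto simp: S_def shell_def B_minus_iff)

text \<open>For each j the granted costs telescope to at most c up to N * \<delta>^3. The pairs of
  position and granted cost stay in the epigraph of the request, which is closed, so the service
  cost of the limit point is at most the limit of the granted costs.\<close>

lemma service_bound: "(\<Sum>n=1..N. snd (r n) (steiner_alg (pre r n))) \<le> c"
proof -
  have pre_n: "valid (pre r n)" "pre r n = pre r (n - 1) @ [r n]" if "n \<in> {1..N}" for n
    using that valid_pre[of n] pre_Suc[of r "n - 1"] by auto
  have \<beta>_eq: "\<beta> j (pre r n) = (LINT v:S j|lebesgue_Rd d. g n v) / m j + delta j ^ 3" if n: "n \<in> {1..N}" for n j
  proof -
    have "set_integrable (lebesgue_Rd d) (S j) (\<lambda>v. delta j ^ 3)"
      using delta(1)[of j] S_sub by (intro integrable_S[where M="delta j ^ 3"]) auto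
    then have "(LINT v:S j|lebesgue_Rd d. g n v + delta j ^ 3) = (LINT v:S j|lebesgue_Rd d. g n v) + delta j ^ 3 * m j"
      using g_facts(4)[OF n S_borel S_sub, of j] integral_const_S[OF S_borel S_sub, of j "delta j ^ 3"] by (simp add: m_def)
    moreover have "\<beta> j (pre r n) = (LINT v:S j|lebesgue_Rd d. g n v + delta j ^ 3) / m j"
    proof -
      have "butlast (pre r n) = pre r (n - 1)" by (subst pre_n(2)[OF n]) simp
      then show ?thesis by (simp add: \<beta>_def g_def Hn_def)
    qed
    ultimately show ?thesis using m_pos[of j] by (simp add: add_divide_distrib)
  qed
  have dl3: "0 < delta j ^ 3" "delta j ^ 3 \<le> 1" for j using delta[of j] by (auto intro!: power_le_one)
  have sum_g: "(\<Sum>n=1..N. (LINT v:S j|lebesgue_Rd d. g n v) / m j) \<le> c" for j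
    using sum_integral_g_le[OF S_borel S_sub symmetric_S_shell(1), of j] m_pos[of j]
    by (simp add: sum_divide_distrib[symmetric] m_def pos_divide_le_eq)
  have g_pos: "0 \<le> (LINT v:S j|lebesgue_Rd d. g n v) / m j" if "n \<in> {1..N}" for n j
    using g_facts(2)[OF that] m_pos[of j] unfolding set_lebesgue_integral_def
    by (intro divide_nonneg_pos Bochner_Integration.integral_nonneg) auto
  \<comment> \<open>The averaged increments are nonnegative with sum at most c, so each single one
    is bounded and has a limit.\<close>
  have "\<exists>b. ((\<lambda>j. \<beta> j (pre r n)) \<longlongrightarrow> b) ultra" if n: "n \<in> {1..N}" for n
  proof (rule bounded_tendsto_ultra)
    fix j
    have "(LINT v:S j|lebesgue_Rd d. g n v) / m j \<le> (\<Sum>n=1..N. (LINT v:S j|lebesgue_Rd d. g n v) / m j)"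
      using member_le_sum[OF n, of "\<lambda>n. (LINT v:S j|lebesgue_Rd d. g n v) / m j"] g_pos by auto
    then show "\<bar>\<beta> j (pre r n)\<bar> \<le> c + 1"
      using \<beta>_eq[OF n, of j] g_pos[OF n, of j] dl3[of j] sum_g[of j] by linarith
  qed
  then obtain b where b: "\<And>n. n \<in> {1..N} \<Longrightarrow> ((\<lambda>j. \<beta> j (pre r n)) \<longlongrightarrow> b n) ultra" by metis
  have "snd (r n) (steiner_alg (pre r n)) \<le> b n" if n: "n \<in> {1..N}" for n
  proof -
    have "closed {(x, c). x \<in> fst (r n) \<and> snd (r n) x \<le> c}" using req[OF n] by (simp add: request_def)
    moreover have "((\<lambda>j. (pos j (pre r n), \<beta> j (pre r n))) \<longlongrightarrow> (steiner_alg (pre r n), b n)) ultra"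
      by (intro tendsto_Pair pos_tendsto_alg pre_n(1)[OF n] b[OF n])
    moreover have "(pos j (pre r n), \<beta> j (pre r n)) \<in> {(x, c). x \<in> fst (r n) \<and> snd (r n) x \<le> c}" for j
    proof -
      have "last (pre r n) = r n" "pre r n \<noteq> []" by (simp_all add: pre_n(2)[OF n])
      then show ?thesis using good_pos[OF pre_n(1)[OF n], of j] by (simp add: good_def)
    qed
    ultimately have "(steiner_alg (pre r n), b n) \<in> {(x, c). x \<in> fst (r n) \<and> snd (r n) x \<le> c}"
      using ultra(1) by (intro Lim_in_closed_set[of _ _ ultra]) auto
    then show ?thesis by simp
  qed
  then have "(\<Sum>n=1..N. snd (r n) (steiner_alg (pre r n))) \<le> (\<Sum>n=1..N. b n)" by (rule sum_mono)
  also have "\<dots> \<le> c"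
  proof (rule tendsto_le[OF ultra(1)])
    show "((\<lambda>j. \<Sum>n=1..N. \<beta> j (pre r n)) \<longlongrightarrow> (\<Sum>n=1..N. b n)) ultra" by (intro tendsto_sum b) 
    have "((\<lambda>j. c + real N * delta j ^ 3) \<longlongrightarrow> c + real N * 0 ^ 3) ultra" by (intro tendsto_intros dl_tendsto)
    then show "((\<lambda>j. c + real N * delta j ^ 3) \<longlongrightarrow> c) ultra" by simp
    have "(\<Sum>n=1..N. \<beta> j (pre r n)) \<le> c + real N * delta j ^ 3" for j
      using sum_g[of j] by (simp add: \<beta>_eq sum.distrib)
    then show "\<forall>\<^sub>F j in ultra. (\<Sum>n=1..N. \<beta> j (pre r n)) \<le> c + real N * delta j ^ 3" by simp
  qed
  finally show ?thesis .
qed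

text \<open>By duality it suffices to bound all directions w. The extremal w varies with the step,
  so I has to dominate every flux region before the sum over n is formed.\<close>

lemma step_le:
  assumes n: "n \<in> {1..N}" and LD: "\<And>w. w \<in> B 1 \<Longrightarrow> (LINT v:D j w|lebesgue_Rd d. g n v) \<le> I"
  shows "nrm (pos j (pre r n) - pos j (pre r (n - 1))) \<le> I / ((delta j)\<^sup>2 * m j) + err j (2 * c)"
proof (rule nrm_le_dualI)
  have n': "n \<le> N" "n - 1 \<le> N" using n by auto
  show "pos j (pre r n) - pos j (pre r (n - 1)) \<in> Rd d" using n' by (intro Rd_closed_ops pos_Rd valid_pre)
  fix w assume w: "w \<in> B 1"
  have "ip d w (pos j (pre r n) - pos j (pre r (n - 1))) \<le> (LINT v:D j w|lebesgue_Rd d. H (pre r n) v - H (pre r (n - 1)) v) / ((delta j)\<^sup>2 * m j) + err j (2 * c)"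
    by (rule pos_step[OF valid_pre valid_pre _ _ w]) (use n' Hn_mono[of "n - 1" n] Hn_le[of "n - 1"] in \<open>auto simp: Hn_def\<close>)
  also have "\<dots> \<le> I / ((delta j)\<^sup>2 * m j) + err j (2 * c)"
    using LD[OF w] delta(1)[of j] m_pos[of j] by (intro add_right_mono divide_right_mono) (auto simp: g_def Hn_def)
  finally show "ip d w (pos j (pre r n) - pos j (pre r (n - 1))) \<le> I / ((delta j)\<^sup>2 * m j) + err j (2 * c)" .
qed

lemma movement_from_pos:
  assumes "eventually (\<lambda>j. (\<Sum>n=1..N. nrm (pos j (pre r n) - pos j (pre r (n - 1)))) \<le> \<kappa> / (1 - 2 * delta j) + real N * err j (2 * c)) ultra"
  shows "(\<Sum>n=1..N. nrm (steiner_alg (pre r n) - steiner_alg (pre r (n - 1)))) \<le> \<kappa>"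
proof (rule tendsto_le[OF ultra(1) _ _ assms])
  show "((\<lambda>j. \<Sum>n=1..N. nrm (pos j (pre r n) - pos j (pre r (n - 1)))) \<longlongrightarrow> (\<Sum>n=1..N. nrm (steiner_alg (pre r n) - steiner_alg (pre r (n - 1))))) ultra"
    by (intro tendsto_sum nrm_tendsto valid_pre) auto
  have "((\<lambda>j. \<kappa> / (1 - 2 * delta j) + real N * err j (2 * c)) \<longlongrightarrow> \<kappa> / (1 - 2 * 0) + real N * 0) ultra"
    by (intro tendsto_intros dl_tendsto err_tendsto) simp
  then show "((\<lambda>j. \<kappa> / (1 - 2 * delta j) + real N * err j (2 * c)) \<longlongrightarrow> \<kappa>) ultra" by simp
qed

lemma sum_shell_le:
  assumes "0 \<le> \<theta>" "\<theta> < 1 - 2 * delta j"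
  shows "(\<Sum>n=1..N. (LINT v:shell j \<theta>|lebesgue_Rd d. g n v)) \<le> c * (real d * \<theta> / (1 - 2 * delta j) * m j)"
proof -
  have "(\<Sum>n=1..N. (LINT v:shell j \<theta>|lebesgue_Rd d. g n v)) \<le> c * measure (lebesgue_Rd d) (shell j \<theta>)"
    by (rule sum_integral_g_le) (use D_shell_sub symmetric_S_shell in auto)
  also have "\<dots> \<le> c * (real d * \<theta> / (1 - 2 * delta j) * m j)"
    using c_nonneg assms by (intro mult_left_mono measure_shell)
  finally show ?thesis .
qed

text \<open>All flux regions lie in one shell, symmetric and independent of both w and n, over which
  the increments telescope. Its relative volume d * \<delta>^2 divided by the step \<delta>^2 leaves
  d.\<close>

lemma movement_bound: "(\<Sum>n=1..N. nrm (steiner_alg (pre r n) - steiner_alg (pre r (n - 1)))) \<le> real d * c"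
proof (rule movement_from_pos, intro always_eventually allI)
  fix j
  have "(\<Sum>n=1..N. nrm (pos j (pre r n) - pos j (pre r (n - 1)))) \<le>
    (\<Sum>n=1..N. (LINT v:shell j ((delta j)\<^sup>2)|lebesgue_Rd d. g n v) / ((delta j)\<^sup>2 * m j) + err j (2 * c))"
    using integral_D_le_shell[OF g_facts(1-3)] by (intro sum_mono step_le) auto
  also have "\<dots> = (\<Sum>n=1..N. (LINT v:shell j ((delta j)\<^sup>2)|lebesgue_Rd d. g n v)) / ((delta j)\<^sup>2 * m j) + real N * err j (2 * c)"
    by (simp add: sum.distrib sum_divide_distrib)
  also have "\<dots> \<le> (c * (real d * (delta j)\<^sup>2 / (1 - 2 * delta j) * m j)) / ((delta j)\<^sup>2 * m j) + real N * err j (2 * c)"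
    using delta(1)[of j] m_pos[of j] dl_sq[of j] by (intro add_right_mono divide_right_mono sum_shell_le) auto
  also have "\<dots> = real d * c / (1 - 2 * delta j) + real N * err j (2 * c)"
    using delta(1)[of j] m_pos[of j] by simp
  finally show "(\<Sum>n=1..N. nrm (pos j (pre r n) - pos j (pre r (n - 1)))) \<le> real d * c / (1 - 2 * delta j) + real N * err j (2 * c)" .
qed

end

section \<open>The Euclidean norm\<close>

locale euclidean_Rd = normed_Rd +
  assumes euclid: "v \<in> Rd d \<Longrightarrow> nrm v = sqrt (ip d v v)"
begin

lemma cauchy_schwarz: "\<bar>ip d v w\<bar> \<le> sqrt (ip d v v) * sqrt (ip d w w)"
proof -
  have "\<bar>ip d v w\<bar> \<le> (\<Sum>i<d. \<bar>v i\<bar> * \<bar>w i\<bar>)"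
    unfolding ip_def by (rule order.trans[OF sum_abs]) (simp add: abs_mult)
  also have "\<dots> \<le> L2_set v {..<d} * L2_set w {..<d}" by (rule L2_set_mult_ineq)
  finally show ?thesis by (simp add: L2_set_def ip_def power2_eq_square)
qed

lemma B_euclid: assumes "0 \<le> r" "v \<in> Rd d" shows "v \<in> B r \<longleftrightarrow> ip d v v \<le> r\<^sup>2"
proof
  assume "v \<in> B r"
  then have "ip d v v \<le> r * sqrt (ip d v v)" using BD(2)[of v r v] euclid assms by simp
  moreover have "ip d v v = sqrt (ip d v v) * sqrt (ip d v v)" using ip_self_nonneg[of d v] by simp
  ultimately have "sqrt (ip d v v) \<le> r"
    using assms(1) by (metis mult_le_cancel_right not_less order.trans real_sqrt_ge_zero ip_self_nonneg order_le_less)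
  then show "ip d v v \<le> r\<^sup>2" using assms(1) real_le_rsqrt sqrt_le_D by blast
next
  assume "ip d v v \<le> r\<^sup>2"
  then have "sqrt (ip d v v) \<le> r" using assms(1) real_le_lsqrt ip_self_nonneg by blast
  then have "ip d v y \<le> r * nrm y" if "y \<in> Rd d" for y
  proof -
    have "\<bar>ip d v y\<bar> \<le> sqrt (ip d v v) * nrm y" unfolding euclid[OF that] by (rule cauchy_schwarz)
    moreover have "sqrt (ip d v v) * nrm y \<le> r * nrm y"
      using \<open>sqrt (ip d v v) \<le> r\<close> nrm_nonneg[OF that] by (rule mult_right_mono)
    ultimately show ?thesis by linarith
  qed
  then show "v \<in> B r" using assms by (simp add: B_def)
qed

section \<open>Concentration of volume: cones over caps, layers of a thin shell\<close>

text \<open>The condition is homogeneous in v, which makes the set star-shaped as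
  \<open>star_shell_measure\<close> requires; the sign matches the flux regions, which lie opposite
  to w.\<close>

definition cone :: "nat \<Rightarrow> point \<Rightarrow> real \<Rightarrow> point set"
  where "cone j w b = {v \<in> S j. b * sqrt (ip d v v) \<le> - ip d w v}"

lemma cone_borel [measurable]: "cone j w b \<in> sets borel"
proof -
  have "closed {v. b * sqrt (ip d v v) \<le> - ip d w v}"
    unfolding ip_def by (intro closed_Collect_le continuous_intros)
  then have "closed (S j \<inter> {v. b * sqrt (ip d v v) \<le> - ip d w v})" unfolding S_def by (intro closed_Int closed_B)
  also have "S j \<inter> {v. b * sqrt (ip d v v) \<le> - ip d w v} = cone j w b" by (auto simp: cone_def)
  finally show ?thesis by (rule borel_closed)
qed

text \<open>The cone over a cap of height b lies in the ball of radius sqrt (1 - 3 b^2 / 4)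
  centred at half the height of the cap; this replaces the usual estimates for the uniform measure
  on the sphere.\<close>

lemma measure_cone:
  assumes w: "w \<in> B 1" and b: "0 \<le> b" "b \<le> 1"
  shows "measure (lebesgue_Rd d) (cone j w b) \<le> exp (- (3 * real d * b\<^sup>2 / 8)) * m j"
proof -
  define r where "r = 1 - 2 * delta j"
  have r: "0 < r" "r \<le> 1" using delta[of j] by (auto simp: r_def)
  have Sr: "S j = B r" by (simp add: S_def r_def)
  have wR: "w \<in> Rd d" using w by (rule BD)
  have ww: "ip d w w \<le> 1" using B_euclid[of 1 w] w wR by simp
  define \<kappa> where "\<kappa> = b * r / 2"
  have \<kappa>: "0 \<le> \<kappa>" using b r by (simp add: \<kappa>_def)
  define \<rho> where "\<rho> = sqrt (1 - 3 * b\<^sup>2 / 4)"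
  have b2: "b\<^sup>2 \<le> 1" "0 \<le> b\<^sup>2" using b by (auto simp: power_le_one)
  have \<rho>: "0 < \<rho>" "\<rho>\<^sup>2 = 1 - 3 * b\<^sup>2 / 4" using b2 by (auto simp: \<rho>_def)
  have sub: "cone j w b \<subseteq> {v. v - (- \<kappa>) *\<^sub>R w \<in> B (\<rho> * r)}"
  proof
    fix v assume v: "v \<in> cone j w b"
    then have vB: "v \<in> B r" and vX: "b * sqrt (ip d v v) \<le> - ip d w v" by (auto simp: cone_def Sr)
    have vR: "v \<in> Rd d" using vB by (rule BD)
    define y where "y = sqrt (ip d v v)"
    have y: "0 \<le> y" "y * y = ip d v v" using ip_self_nonneg by (simp_all add: y_def)
    have yr: "y \<le> r" using B_euclid[of r v] vB vR r unfolding y_def by (intro real_le_lsqrt) (auto simp: ip_self_nonneg)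
    \<comment> \<open>The squared distance to the centre is bounded by a quadratic in y that is no
      larger at y than at the endpoint y = r.\<close>
    have key: "y * (y - b\<^sup>2 * r) \<le> r * (r - b\<^sup>2 * r)"
    proof (cases "y \<le> b\<^sup>2 * r")
      case True
      then have "y * (y - b\<^sup>2 * r) \<le> 0" using y by (simp add: mult_nonneg_nonpos)
      also have "0 \<le> r * (r - b\<^sup>2 * r)" using r b2 by (simp add: mult_le_cancel_right2)
      finally show ?thesis .
    next
      case False
      then show ?thesis using y yr by (intro mult_mono) auto
    qed
    have "ip d (v - (- \<kappa>) *\<^sub>R w) (v - (- \<kappa>) *\<^sub>R w) = y * y + 2 * \<kappa> * ip d w v + \<kappa> * \<kappa> * ip d w w"
      unfolding ip_sq y(2) by (simp add: ip_commute)
    also have "\<dots> \<le> y * y + 2 * \<kappa> * (- (b * y)) + \<kappa> * \<kappa> * 1"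
    proof -
      have "ip d w v \<le> - (b * y)" using vX by (simp add: y_def)
      then have "2 * \<kappa> * ip d w v \<le> 2 * \<kappa> * (- (b * y))" using \<kappa> by (intro mult_left_mono) auto
      moreover have "\<kappa> * \<kappa> * ip d w w \<le> \<kappa> * \<kappa> * 1" using ww \<kappa> by (intro mult_left_mono) auto
      ultimately show ?thesis by linarith
    qed
    also have "\<dots> = y * (y - b\<^sup>2 * r) + b\<^sup>2 * r\<^sup>2 / 4"
      by (simp add: \<kappa>_def power2_eq_square algebra_simps)
    also have "\<dots> \<le> r * (r - b\<^sup>2 * r) + b\<^sup>2 * r\<^sup>2 / 4" using key by simp
    also have "\<dots> = (1 - 3 * b\<^sup>2 / 4) * r\<^sup>2" by (simp add: power2_eq_square algebra_simps)
    also have "\<dots> = (\<rho> * r)\<^sup>2" by (simp only: power_mult_distrib \<rho>(2))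
    finally have "v - (- \<kappa>) *\<^sub>R w \<in> B (\<rho> * r)"
      using B_euclid[of "\<rho> * r" "v - (- \<kappa>) *\<^sub>R w"] vR wR r \<rho> by simp
    then show "v \<in> {v. v - (- \<kappa>) *\<^sub>R w \<in> B (\<rho> * r)}" by simp
  qed
  have fm: "{v. v - (- \<kappa>) *\<^sub>R w \<in> B (\<rho> * r)} \<in> fmeasurable (lebesgue_Rd d)"
  proof (rule fmeasurableI)
    show "{v. v - (- \<kappa>) *\<^sub>R w \<in> B (\<rho> * r)} \<in> sets (lebesgue_Rd d)"
      using measurable_sets[OF affine_measurable[of "\<kappa> *\<^sub>R w" 1] B_borel[of "\<rho> * r"]] by (simp add: vimage_def add.commute)
    have "{v. v - (- \<kappa>) *\<^sub>R w \<in> B (\<rho> * r)} \<subseteq> B (\<rho> * r + \<kappa>)"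
    proof
      fix v assume "v \<in> {v. v - (- \<kappa>) *\<^sub>R w \<in> B (\<rho> * r)}"
      then have "v + \<kappa> *\<^sub>R w \<in> B (\<rho> * r)" by simp
      from B_shift[OF this _ \<kappa>, of "- w"] w show "v \<in> B (\<rho> * r + \<kappa>)" by (simp add: B_minus_iff)
    qed
    then show "emeasure (lebesgue_Rd d) {v. v - (- \<kappa>) *\<^sub>R w \<in> B (\<rho> * r)} < \<infinity>"
      using \<rho> r \<kappa> by (intro emeasure_finite[where r="\<rho> * r + \<kappa>"]) (auto simp: add_nonneg_nonneg)
  qed
  have "measure (lebesgue_Rd d) (cone j w b) \<le> measure (lebesgue_Rd d) {v. v - (- \<kappa>) *\<^sub>R w \<in> B (\<rho> * r)}"
    by (rule measure_mono_fmeasurable[OF sub _ fm]) simp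
  also have "\<dots> = measure (lebesgue_Rd d) (B (\<rho> * r))" using wR by (intro measure_translate) auto
  also have "\<dots> = \<rho> ^ d * measure (lebesgue_Rd d) {v. \<rho> *\<^sub>R v \<in> B (\<rho> * r)}" by (rule measure_scale) (use \<rho> in auto)
  also have "\<dots> = \<rho> ^ d * m j" using B_scale_iff[OF \<rho>(1), of _ r] by (simp add: m_def Sr)
  also have "\<dots> \<le> exp (- (3 * b\<^sup>2 / 8)) ^ d * m j"
  proof (intro mult_right_mono power_mono)
    \<comment> \<open>The radius ratio \<rho> enters to the power d; 1 + x \<le> exp x turns this
      into a Gaussian bound.\<close>
    have "\<rho>\<^sup>2 \<le> exp (- (3 * b\<^sup>2 / 4))" unfolding \<rho>(2) using exp_ge_add_one_self[of "- (3 * b\<^sup>2 / 4)"] by simp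
    also have "\<dots> = (exp (- (3 * b\<^sup>2 / 8)))\<^sup>2" by (simp add: power2_eq_square exp_add[symmetric])
    finally show "\<rho> \<le> exp (- (3 * b\<^sup>2 / 8))" by (rule power2_le_imp_le) simp
  qed (use \<rho> m_pos[of j] in auto)
  also have "exp (- (3 * b\<^sup>2 / 8)) ^ d = exp (- (3 * real d * b\<^sup>2 / 8))"
    by (simp add: exp_of_nat_mult[symmetric] algebra_simps)
  finally show ?thesis .
qed

definition layer :: "nat \<Rightarrow> point \<Rightarrow> real \<Rightarrow> real \<Rightarrow> point set"
  where "layer j w \<theta> b = shell j \<theta> \<inter> {v. b < - ip d w v}"

lemma layer_borel [measurable]: "layer j w \<theta> b \<in> sets borel"
proof -
  have "open {v. b < - ip d w v}" unfolding ip_def by (intro open_Collect_less continuous_intros)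
  then show ?thesis unfolding layer_def by (intro sets.Int sets_D_shell borel_open)
qed

text \<open>In the unit ball, height above b implies membership in the cone of slope b. The shell
  estimate applied to the cone then carries its Gaussian volume bound over to a thin shell.\<close>

lemma measure_layer:
  assumes w: "w \<in> B 1" and b: "0 \<le> b" "b \<le> 1" and \<theta>: "0 \<le> \<theta>" "\<theta> < 1 - 2 * delta j"
  shows "measure (lebesgue_Rd d) (layer j w \<theta> b) \<le> real d * \<theta> / (1 - 2 * delta j) * (exp (- (3 * real d * b\<^sup>2 / 8)) * m j)"
proof -
  define r where "r = 1 - 2 * delta j"
  have r: "0 < r" "r \<le> 1" using delta[of j] by (auto simp: r_def)
  have Sr: "S j = B r" by (simp add: S_def r_def)
  have coneS: "cone j w b \<subseteq> B r" by (auto simp: cone_def Sr)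
  have "layer j w \<theta> b \<subseteq> cone j w b - B (r - \<theta>)"
  proof
    fix v assume v: "v \<in> layer j w \<theta> b"
    then have vS: "v \<in> S j" "v \<notin> B (r - \<theta>)" "b < - ip d w v" by (auto simp: layer_def shell_def r_def)
    have vR: "v \<in> Rd d" using vS BD(1) by (simp add: Sr)
    have "ip d v v \<le> r\<^sup>2" using B_euclid[of r v] vS vR r by (simp add: Sr)
    also have "\<dots> \<le> 1" using r by (simp add: power_le_one)
    finally have "sqrt (ip d v v) \<le> 1" using real_sqrt_le_mono by fastforce
    then have "b * sqrt (ip d v v) \<le> b" using b by (simp add: mult_left_le)
    then show "v \<in> cone j w b - B (r - \<theta>)" using vS by (simp add: cone_def)
  qed
  moreover have "cone j w b - B (r - \<theta>) \<in> fmeasurable (lebesgue_Rd d)"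
    using emeasure_finite[of "cone j w b - B (r - \<theta>)" r] coneS r by (intro fmeasurableI) auto
  ultimately have "measure (lebesgue_Rd d) (layer j w \<theta> b) \<le> measure (lebesgue_Rd d) (cone j w b - B (r - \<theta>))"
    by (intro measure_mono_fmeasurable) auto
  also have "\<dots> \<le> real d * \<theta> / r * measure (lebesgue_Rd d) (cone j w b)"
  proof (rule star_shell_measure[OF cone_borel coneS])
    fix v and c :: real assume v: "v \<in> cone j w b" "0 < c" "c \<le> 1"
    have "sqrt (ip d (c *\<^sub>R v) (c *\<^sub>R v)) = c * sqrt (ip d v v)"
      using v by (simp add: ip_scale real_sqrt_mult mult.assoc[symmetric])
    moreover have "c * (b * sqrt (ip d v v)) \<le> c * (- ip d w v)" using v by (intro mult_left_mono) (auto simp: cone_def)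
    ultimately show "c *\<^sub>R v \<in> cone j w b" using v S_scale[of v j c] by (simp add: cone_def ip_scale mult_ac)
  qed (use r \<theta> in \<open>auto simp: r_def\<close>)
  also have "\<dots> \<le> real d * \<theta> / r * (exp (- (3 * real d * b\<^sup>2 / 8)) * m j)"
    using \<theta> r by (intro mult_left_mono measure_cone w b) auto
  finally show ?thesis by (simp add: r_def)
qed

text \<open>If a step -t w leaves the ball, then v lies within order t * X of the sphere, where X is
  its height against w. Sorting by dyadic multiples of a, level k needs a shell of thickness
  proportional to 2^(k+1) * a but contains only points higher than 2^k * a.\<close>

lemma D_cover:
  assumes w: "w \<in> B 1" and a: "0 < a" "a \<le> 1" "1 \<le> 2 ^ J * a" and t: "(delta j)\<^sup>2 \<le> a / 2"
    and J: "\<And>k. k < J \<Longrightarrow> 2 ^ k * a < 1"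
  shows "D j w \<subseteq> shell j (2 * (delta j)\<^sup>2 * a) \<union>
    (\<Union>k<J. layer j w (2 * (delta j)\<^sup>2 * (2 ^ Suc k * a)) (2 ^ k * a))"
proof
  fix v assume v: "v \<in> D j w"
  define r t where "r = 1 - 2 * delta j" and "t = (delta j)\<^sup>2"
  have r: "3 / 4 \<le> r" "r \<le> 1" using delta[of j] by (auto simp: r_def)
  have t: "0 \<le> t" "t \<le> 1 / 64" "t \<le> a / 2" using dl_sq[of j] delta[of j] t by (auto simp: t_def)
  have Sr: "S j = B r" by (simp add: S_def r_def)
  have vS: "v \<in> S j" "v - t *\<^sub>R w \<notin> S j" using v by (auto simp: D_def t_def)
  have vR: "v \<in> Rd d" and wR: "w \<in> Rd d" using vS BD(1) w by (auto simp: Sr)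
  have ww: "ip d w w \<le> 1" using B_euclid[of 1 w] w wR by simp
  have vv: "ip d v v \<le> 1" using B_euclid[of 1 v] vS vR S_sub[of j] by auto
  define X where "X = - ip d w v"
  have X1: "X \<le> 1"
  proof -
    have "\<bar>ip d w v\<bar> \<le> 1 * nrm v" by (rule B_abs[OF w vR])
    also have "nrm v \<le> 1" using euclid[OF vR] vv by simp
    finally show ?thesis by (simp add: X_def)
  qed
  have "r\<^sup>2 < ip d (v - t *\<^sub>R w) (v - t *\<^sub>R w)"
    using vS(2) B_euclid[of r "v - t *\<^sub>R w"] r vR wR by (auto simp: Sr)
  also have "\<dots> = ip d v v + 2 * t * X + t * t * ip d w w"
    unfolding ip_sq by (simp add: X_def ip_commute)
  also have "\<dots> \<le> ip d v v + 2 * t * X + t * t" using ww t by (simp add: mult_left_le)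
  finally have low: "r\<^sup>2 < ip d v v + 2 * t * X + t * t" .
  \<comment> \<open>The factor 2 in the thickness absorbs that r may be as small as 3 / 4 and also
    the quadratic terms, which \<open>t \<le> a / 2\<close> keeps below the linear one.\<close>
  have shell: "v \<in> shell j (2 * t * \<alpha>)" if \<alpha>: "a \<le> \<alpha>" "\<alpha> \<le> 2" "X \<le> \<alpha>" for \<alpha>
  proof -
    have \<alpha>0: "0 < \<alpha>" using \<alpha> a by simp
    have "2 * t * \<alpha> \<le> 2 * (1 / 64) * 2" using t \<alpha> \<alpha>0 by (intro mult_mono) auto
    then have r\<theta>: "0 \<le> r - 2 * t * \<alpha>" using r by simp
    have "v \<notin> B (r - 2 * t * \<alpha>)"
    proof
      assume "v \<in> B (r - 2 * t * \<alpha>)"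
      then have "ip d v v \<le> (r - 2 * t * \<alpha>)\<^sup>2" using B_euclid[OF r\<theta> vR] by simp
      also have "\<dots> = r\<^sup>2 - t * (4 * r * \<alpha> - 4 * t * \<alpha> * \<alpha>)" by (simp add: power2_eq_square algebra_simps)
      also have "\<dots> \<le> r\<^sup>2 - t * (2 * X + t)"
      proof -
        have "t * \<alpha> \<le> 1 / 64 * 2" using t \<alpha> \<alpha>0 by (intro mult_mono) auto
        then have "4 * t * \<alpha> * \<alpha> \<le> 1 / 8 * \<alpha>" using \<alpha>0 by (intro mult_right_mono) auto
        moreover have "3 / 4 * \<alpha> \<le> r * \<alpha>" using r \<alpha>0 by (intro mult_right_mono) auto
        moreover have "4 * r * \<alpha> = 4 * (r * \<alpha>)" by simp
        moreover have "t \<le> \<alpha> / 2" using t \<alpha> by linarith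
        ultimately have "2 * X + t \<le> 4 * r * \<alpha> - 4 * t * \<alpha> * \<alpha>" using \<alpha>(3) \<alpha>0 by linarith
        then show ?thesis using t by (simp add: mult_left_mono)
      qed
      finally show False using low by (simp add: algebra_simps)
    qed
    then show ?thesis using vS by (simp add: shell_def r_def)
  qed
  \<comment> \<open>The first dyadic level above the height: level 0 means the symmetric shell,
    level k + 1 means the layer with index k.\<close>
  define i where "i = (LEAST i. X \<le> 2 ^ i * a)"
  have "X \<le> 2 ^ J * a" using X1 a by simp
  then have i: "X \<le> 2 ^ i * a" "i \<le> J" unfolding i_def by (rule LeastI, rule Least_le)
  show "v \<in> shell j (2 * (delta j)\<^sup>2 * a) \<union> (\<Union>k<J. layer j w (2 * (delta j)\<^sup>2 * (2 ^ Suc k * a)) (2 ^ k * a))"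
  proof (cases i)
    case 0
    then have "v \<in> shell j (2 * t * a)" using i a by (intro shell) auto
    then show ?thesis by (simp add: t_def)
  next
    case (Suc k)
    then have k: "k < J" "\<not> X \<le> 2 ^ k * a" using i not_less_Least[of k "\<lambda>i. X \<le> 2 ^ i * a"] by (auto simp: i_def)
    have "1 \<le> (2 ^ Suc k :: real)" by (rule one_le_power) simp
    then have "a \<le> 2 ^ Suc k * a" using a by (simp add: mult_le_cancel_right1)
    moreover have "2 ^ Suc k * a \<le> 2" using J[OF k(1)] by simp
    ultimately have "v \<in> shell j (2 * t * (2 ^ Suc k * a))" using i Suc by (intro shell) auto
    then have "v \<in> layer j w (2 * (delta j)\<^sup>2 * (2 ^ Suc k * a)) (2 ^ k * a)" using k by (simp add: layer_def t_def X_def)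
    then show ?thesis using k(1) by blast
  qed
qed

end

locale euclidean_chase = chase + euclidean_Rd +
  assumes d1: "1 \<le> d" and N2: "2 \<le> N"
begin

section \<open>The bound of order sqrt (d ln N)\<close>

text \<open>With 16 * 3 / 8 = 6 the exponent is 6 * 4^k * ln N, at least (1 + 2 (k + 1)) * ln N. One
  power of 1 / N pays for the N steps; the others give 4^(-(k + 1)) as N is at least 2, which beats
  the thickness 2^(k + 1) and leaves a geometric series.\<close>

lemma gaussian_layer_sum:
  assumes "real d * a\<^sup>2 = 16 * ln (real N)"
  shows "2 ^ Suc k * exp (- (3 * real d * (2 ^ k * a)\<^sup>2 / 8)) \<le> (1 / 2) ^ Suc k / real N"
proof -
  have N: "2 \<le> real N" "0 < real N" using N2 by auto
  have kk: "1 + 2 * real (Suc k) \<le> 6 * 4 ^ k"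
  proof (induction k)
    case (Suc k)
    have "(1::real) \<le> 4 ^ k" by simp
    then show ?case using Suc by simp
  qed simp
  have "(2 ^ k)\<^sup>2 = ((2::real)\<^sup>2) ^ k" by (simp only: power_mult[symmetric] mult.commute)
  then have "(2 ^ k * a)\<^sup>2 = 4 ^ k * a\<^sup>2" by (simp add: power_mult_distrib)
  then have "3 * real d * (2 ^ k * a)\<^sup>2 / 8 = 3 * 4 ^ k * (real d * a\<^sup>2) / 8" by simp
  also have "\<dots> = 6 * 4 ^ k * ln (real N)" unfolding assms by simp
  finally have e: "3 * real d * (2 ^ k * a)\<^sup>2 / 8 = 6 * 4 ^ k * ln (real N)" .
  have "(1 + 2 * real (Suc k)) * ln (real N) \<le> 6 * 4 ^ k * ln (real N)"
    using kk N by (intro mult_right_mono) auto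
  then have "exp (- (3 * real d * (2 ^ k * a)\<^sup>2 / 8)) \<le> exp (- (real (1 + 2 * Suc k) * ln (real N)))"
    unfolding e by simp
  also have "\<dots> = 1 / real N ^ (1 + 2 * Suc k)"
    using N by (simp only: exp_minus exp_of_nat_mult exp_ln inverse_eq_divide)
  also have "real N ^ (1 + 2 * Suc k) = real N * ((real N)\<^sup>2) ^ Suc k"
    by (simp only: power_mult[symmetric] power_add power_one_right)
  also have "1 / (real N * ((real N)\<^sup>2) ^ Suc k) \<le> 1 / (real N * 4 ^ Suc k)"
  proof (intro divide_left_mono mult_left_mono power_mono)
    show "4 \<le> (real N)\<^sup>2" using power_mono[of 2 "real N" 2] N by simp
  qed (use N in auto)
  finally have "2 ^ Suc k * exp (- (3 * real d * (2 ^ k * a)\<^sup>2 / 8)) \<le> 2 ^ Suc k * (1 / (real N * 4 ^ Suc k))"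
    by (intro mult_left_mono) auto
  also have "\<dots> = (1 / 2) ^ Suc k / real N"
  proof -
    have "(4::real) ^ Suc k = 2 ^ Suc k * 2 ^ Suc k" by (simp flip: power_mult_distrib)
    then show ?thesis by (simp add: power_one_over)
  qed
  finally show ?thesis .
qed

text \<open>The symmetric shell of thickness 2 t a telescopes and gives 2 d a c. The layers depend
  on w; there each increment is bounded by 2 c, and N steps of Gaussian tails add 4 d a c.\<close>

lemma euclidean_movement_small:
  assumes a: "0 < a" "a \<le> 1" and da: "real d * a\<^sup>2 = 16 * ln (real N)"
  shows "(\<Sum>n=1..N. nrm (steiner_alg (pre r n) - steiner_alg (pre r (n - 1)))) \<le> 6 * real d * a * c"
proof (rule movement_from_pos)
  have "\<exists>J. 1 \<le> 2 ^ J * a"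
  proof -
    obtain J where "1 / a < 2 ^ J" using real_arch_pow[of 2 "1 / a"] by auto
    then have "1 \<le> 2 ^ J * a" using a by (simp add: field_simps)
    then show ?thesis ..
  qed
  \<comment> \<open>The least such J, so that all layers used have height below 1, the range of the
    cone estimate.\<close>
  then obtain J where J: "1 \<le> 2 ^ J * a" "\<And>k. k < J \<Longrightarrow> 2 ^ k * a < 1"
    using exists_least_iff[of "\<lambda>J. 1 \<le> 2 ^ J * a"] by (metis linorder_not_le)
  have ev: "eventually (\<lambda>j. (delta j)\<^sup>2 < a / 2) ultra"
  proof -
    have "((\<lambda>j. (delta j)\<^sup>2) \<longlongrightarrow> 0\<^sup>2) ultra" by (intro tendsto_intros dl_tendsto)
    then have "((\<lambda>j. (delta j)\<^sup>2) \<longlongrightarrow> 0) ultra" by simp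
    from order_tendstoD(2)[OF this, of "a / 2"] show ?thesis using a by simp
  qed
  have "(\<Sum>n=1..N. nrm (pos j (pre r n) - pos j (pre r (n - 1)))) \<le> 6 * real d * a * c / (1 - 2 * delta j) + real N * err j (2 * c)"
    if small: "(delta j)\<^sup>2 < a / 2" for j
  proof -
    define \<rho> t where "\<rho> = 1 - 2 * delta j" and "t = (delta j)\<^sup>2"
    have \<rho>: "3 / 4 \<le> \<rho>" using delta[of j] by (simp add: \<rho>_def)
    have t: "0 < t" "t \<le> 1 / 64" using dl_sq[of j] delta[of j] by (auto simp: t_def)
    have N0: "0 < real N" using N2 by simp
    \<comment> \<open>The volume bound for a shell of thickness 2 t a, used as the unit in which the
      layers are measured.\<close>
    define Q where "Q = 2 * t * real d * a / \<rho> * m j"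
    have Q0: "0 \<le> Q" using t a \<rho> m_pos[of j] by (simp add: Q_def)
    have th: "2 * t * \<alpha> < \<rho>" if "0 \<le> \<alpha>" "\<alpha> \<le> 2" for \<alpha>
    proof -
      have "2 * t * \<alpha> \<le> 2 * (1 / 64) * 2" using t that by (intro mult_mono) auto
      then show ?thesis using \<rho> by simp
    qed
    have step: "(LINT v:D j w|lebesgue_Rd d. g n v) \<le> (LINT v:shell j (2 * t * a)|lebesgue_Rd d. g n v) + 2 * c * Q / real N"
      if n: "n \<in> {1..N}" and w: "w \<in> B 1" for n w
    proof -
      define L where "L = (\<lambda>k. layer j w (2 * t * (2 ^ Suc k * a)) (2 ^ k * a))"
      have Lsub: "L k \<subseteq> B 1" for k using D_shell_sub(4) by (auto simp: L_def layer_def)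
      have Lb: "L k \<in> sets borel" for k by (simp add: L_def)
      have "(LINT v:D j w|lebesgue_Rd d. g n v) \<le> (LINT v:shell j (2 * t * a)|lebesgue_Rd d. g n v) + (\<Sum>k<J. LINT v:L k|lebesgue_Rd d. g n v)"
      proof (rule set_integral_mono_cover)
        show "D j w \<subseteq> shell j (2 * t * a) \<union> (\<Union>k<J. L k)"
          unfolding L_def t_def using D_cover[OF w a J(1) _ J(2)] small by simp
      qed (use g_facts(2)[OF n] in \<open>auto intro!: g_facts(4)[OF n] Lb Lsub D_shell_sub sets_D_shell\<close>)
      also have "(\<Sum>k<J. LINT v:L k|lebesgue_Rd d. g n v) \<le> (\<Sum>k<J. 2 * c * (Q * (1 / 2) ^ Suc k / real N))"
      proof (rule sum_mono)
        fix k assume "k \<in> {..<J}"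
        then have k: "2 ^ k * a < 1" using J(2) by simp
        have "(LINT v:L k|lebesgue_Rd d. g n v) \<le> (LINT v:L k|lebesgue_Rd d. 2 * c)"
          using g_facts(3)[OF n] c_nonneg
          by (intro set_integral_mono g_facts(4)[OF n] Lb Lsub integrable_S[where M="2 * c"]) auto
        also have "\<dots> = 2 * c * measure (lebesgue_Rd d) (L k)" by (rule integral_const_S[OF Lb Lsub])
        also have "\<dots> \<le> 2 * c * (Q * (1 / 2) ^ Suc k / real N)"
        proof (rule mult_left_mono)
          have "measure (lebesgue_Rd d) (L k) \<le> real d * (2 * t * (2 ^ Suc k * a)) / \<rho> * (exp (- (3 * real d * (2 ^ k * a)\<^sup>2 / 8)) * m j)"
            unfolding L_def \<rho>_def using k a t th[of "2 ^ Suc k * a"]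
            by (intro measure_layer w) (auto simp: \<rho>_def)
          also have "\<dots> = Q * (2 ^ Suc k * exp (- (3 * real d * (2 ^ k * a)\<^sup>2 / 8)))"
            by (simp add: Q_def mult_ac)
          also have "\<dots> \<le> Q * ((1 / 2) ^ Suc k / real N)"
            by (intro mult_left_mono gaussian_layer_sum da Q0)
          finally show "measure (lebesgue_Rd d) (L k) \<le> Q * (1 / 2) ^ Suc k / real N" by simp
        qed (use c_nonneg in simp)
        finally show "(LINT v:L k|lebesgue_Rd d. g n v) \<le> 2 * c * (Q * (1 / 2) ^ Suc k / real N)" .
      qed
      also have "\<dots> = 2 * c * Q / real N * (\<Sum>k<J. (1 / 2) ^ Suc k)"
        by (simp add: sum_distrib_left mult_ac)
      also have "\<dots> \<le> 2 * c * Q / real N * 1"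
      proof (rule mult_left_mono)
        have "(\<Sum>k<J. (1 / 2) ^ Suc k) = 1 - (1 / 2 :: real) ^ J" by (induction J) auto
        then show "(\<Sum>k<J. (1 / 2) ^ Suc k) \<le> (1 :: real)" by simp
      qed (use c_nonneg Q0 in simp)
      finally show ?thesis by simp
    qed
    have "(\<Sum>n=1..N. nrm (pos j (pre r n) - pos j (pre r (n - 1)))) \<le>
      (\<Sum>n=1..N. ((LINT v:shell j (2 * t * a)|lebesgue_Rd d. g n v) + 2 * c * Q / real N) / (t * m j) + err j (2 * c))"
      unfolding t_def by (intro sum_mono step_le) (use step in \<open>auto simp: t_def\<close>)
    also have "\<dots> = ((\<Sum>n=1..N. LINT v:shell j (2 * t * a)|lebesgue_Rd d. g n v) + 2 * c * Q) / (t * m j) + real N * err j (2 * c)"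
      using N0 by (simp add: sum.distrib add_divide_distrib sum_divide_distrib)
    also have "\<dots> \<le> (c * (real d * (2 * t * a) / \<rho> * m j) + 2 * c * Q) / (t * m j) + real N * err j (2 * c)"
      unfolding \<rho>_def using t a m_pos[of j] th[of a]
      by (intro add_right_mono divide_right_mono sum_shell_le) (auto simp: \<rho>_def)
    also have "(c * (real d * (2 * t * a) / \<rho> * m j) + 2 * c * Q) / (t * m j) = 6 * real d * a * c / \<rho>"
      unfolding Q_def using t m_pos[of j] \<rho> by (simp add: field_simps)
    finally show ?thesis unfolding \<rho>_def .
  qed
  then show "eventually (\<lambda>j. (\<Sum>n=1..N. nrm (pos j (pre r n) - pos j (pre r (n - 1)))) \<le> 6 * real d * a * c / (1 - 2 * delta j) + real N * err j (2 * c)) ultra"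
    using ev by (rule eventually_mono[rotated])
qed

lemma euclidean_movement_bound:
  "(\<Sum>n=1..N. nrm (steiner_alg (pre r n) - steiner_alg (pre r (n - 1)))) \<le> 24 * sqrt (real d * ln (real N)) * c"
proof -
  \<comment> \<open>The solution of d * a^2 = 16 ln N.\<close>
  define a where "a = 4 * sqrt (ln (real N) / real d)"
  have d0: "0 < real d" using d1 by simp
  have lnN: "0 < ln (real N)" using N2 by simp
  have a: "0 < a" using d0 lnN by (simp add: a_def)
  have da: "real d * a\<^sup>2 = 16 * ln (real N)" using d0 lnN by (simp add: a_def power_mult_distrib)
  have dda: "real d * a = 4 * sqrt (real d * ln (real N))"
  proof -
    have "real d * sqrt (ln (real N) / real d) = real d / sqrt (real d) * sqrt (ln (real N))"
      by (simp add: real_sqrt_divide)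
    also have "\<dots> = sqrt (real d * ln (real N))" using d0 by (simp only: real_div_sqrt real_sqrt_mult less_imp_le)
    finally show ?thesis by (simp add: a_def)
  qed
  show ?thesis
  proof (cases "a \<le> 1")
    case True
    from euclidean_movement_small[OF a True da] show ?thesis using dda by (simp add: mult.assoc)
  next
    case False
    \<comment> \<open>If a exceeds 1 then d itself is below the target, and the bound for general
      norms is good enough.\<close>
    then have "real d * 1 \<le> real d * a" using d0 by (intro mult_left_mono) auto
    then have "real d \<le> 24 * sqrt (real d * ln (real N))" using dda d0 lnN by simp
    then have "real d * c \<le> 24 * sqrt (real d * ln (real N)) * c" using c_nonneg by (rule mult_right_mono)
    then show ?thesis using movement_bound by simp
  qed
qed

end

section \<open>Function and body requests\<close>

text \<open>A convex function on a cross-polytope is bounded by its values at the vertices and the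
  centre; as f is nonnegative, their sum serves as the bound.\<close>

lemma convex_bounded_on_cross_polytope:
  assumes f: "convex_on (Rd d) f" "\<And>x. x \<in> Rd d \<Longrightarrow> 0 \<le> f x" and x: "x \<in> Rd d"
  shows "\<exists>M. \<forall>z\<in>Rd d. l1 d (z - x) \<le> 1 \<longrightarrow> f z \<le> M"
proof -
  define e :: "nat \<Rightarrow> point" where "e = (\<lambda>i j. if j = i then 1 else 0)"
  have eR: "e i \<in> Rd d" if "i < d" for i using that by (simp add: e_def Rd_iff)
  define M where "M = f x + (\<Sum>i<d. f (x + e i) + f (x - e i))"
  have vert: "f x \<le> M" "i < d \<Longrightarrow> f (x + e i) \<le> M" "i < d \<Longrightarrow> f (x - e i) \<le> M" for i
  proof -
    have pos: "0 \<le> f (x + e i)" "0 \<le> f (x - e i)" if "i < d" for i using f(2) x eR[OF that] by blast+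
    then have "0 \<le> (\<Sum>i<d. f (x + e i) + f (x - e i))"
      by (intro sum_nonneg add_nonneg_nonneg) simp_all
    then show "f x \<le> M" by (simp add: M_def)
    assume i: "i < d"
    have "f (x + e i) + f (x - e i) \<le> (\<Sum>i<d. f (x + e i) + f (x - e i))"
      by (rule member_le_sum) (use i pos in auto)
    then show "f (x + e i) \<le> M" "f (x - e i) \<le> M" using pos[OF i] f(2)[OF x] by (auto simp: M_def)
  qed
  have "f z \<le> M" if z: "z \<in> Rd d" "l1 d (z - x) \<le> 1" for z
  proof -
    define u where "u = z - x"
    have uR: "u \<in> Rd d" using z x by (simp add: u_def)
    \<comment> \<open>Weight \<open>\<bar>u i\<bar>\<close> goes to the vertex on the side of the
      sign of \<open>u i\<close>, and the remaining mass, stored at index d, to the centre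
      x.\<close>
    define a where "a = (\<lambda>i. if i < d then \<bar>u i\<bar> else 1 - l1 d u)"
    define y where "y = (\<lambda>i. if i < d then x + sgn (u i) *\<^sub>R e i else x)"
    have yR: "y i \<in> Rd d" for i using x eR by (auto simp: y_def)
    have fy: "f (y i) \<le> M" for i
    proof (cases "i < d")
      case True
      then consider "u i = 0" | "u i > 0" | "u i < 0" by linarith
      then show ?thesis
      proof cases
        case 1
        then show ?thesis using True vert(1) by (simp only: y_def if_True sgn_0 scaleR_zero_left add_0_right)
      next
        case 2
        then show ?thesis using True vert(2)[OF True] by (simp only: y_def if_True sgn_pos scaleR_one)
      next
        case 3
        then show ?thesis using True vert(3)[OF True] by (simp only: y_def if_True sgn_neg scaleR_minus1_left diff_conv_add_uminus)
      qed
    qed (use vert(1) in \<open>simp add: y_def\<close>)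
    have a0: "0 \<le> a i" for i using z by (simp add: a_def u_def)
    have a1: "(\<Sum>i\<le>d. a i) = 1" by (simp add: lessThan_Suc_atMost[symmetric] a_def l1_def)
    have "(\<Sum>i\<le>d. a i *\<^sub>R y i) = (\<Sum>i<d. a i *\<^sub>R y i) + a d *\<^sub>R y d"
      by (simp only: lessThan_Suc_atMost[symmetric] sum.lessThan_Suc)
    also have "(\<Sum>i<d. a i *\<^sub>R y i) = (\<Sum>i<d. \<bar>u i\<bar> *\<^sub>R x + u i *\<^sub>R e i)"
    proof (rule sum.cong)
      fix i assume "i \<in> {..<d}"
      then have "a i = \<bar>u i\<bar>" "y i = x + sgn (u i) *\<^sub>R e i" by (auto simp: a_def y_def)
      then show "a i *\<^sub>R y i = \<bar>u i\<bar> *\<^sub>R x + u i *\<^sub>R e i"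
        by (simp only: scaleR_add_right scaleR_scaleR abs_mult_sgn)
    qed simp
    also have "\<dots> = l1 d u *\<^sub>R x + u"
      using Rd_eq_sum_axes[OF uR] by (simp only: sum.distrib scaleR_sum_left[symmetric] l1_def e_def)
    also have "l1 d u *\<^sub>R x + u + a d *\<^sub>R y d = z"
      by (simp add: a_def y_def u_def fun_eq_iff algebra_simps)
    finally have zy: "z = (\<Sum>i\<le>d. a i *\<^sub>R y i)" by (rule sym)
    have "f z \<le> (\<Sum>i\<le>d. a i * f (y i))"
      unfolding zy by (rule convex_on_sum[OF _ _ f(1) a1 a0 yR]) auto
    also have "\<dots> \<le> (\<Sum>i\<le>d. a i * M)" by (intro sum_mono mult_left_mono fy a0)
    also have "\<dots> = M" by (simp only: sum_distrib_right[symmetric] a1 mult_1)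
    finally show ?thesis .
  qed
  then show ?thesis by blast
qed

text \<open>Lower semicontinuity of f at x: x lies between X n and a point z beyond it at l1
  distance 1, where f is at most M. Convexity gives f x * (1 + \<epsilon>) \<le> f (X n) +
  \<epsilon> * M with \<epsilon> the distance from X n to x.\<close>

lemma convex_on_Rd_closed_epigraph:
  assumes f: "convex_on (Rd d) f" "\<And>x. x \<in> Rd d \<Longrightarrow> 0 \<le> f x"
  shows "closed {(x, c). x \<in> Rd d \<and> f x \<le> c}"
  unfolding closed_sequential_limits
proof (intro allI impI)
  fix P :: "nat \<Rightarrow> point \<times> real" and l
  assume P: "(\<forall>n. P n \<in> {(x, c). x \<in> Rd d \<and> f x \<le> c}) \<and> P \<longlonglongrightarrow> l"
  define X \<beta> x b where "X = (\<lambda>n. fst (P n))" and "\<beta> = (\<lambda>n. snd (P n))" and "x = fst l" and "b = snd l"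
  have X: "X n \<in> Rd d" "f (X n) \<le> \<beta> n" for n using P by (auto simp: X_def \<beta>_def split_beta)
  have lim: "X \<longlonglongrightarrow> x" "\<beta> \<longlonglongrightarrow> b" using P by (auto simp: X_def \<beta>_def x_def b_def intro: tendsto_fst tendsto_snd)
  have x: "x \<in> Rd d" using closed_sequentially[OF closed_Rd _ lim(1)] X by blast
  obtain M where M: "\<And>z. z \<in> Rd d \<Longrightarrow> l1 d (z - x) \<le> 1 \<Longrightarrow> f z \<le> M"
    using convex_bounded_on_cross_polytope[OF f x] by blast
  define \<epsilon> where "\<epsilon> = (\<lambda>n. l1 d (x - X n))"
  have "(\<lambda>n. l1 d (x - X n)) \<longlonglongrightarrow> l1 d (x - x)"
    using continuous_on_tendsto_compose[OF continuous_on_l1[of UNIV d x] lim(1)] by simp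
  then have \<epsilon>lim: "\<epsilon> \<longlonglongrightarrow> 0" by (simp add: \<epsilon>_def l1_def)
  have ineq: "f x * (1 + \<epsilon> n) \<le> \<beta> n + \<epsilon> n * M" for n
  proof (cases "\<epsilon> n = 0")
    case True
    then have "\<And>i. i < d \<Longrightarrow> x i = X n i" by (auto simp: \<epsilon>_def l1_def sum_nonneg_eq_0_iff)
    then have "x = X n" using x X(1)[of n] by (intro ext) (metis Rd_iff linorder_not_le)
    then show ?thesis using X(2)[of n] True by simp
  next
    case False
    then have e: "0 < \<epsilon> n" using l1_nonneg[of d "x - X n"] by (simp add: \<epsilon>_def)
    \<comment> \<open>The ray from X n through x, continued by l1 length 1 beyond x.\<close>
    define z where "z = x + (1 / \<epsilon> n) *\<^sub>R (x - X n)"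
    have zR: "z \<in> Rd d" using x X(1)[of n] by (simp add: z_def)
    have "l1 d (z - x) = 1 / \<epsilon> n * l1 d (x - X n)"
      using e by (simp add: z_def l1_def abs_mult sum_divide_distrib)
    then have fz: "f z \<le> M" using M[OF zR] e by (simp add: \<epsilon>_def)
    have "x = (1 / (1 + \<epsilon> n)) *\<^sub>R X n + (\<epsilon> n / (1 + \<epsilon> n)) *\<^sub>R z"
    proof
      fix i show "x i = ((1 / (1 + \<epsilon> n)) *\<^sub>R X n + (\<epsilon> n / (1 + \<epsilon> n)) *\<^sub>R z) i"
      proof -
        have "\<epsilon> n * z i = (1 + \<epsilon> n) * x i - X n i" using e by (simp add: z_def field_simps)
        then have "(1 + \<epsilon> n) * x i = X n i + \<epsilon> n * z i" by simp
        then have "x i = (X n i + \<epsilon> n * z i) / (1 + \<epsilon> n)" using e by (simp add: field_simps)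
        then show ?thesis by (simp add: add_divide_distrib)
      qed
    qed
    moreover have "1 / (1 + \<epsilon> n) + \<epsilon> n / (1 + \<epsilon> n) = 1" using e by (simp add: field_simps)
    ultimately have "f x \<le> 1 / (1 + \<epsilon> n) * f (X n) + \<epsilon> n / (1 + \<epsilon> n) * f z"
      using f(1) X(1)[of n] zR e unfolding convex_on_def by (metis divide_nonneg_pos add_pos_pos zero_less_one zero_le_one less_imp_le)
    also have "\<dots> \<le> 1 / (1 + \<epsilon> n) * \<beta> n + \<epsilon> n / (1 + \<epsilon> n) * M"
      using X(2)[of n] fz e by (intro add_mono mult_left_mono) auto
    also have "\<dots> = (\<beta> n + \<epsilon> n * M) / (1 + \<epsilon> n)" by (simp add: add_divide_distrib)
    finally show ?thesis using e by (simp add: pos_le_divide_eq)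
  qed
  have "f x * (1 + 0) \<le> b + 0 * M"
  proof (rule LIMSEQ_le)
    show "(\<lambda>n. f x * (1 + \<epsilon> n)) \<longlonglongrightarrow> f x * (1 + 0)" by (intro tendsto_intros \<epsilon>lim)
    show "(\<lambda>n. \<beta> n + \<epsilon> n * M) \<longlonglongrightarrow> b + 0 * M" by (intro tendsto_intros \<epsilon>lim lim)
  qed (use ineq in blast)
  then show "l \<in> {(x, c). x \<in> Rd d \<and> f x \<le> c}" using x by (simp add: x_def b_def split_beta)
qed

lemma le_mult_Inf:
  fixes y \<kappa> :: real
  assumes "\<And>c. c \<in> T \<Longrightarrow> y \<le> \<kappa> * c" "T \<noteq> {}" "0 \<le> \<kappa>"
  shows "y \<le> \<kappa> * Inf T"
proof (cases "\<kappa> = 0")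
  \<comment> \<open>The factor is the dimension in one application, so 0 does occur and division by
    it has to be avoided.\<close>
  case True
  then show ?thesis using assms by auto
next
  case False
  then have "0 < \<kappa>" using assms(3) by simp
  then have "y / \<kappa> \<le> Inf T" using assms(1,2) by (intro cInf_greatest) (auto simp: pos_divide_le_eq mult.commute)
  then show ?thesis using \<open>0 < \<kappa>\<close> by (simp add: pos_divide_le_eq mult.commute)
qed

section \<open>The two kinds of requests, and passage to the offline infimum\<close>

context normed_Rd
begin

lemma alg_mem:
  assumes "valid \<rho>" "\<rho> \<noteq> []" "closed (fst (last \<rho>))"
  shows "steiner_alg \<rho> \<in> fst (last \<rho>)"
proof (rule Lim_in_closed_set[OF assms(3) _ ultra(1) pos_tendsto_alg[OF assms(1)]])
  have "pos j \<rho> \<in> fst (last \<rho>)" for j using good_pos[OF assms(1), of j] assms(2) by (simp add: good_def)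
  then show "\<forall>\<^sub>F j in ultra. pos j \<rho> \<in> fst (last \<rho>)" by simp
qed

definition function_req :: "(point \<Rightarrow> real) \<Rightarrow> req"
  where "function_req f = (Rd d, f)"

definition body_req :: "point set \<Rightarrow> req"
  where "body_req K = (K, \<lambda>_. 0)"

lemma request_function: "function_request d f \<Longrightarrow> request (function_req f)"
  using convex_on_Rd_closed_epigraph[of d f] Rd_closed_ops(1)[of d]
  unfolding function_request_def request_def function_req_def fst_conv snd_conv by blast

lemma request_body: "body_request d K \<Longrightarrow> request (body_req K)"
proof -
  assume K: "body_request d K"
  then have "closed K" "K \<subseteq> Rd d" "K \<noteq> {}" "convex K"
    by (auto simp: body_request_def closedin_Euclidean_space_iff)
  moreover have "{(x, c). x \<in> K \<and> (0::real) \<le> c} = K \<times> {0..}" by auto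
  ultimately show ?thesis
    by (simp add: request_def body_req_def convex_on_def closed_Times)
qed

lemma play_map: "play (\<lambda>rs. steiner_alg (map h rs)) f n = steiner_alg (pre (\<lambda>n. h (f n)) n)"
proof (cases "n = 0")
  case True
  show ?thesis unfolding play_def True pre_0 alg_Nil by (rule if_P) (rule refl)
next
  case False
  then show ?thesis unfolding play_def pre_def by (simp only: if_False map_map o_def)
qed

lemma euclidean_bound:
  assumes "chase d nrm r N x" "1 \<le> d" "2 \<le> N" "euclidean_norm_on_Rd d nrm"
  shows "(\<Sum>n=1..N. nrm (steiner_alg (pre r n) - steiner_alg (pre r (n - 1)))) \<le> 24 * sqrt (real d * ln (real N)) * traj_cost r x N"
proof -
  interpret chase d nrm r N x by fact
  interpret euclidean_chase d nrm r N x
    by unfold_locales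
      (use assms in \<open>auto simp: euclidean_norm_on_Rd_def L2_set_def ip_def power2_eq_square\<close>)
  show ?thesis using euclidean_movement_bound by (simp add: c_def)
qed

lemma function_play_bounds:
  fixes f :: "nat \<Rightarrow> point \<Rightarrow> real"
  defines "p \<equiv> play (\<lambda>fs. steiner_alg (map function_req fs)) f"
  assumes f: "\<forall>n\<in>{1..N}. function_request d (f n)" and x: "x 0 = 0" "\<forall>n\<in>{1..N}. x n \<in> Rd d"
  shows "service_cost f N p \<le> function_cost nrm f N x"
    and "movement_cost nrm N p \<le> real d * function_cost nrm f N x"
    and "1 \<le> d \<Longrightarrow> 2 \<le> N \<Longrightarrow> euclidean_norm_on_Rd d nrm \<Longrightarrow>
      movement_cost nrm N p \<le> 24 * sqrt (real d * ln (real N)) * function_cost nrm f N x"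
    and "0 \<le> function_cost nrm f N x"
proof -
  define r where "r = (\<lambda>n. function_req (f n))"
  interpret ch: chase d nrm r N x
    by unfold_locales (use f x request_function in \<open>auto simp: r_def function_req_def\<close>)
  have p: "p n = steiner_alg (pre r n)" for n unfolding p_def r_def by (rule play_map)
  have c: "traj_cost r x N = function_cost nrm f N x"
    by (simp add: traj_cost_def function_cost_def service_cost_def movement_cost_def r_def function_req_def sum.distrib)
  show "service_cost f N p \<le> function_cost nrm f N x"
    using ch.service_bound unfolding ch.c_def c by (simp add: service_cost_def p r_def function_req_def)
  show "movement_cost nrm N p \<le> real d * function_cost nrm f N x"
    using ch.movement_bound unfolding ch.c_def c movement_cost_def p .
  show "movement_cost nrm N p \<le> 24 * sqrt (real d * ln (real N)) * function_cost nrm f N x"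
    if "1 \<le> d" "2 \<le> N" "euclidean_norm_on_Rd d nrm"
    using euclidean_bound[OF ch.chase_axioms that] unfolding c movement_cost_def p .
  show "0 \<le> function_cost nrm f N x" using ch.c_nonneg unfolding ch.c_def c .
qed

lemma body_play_bounds:
  fixes K :: "nat \<Rightarrow> point set"
  defines "p \<equiv> play (\<lambda>Ks. steiner_alg (map body_req Ks)) K"
  assumes K: "\<forall>n\<in>{1..N}. body_request d (K n)" and x: "x 0 = 0" "\<forall>n\<in>{1..N}. x n \<in> K n"
  shows "movement_cost nrm N p \<le> real d * movement_cost nrm N x"
    and "1 \<le> d \<Longrightarrow> 2 \<le> N \<Longrightarrow> euclidean_norm_on_Rd d nrm \<Longrightarrow>
      movement_cost nrm N p \<le> 24 * sqrt (real d * ln (real N)) * movement_cost nrm N x"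
    and "0 \<le> movement_cost nrm N x"
proof -
  define r where "r = (\<lambda>n. body_req (K n))"
  interpret ch: chase d nrm r N x
    by unfold_locales (use K x request_body in \<open>auto simp: r_def body_req_def\<close>)
  have p: "p n = steiner_alg (pre r n)" for n unfolding p_def r_def by (rule play_map)
  have c: "traj_cost r x N = movement_cost nrm N x"
    by (simp add: traj_cost_def movement_cost_def r_def body_req_def)
  show "movement_cost nrm N p \<le> real d * movement_cost nrm N x"
    using ch.movement_bound unfolding ch.c_def c movement_cost_def p .
  show "movement_cost nrm N p \<le> 24 * sqrt (real d * ln (real N)) * movement_cost nrm N x"
    if "1 \<le> d" "2 \<le> N" "euclidean_norm_on_Rd d nrm"
    using euclidean_bound[OF ch.chase_axioms that] unfolding c movement_cost_def p .
  show "0 \<le> movement_cost nrm N x" using ch.c_nonneg unfolding ch.c_def c .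
qed

lemma le_function_OPT:
  assumes "\<And>x. x 0 = 0 \<Longrightarrow> \<forall>n\<in>{1..N}. x n \<in> Rd d \<Longrightarrow> y \<le> \<kappa> * function_cost nrm f N x" "0 \<le> \<kappa>"
  shows "y \<le> \<kappa> * function_OPT d nrm f N"
  unfolding function_OPT_def
proof (rule le_mult_Inf[OF _ _ assms(2)])
  show "{function_cost nrm f N x |x. x 0 = 0 \<and> (\<forall>n\<in>{1..N}. x n \<in> Rd d)} \<noteq> {}"
  proof -
    have "function_cost nrm f N (\<lambda>_. 0) \<in> {function_cost nrm f N x |x. x 0 = 0 \<and> (\<forall>n\<in>{1..N}. x n \<in> Rd d)}"
      unfolding mem_Collect_eq by (intro exI[of _ "\<lambda>_. 0"] conjI ballI refl Rd_closed_ops(1))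
    then show ?thesis unfolding ex_in_conv[symmetric] by (rule exI)
  qed
qed (use assms(1) in blast)

lemma le_body_OPT:
  assumes K: "\<forall>n\<in>{1..N}. body_request d (K n)"
    and "\<And>x. x 0 = 0 \<Longrightarrow> \<forall>n\<in>{1..N}. x n \<in> K n \<Longrightarrow> y \<le> \<kappa> * movement_cost nrm N x" "0 \<le> \<kappa>"
  shows "y \<le> \<kappa> * body_OPT nrm K N"
  unfolding body_OPT_def
proof (rule le_mult_Inf[OF _ _ assms(3)])
  have "\<forall>n\<in>{1..N}. \<exists>z. z \<in> K n" using K by (auto simp: body_request_def)
  then obtain z where z: "\<forall>n\<in>{1..N}. z n \<in> K n" by metis
  define x where "x = (\<lambda>n. if n = 0 then 0 else z n)"
  have "x 0 = 0" "\<forall>n\<in>{1..N}. x n \<in> K n" using z by (simp_all add: x_def)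
  then show "{movement_cost nrm N x |x. x 0 = 0 \<and> (\<forall>n\<in>{1..N}. x n \<in> K n)} \<noteq> {}" by blast
qed (use assms(2) in blast)

end

theorem theorem1p1:
  shows "\<exists>C::real. \<forall>(d::nat) (nrm::point \<Rightarrow> real). norm_on_Rd d nrm \<longrightarrow>
    (\<exists>A. function_algorithm d A \<and>
      (\<forall>N. function_competitive_at d nrm A N (real d + 1)) \<and>
      (\<forall>N f. (\<forall>n\<in>{1..N}. function_request d (f n)) \<longrightarrow>
        service_cost f N (play A f) \<le> function_OPT d nrm f N) \<and>
      (1 \<le> d \<and> euclidean_norm_on_Rd d nrm \<longrightarrow>
        (\<forall>N\<ge>2. function_competitive_at d nrm A N (C * sqrt (real d * ln (real N)))))) \<and>
    (\<exists>B. body_algorithm d B \<and>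
      (\<forall>N. body_competitive_at d nrm B N (real d)) \<and>
      (1 \<le> d \<and> euclidean_norm_on_Rd d nrm \<longrightarrow>
        (\<forall>N\<ge>2. body_competitive_at d nrm B N (C * sqrt (real d * ln (real N))))))"
proof (intro exI[of _ 26] allI impI)
  fix d :: nat and nrm :: "point \<Rightarrow> real"
  assume "norm_on_Rd d nrm"
  then interpret normed_Rd d nrm by unfold_locales
  let ?A = "\<lambda>fs. steiner_alg (map function_req fs)" and ?B = "\<lambda>Ks. steiner_alg (map body_req Ks)"
  define \<sigma> where "\<sigma> N = sqrt (real d * ln (real N))" for N :: nat
  \<comment> \<open>The service cost, at most the offline cost, is absorbed as 2 \<sigma> times that
    cost, whence 26 = 24 + 2; here ln 2 \<ge> 2 / 3 is used.\<close>
  have \<sigma>: "1 \<le> 2 * \<sigma> N" if "1 \<le> d" "2 \<le> N" for N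
  proof -
    have "ln 2 \<le> ln (real N)" using that by (subst ln_le_cancel_iff) auto
    then have "2 / 3 \<le> ln (real N)" using ln2_ge_two_thirds by linarith
    then have "1 * (1 / 4) \<le> real d * ln (real N)" using that by (intro mult_mono) auto
    then have "sqrt (1 / 4) \<le> \<sigma> N" unfolding \<sigma>_def by simp
    then show ?thesis by (simp add: real_sqrt_divide)
  qed
  have \<sigma>0: "0 \<le> \<sigma> N" if "1 \<le> d" "2 \<le> N" for N using \<sigma>[OF that] by linarith
  have fcost: "function_cost nrm f N p = service_cost f N p + movement_cost nrm N p" for f N p
    by (simp add: function_cost_def)
  have "function_algorithm d ?A"
    unfolding function_algorithm_def by (auto intro!: alg_Rd simp: valid_def request_function)
  moreover have "function_competitive_at d nrm ?A N (real d + 1)" for N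
    unfolding function_competitive_at_def
  proof (intro allI impI le_function_OPT)
    fix f and x :: "nat \<Rightarrow> point"
    assume "\<forall>n\<in>{1..N}. function_request d (f n)" "x 0 = 0" "\<forall>n\<in>{1..N}. x n \<in> Rd d"
    from function_play_bounds(1,2)[OF this]
    show "function_cost nrm f N (play ?A f) \<le> (real d + 1) * function_cost nrm f N x"
      unfolding fcost[of f N "play ?A f"] by (simp add: distrib_right)
  qed simp
  moreover have "service_cost f N (play ?A f) \<le> function_OPT d nrm f N"
    if f: "\<forall>n\<in>{1..N}. function_request d (f n)" for N f
    using le_function_OPT[of N "service_cost f N (play ?A f)" 1 f] function_play_bounds(1)[OF f] by simp
  moreover have "function_competitive_at d nrm ?A N (26 * sqrt (real d * ln (real N)))"
    if e: "1 \<le> d" "euclidean_norm_on_Rd d nrm" and N: "2 \<le> N" for N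
    unfolding function_competitive_at_def \<sigma>_def[symmetric]
  proof (intro allI impI le_function_OPT)
    fix f and x :: "nat \<Rightarrow> point"
    assume fx: "\<forall>n\<in>{1..N}. function_request d (f n)" "x 0 = 0" "\<forall>n\<in>{1..N}. x n \<in> Rd d"
    have "1 * function_cost nrm f N x \<le> 2 * \<sigma> N * function_cost nrm f N x"
      by (intro mult_right_mono \<sigma> e N function_play_bounds(4)[OF fx])
    then show "function_cost nrm f N (play ?A f) \<le> 26 * \<sigma> N * function_cost nrm f N x"
      using function_play_bounds(1)[OF fx] function_play_bounds(3)[OF fx e(1) N e(2)]
      unfolding fcost[of f N "play ?A f"] \<sigma>_def by linarith
  qed (use \<sigma>0[OF e(1) N] in simp)
  moreover have "body_algorithm d ?B"
    unfolding body_algorithm_def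
  proof (intro allI impI)
    fix Ks :: "point set list" assume Ks: "Ks \<noteq> [] \<and> (\<forall>K\<in>set Ks. body_request d K)"
    then have "fst (last (map body_req Ks)) = last Ks" by (simp add: last_map body_req_def)
    moreover have "closed (last Ks)"
    proof -
      have "body_request d (last Ks)" using Ks by simp
      then show ?thesis unfolding body_request_def using closedin_Euclidean_imp_closed by blast
    qed
    moreover have "valid (map body_req Ks)" using Ks by (auto simp: valid_def request_body)
    ultimately show "?B Ks \<in> last Ks" using alg_mem[of "map body_req Ks"] Ks by simp
  qed
  moreover have "body_competitive_at d nrm ?B N (real d)" for N
    unfolding body_competitive_at_def
    using le_body_OPT body_play_bounds(1) by (auto intro!: le_body_OPT)
  moreover have "body_competitive_at d nrm ?B N (26 * sqrt (real d * ln (real N)))"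
    if e: "1 \<le> d" "euclidean_norm_on_Rd d nrm" and N: "2 \<le> N" for N
    unfolding body_competitive_at_def \<sigma>_def[symmetric]
  proof (intro allI impI le_body_OPT)
    fix K and x :: "nat \<Rightarrow> point"
    assume Kx: "\<forall>n\<in>{1..N}. body_request d (K n)" "x 0 = 0" "\<forall>n\<in>{1..N}. x n \<in> K n"
    \<comment> \<open>Bodies have no service cost; 24 is only enlarged to the constant shared with
      functions.\<close>
    have "24 * \<sigma> N * movement_cost nrm N x \<le> 26 * \<sigma> N * movement_cost nrm N x"
      using \<sigma>0[OF e(1) N] by (intro mult_right_mono body_play_bounds(3)[OF Kx]) simp
    then show "movement_cost nrm N (play ?B K) \<le> 26 * \<sigma> N * movement_cost nrm N x"
      using body_play_bounds(2)[OF Kx e(1) N e(2)] unfolding \<sigma>_def by linarith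
  qed (use \<sigma>0[OF e(1) N] in auto)
  ultimately show "(\<exists>A. function_algorithm d A \<and>
      (\<forall>N. function_competitive_at d nrm A N (real d + 1)) \<and>
      (\<forall>N f. (\<forall>n\<in>{1..N}. function_request d (f n)) \<longrightarrow>
        service_cost f N (play A f) \<le> function_OPT d nrm f N) \<and>
      (1 \<le> d \<and> euclidean_norm_on_Rd d nrm \<longrightarrow>
        (\<forall>N\<ge>2. function_competitive_at d nrm A N (26 * sqrt (real d * ln (real N)))))) \<and>
    (\<exists>B. body_algorithm d B \<and>
      (\<forall>N. body_competitive_at d nrm B N (real d)) \<and>
      (1 \<le> d \<and> euclidean_norm_on_Rd d nrm \<longrightarrow>
        (\<forall>N\<ge>2. body_competitive_at d nrm B N (26 * sqrt (real d * ln (real N))))))"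
    by blast
qed

end
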